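(* Let $B(3)\subset\mathbb P^4$ be a cubic threefold, defined over a number field, with one singular point, which is an ordinary double point. Let $D=H_1\cup H_2$ where $H_1,H_2$ are two hyperplane sections of $B(3)$, defined over that number field, passing through the singular point. Then the set of integral points of $B(3)\setminus D$ is potentially dense.
   Context: Let $X\subset\mathbb P^n$ be a projective variety over a number field $\mathbb K$, let $D\subset X$ be a proper closed algebraic subset and let $X^o=X\setminus D$. For a finite set $S$ of places of $\mathbb K$ containing the archimedean ones, a point $P\in X^o(\mathbb K)$ is $S$-integral with respect to $D$ if for no place $\nu\notin S$ does $P$ reduce modulo $\nu$ to a point of $D$. The integral points of $X^o$ are potentially dense if, after replacing $\mathbb K$ by a suitable finite extension and enlarging the finite set $S$ suitably, the set of $S$-integral points of $X^o$ is Zariski-dense. *)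

theory Defs
  imports
    "HOL-Analysis.Analysis"
    "HOL-Computational_Algebra.Computational_Algebra"
    "HOL-Library.Poly_Mapping"
begin

section \<open>Polynomials in finitely many variables\<close>

text \<open>
  A polynomial in variables indexed by the finite type \<open>'n\<close> maps exponent vectors to
  coefficients; \<^theory>\<open>HOL-Library.Poly_Mapping\<close> supplies the ring structure.
\<close>

type_synonym 'n cpoly = "('n \<Rightarrow>\<^sub>0 nat) \<Rightarrow>\<^sub>0 complex"

definition eval_poly :: "'n::finite cpoly \<Rightarrow> complex ^ 'n \<Rightarrow> complex" where
  "eval_poly f x =
     (\<Sum>m\<in>Poly_Mapping.keys f.
        Poly_Mapping.lookup f m * (\<Prod>i\<in>UNIV. (x $ i) ^ Poly_Mapping.lookup m i))"

definition homogeneous :: "nat \<Rightarrow> 'n::finite cpoly \<Rightarrow> bool" where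
  "homogeneous d f \<longleftrightarrow>
     (\<forall>m\<in>Poly_Mapping.keys f. (\<Sum>i\<in>UNIV. Poly_Mapping.lookup m i) = d)"

definition coeffs_in :: "complex set \<Rightarrow> 'n::finite cpoly \<Rightarrow> bool" where
  "coeffs_in A f \<longleftrightarrow> (\<forall>m. Poly_Mapping.lookup f m \<in> A)"

definition partial_deriv :: "'n::finite \<Rightarrow> 'n cpoly \<Rightarrow> 'n cpoly" where
  "partial_deriv i f =
     (\<Sum>m\<in>Poly_Mapping.keys f.
        Poly_Mapping.single (m - Poly_Mapping.single i 1)
          (of_nat (Poly_Mapping.lookup m i) * Poly_Mapping.lookup f m))"


section \<open>Projective space and hypersurfaces\<close>

text \<open>
  Varieties over a number field (embedded in \<open>\<complex>\<close>) are given by their sets of complex points.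
  The type \<open>'n proj\<close> is projective space of dimension \<open>CARD('n) - 1\<close>: its points are
  the lines through the origin of \<open>\<complex>\<^sup>n\<close>.
\<close>

typedef 'n proj = "{l :: (complex ^ 'n) set. vec.subspace l \<and> vec.dim l = 1}"
proof -
  fix i :: 'n
  have "vec.dim {axis i (1::complex)} = card {axis i (1::complex)}"
    by (rule vec.dim_eq_card_independent) (simp add: vec.dependent_single axis_eq_0_iff)
  then have "vec.dim (vec.span {axis i (1::complex)}) = 1"
    by (simp add: vec.dim_span)
  then show ?thesis
    using vec.subspace_span by blast
qed

definition hom_coords :: "'n::finite proj \<Rightarrow> (complex ^ 'n) set" where
  "hom_coords P = Rep_proj P - {0}"

definition proj_zeros :: "'n::finite cpoly set \<Rightarrow> 'n proj set" where
  "proj_zeros T = {P. \<forall>f\<in>T. \<forall>x\<in>hom_coords P. eval_poly f x = 0}"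

definition zariski_closed :: "'n::finite proj set \<Rightarrow> bool" where
  "zariski_closed Z \<longleftrightarrow> (\<exists>T. (\<forall>f\<in>T. \<exists>d. homogeneous d f) \<and> Z = proj_zeros T)"

definition zariski_dense_in :: "'n::finite proj set \<Rightarrow> 'n proj set \<Rightarrow> bool" where
  "zariski_dense_in A Y \<longleftrightarrow>
     A \<subseteq> Y \<and> (\<forall>Z. zariski_closed Z \<and> A \<subseteq> Z \<longrightarrow> Y \<subseteq> Z)"

definition singular_points :: "'n::finite cpoly \<Rightarrow> 'n proj set" where
  "singular_points F = proj_zeros (insert F (range (\<lambda>i. partial_deriv i F)))"

text \<open>
  In the affine chart \<open>x\<^sub>i = 1\<close> a local equation of the hypersurface \<open>F = 0\<close> is \<open>F\<close> itself with
  \<open>x\<^sub>i\<close> set to 1, and its Hessian is that of \<open>F\<close> restricted to the tangent space \<open>v\<^sub>i = 0\<close> of the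
  chart. At a singular point, this Hessian is (twice) the quadratic form
  defining the tangent cone; the point is an ordinary double point if the form is nondegenerate.
\<close>

definition hessian_form ::
    "'n::finite cpoly \<Rightarrow> complex ^ 'n \<Rightarrow> complex ^ 'n \<Rightarrow> complex ^ 'n \<Rightarrow> complex" where
  "hessian_form F x v w =
     (\<Sum>j\<in>UNIV. \<Sum>k\<in>UNIV.
        eval_poly (partial_deriv j (partial_deriv k F)) x * v $ j * w $ k)"

definition ordinary_double_point :: "'n::finite cpoly \<Rightarrow> 'n proj \<Rightarrow> bool" where
  "ordinary_double_point F P \<longleftrightarrow>
     P \<in> singular_points F \<and>
     (\<exists>x\<in>hom_coords P. \<exists>i. x $ i = 1 \<and>
        (\<forall>v. v $ i = 0 \<and> (\<forall>w. w $ i = 0 \<longrightarrow> hessian_form F x v w = 0) \<longrightarrow> v = 0))"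


section \<open>Number fields and their finite places\<close>

text \<open>
  Number fields are taken inside \<open>\<complex>\<close>, so that a finite extension of \<open>K\<close> is a larger number
  field.
\<close>

definition number_field :: "complex set \<Rightarrow> bool" where
  "number_field K \<longleftrightarrow>
     1 \<in> K \<and> (\<forall>x\<in>K. \<forall>y\<in>K. x - y \<in> K \<and> x * y \<in> K) \<and> (\<forall>x\<in>K. inverse x \<in> K) \<and>
     (\<exists>E. finite E \<and> E \<subseteq> K \<and>
        (\<forall>x\<in>K. \<exists>c :: complex \<Rightarrow> rat. x = (\<Sum>e\<in>E. of_rat (c e) * e)))"

definition ring_of_integers :: "complex set \<Rightarrow> complex set" where
  "ring_of_integers K = {x \<in> K. algebraic_int x}"

text \<open>The non-archimedean places of \<open>K\<close> are the nonzero prime ideals of its ring of integers.\<close>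

definition finite_place :: "complex set \<Rightarrow> complex set \<Rightarrow> bool" where
  "finite_place K \<nu> \<longleftrightarrow>
     \<nu> \<subseteq> ring_of_integers K \<and> 0 \<in> \<nu> \<and> \<nu> \<noteq> {0} \<and> 1 \<notin> \<nu> \<and>
     (\<forall>a\<in>\<nu>. \<forall>b\<in>\<nu>. a + b \<in> \<nu>) \<and>
     (\<forall>a\<in>ring_of_integers K. \<forall>b\<in>\<nu>. a * b \<in> \<nu>) \<and>
     (\<forall>a\<in>ring_of_integers K. \<forall>b\<in>ring_of_integers K. a * b \<in> \<nu> \<longrightarrow> a \<in> \<nu> \<or> b \<in> \<nu>)"

definition local_ring :: "complex set \<Rightarrow> complex set \<Rightarrow> complex set" where
  "local_ring K \<nu> = {a / b | a b. a \<in> ring_of_integers K \<and> b \<in> ring_of_integers K - \<nu>}"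

definition local_max_ideal :: "complex set \<Rightarrow> complex set \<Rightarrow> complex set" where
  "local_max_ideal K \<nu> = {a / b | a b. a \<in> \<nu> \<and> b \<in> ring_of_integers K - \<nu>}"


section \<open>Integral points and potential density\<close>

definition rational_point :: "complex set \<Rightarrow> 'n::finite proj \<Rightarrow> bool" where
  "rational_point K P \<longleftrightarrow> (\<exists>x\<in>hom_coords P. \<forall>i. x $ i \<in> K)"

text \<open>
  To reduce a \<open>K\<close>-rational point modulo \<open>\<nu>\<close>, scale its coordinates so that they are
  \<open>\<nu>\<close>-integral and not all in the maximal ideal (always possible, the local ring being a discrete
  valuation ring). The reduction of \<open>D\<close> is the special fibre of the Zariski closure of \<open>D\<close> in
  projective space over the local ring, i.e. it is cut out by the reductions of all forms with
  \<open>\<nu>\<close>-integral coefficients that vanish on \<open>D\<close>.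
\<close>

definition reduces_into ::
    "complex set \<Rightarrow> complex set \<Rightarrow> 'n::finite proj set \<Rightarrow> 'n proj \<Rightarrow> bool" where
  "reduces_into K \<nu> D P \<longleftrightarrow>
     (\<exists>x\<in>hom_coords P.
        (\<forall>i. x $ i \<in> local_ring K \<nu>) \<and> (\<exists>i. x $ i \<notin> local_max_ideal K \<nu>) \<and>
        (\<forall>d f. homogeneous d f \<and> coeffs_in (local_ring K \<nu>) f \<and> D \<subseteq> proj_zeros {f} \<longrightarrow>
           eval_poly f x \<in> local_max_ideal K \<nu>))"

text \<open>
  In the following, \<open>S\<close> stands for the set of the finite places in question together with all
  (finitely many) archimedean places, which impose no condition.
\<close>

definition integral_points ::
    "complex set \<Rightarrow> complex set set \<Rightarrow> 'n::finite proj set \<Rightarrow> 'n proj set \<Rightarrow> 'n proj set" where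
  "integral_points K S X D =
     {P \<in> X - D. rational_point K P \<and> (\<forall>\<nu>. finite_place K \<nu> \<and> \<nu> \<notin> S \<longrightarrow> \<not> reduces_into K \<nu> D P)}"

text \<open>
  No initial \<open>S\<close> is mentioned below: enlarging \<open>S\<close> only enlarges the set of \<open>S\<close>-integral points.
\<close>

definition potentially_dense ::
    "complex set \<Rightarrow> 'n::finite proj set \<Rightarrow> 'n proj set \<Rightarrow> bool" where
  "potentially_dense K X D \<longleftrightarrow>
     (\<exists>L S. number_field L \<and> K \<subseteq> L \<and> finite S \<and> (\<forall>\<nu>\<in>S. finite_place L \<nu>) \<and>
        zariski_dense_in (integral_points L S X D) (X - D))"


section \<open>Cubic threefolds and hyperplane sections\<close>

definition cubic_threefold_form :: "complex set \<Rightarrow> 5 cpoly \<Rightarrow> bool" where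
  "cubic_threefold_form K F \<longleftrightarrow> homogeneous 3 F \<and> irreducible F \<and> coeffs_in K F"

definition hyperplane_section :: "complex set \<Rightarrow> 'n::finite proj set \<Rightarrow> 'n proj set \<Rightarrow> bool" where
  "hyperplane_section K X H \<longleftrightarrow>
     (\<exists>l. l \<noteq> 0 \<and> homogeneous 1 l \<and> coeffs_in K l \<and> H = X \<inter> proj_zeros {l})"

end

theory Submission
  imports Defs
begin

text \<open>
  With the node at \<open>p\<close>, the cubic form satisfies \<open>F(y + r p) = C(y) + r Q(y)\<close>, with \<open>Q\<close> the form defining
  the tangent cone, so the cubic is parametrized by \<open>y \<mapsto> Q(y) y - C(y) p\<close>. After a finite extension of
  the number field there are vectors \<open>a\<^sub>0\<close>, \<open>a\<^sub>1\<close> dual to the two linear forms and, in their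
  common kernel, \<open>f\<close> and a \<open>Q\<close>-isotropic \<open>e\<close>. If \<open>y = a\<^sub>0 + u a\<^sub>1 + s f + t e\<close> has \<open>S\<close>-integral coordinates, \<open>u\<close>
  is an \<open>S\<close>-unit and \<open>Q(y)\<close> is an \<open>S\<close>-unit, then \<open>y - (C(y) / Q(y)) p\<close> is an integral point, as the two linear
  forms take the unit values \<open>1\<close> and \<open>u\<close> there. Since \<open>e\<close> is isotropic, \<open>Q(y)\<close> is affine in \<open>t\<close>,
  and every suitable \<open>(u, s)\<close> admits infinitely many \<open>t\<close>, because units lie in infinitely many
  ways in a residue class of a unit.

  That the node and the frame can be taken over a number field follows by specialization: the
  finitely generated ring of their coordinates has a homomorphism to a number field that fixes the
  base field, and the image of the node is again a singular point, hence the node itself.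
\<close>

section \<open>Rings of algebraic integers\<close>

text \<open>No unit theorem is used: \<open>S\<close> contains the places above 2, and the powers of
  2 supply all the infinitely many units that are needed. The equation to solve is
  \<open>t * slope u s + g u s = unit\<close> in S-integers \<open>t\<close>, so \<open>g\<close>
  must be congruent to a unit modulo the slope, and the slope cannot always be made a unit. If it
  involves \<open>s\<close>, then \<open>s\<close> can be chosen to make it a power of 2. If it
  reduces to a constant or to a constant times \<open>u\<close>, enlarging \<open>S\<close> makes it
  a unit. The obstacle is the slope \<open>\<alpha> + \<beta> * u\<close> with both coefficients
  nonzero. Modulo it, \<open>u\<close> is congruent to the constant
  \<open>- \<alpha> / \<beta>\<close>, so along a progression of values \<open>s\<close> the value
  \<open>g\<close> stays congruent to one constant. Nondegeneracy of the tangent cone allows this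
  constant to be nonzero, and it is then a unit for large \<open>S\<close>. For this reason
  \<open>S\<close> is fixed only after the frame.\<close>

locale subring =
  fixes A :: "'a::comm_ring_1 set"
  assumes one_closed: "1 \<in> A"
    and diff_closed: "\<And>x y. x \<in> A \<Longrightarrow> y \<in> A \<Longrightarrow> x - y \<in> A"
    and mult_closed: "\<And>x y. x \<in> A \<Longrightarrow> y \<in> A \<Longrightarrow> x * y \<in> A"
begin

lemma zero_closed: "0 \<in> A"
  using diff_closed[OF one_closed one_closed] by simp

lemma uminus_closed: "x \<in> A \<Longrightarrow> - x \<in> A"
  using diff_closed[OF zero_closed] by force

lemma add_closed: "x \<in> A \<Longrightarrow> y \<in> A \<Longrightarrow> x + y \<in> A"
  using diff_closed[OF _ uminus_closed, of x y] by simp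

lemma power_closed: "x \<in> A \<Longrightarrow> x ^ n \<in> A"
  by (induction n) (auto intro: one_closed mult_closed)

lemma sum_closed: "(\<And>i. i \<in> I \<Longrightarrow> f i \<in> A) \<Longrightarrow> sum f I \<in> A"
  by (induction I rule: infinite_finite_induct) (auto intro: zero_closed add_closed)

lemma prod_closed: "(\<And>i. i \<in> I \<Longrightarrow> f i \<in> A) \<Longrightarrow> prod f I \<in> A"
  by (induction I rule: infinite_finite_induct) (auto intro: one_closed mult_closed)

lemma of_nat_closed: "of_nat n \<in> A"
  by (induction n) (auto intro: zero_closed one_closed add_closed)

lemma of_int_closed: "of_int n \<in> A"
  by (cases n) (auto intro: of_nat_closed uminus_closed simp del: of_nat_Suc)

lemma numeral_closed: "numeral n \<in> A"
  using of_nat_closed[of "numeral n"] by simp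

lemmas closed = zero_closed one_closed add_closed diff_closed uminus_closed mult_closed
  power_closed of_nat_closed of_int_closed numeral_closed

end

section \<open>Finitely generated additive subgroups of the complex numbers and integrality\<close>

interpretation zmod: module "\<lambda>(n::int) (x::complex). of_int n * x"
  by unfold_locales (auto simp: algebra_simps)

text \<open>Noetherianity of the integers, by induction on the generators. The coefficients that the
  new generator \<open>b\<close> takes in \<open>H\<close>, modulo the span of \<open>B\<close>,
  form the ideal \<open>J\<close>. A nonzero element of least absolute value generates
  \<open>J\<close>, and a lift \<open>k\<close> of it, together with generators of the part of
  \<open>H\<close> inside the span of \<open>B\<close>, generates \<open>H\<close>.\<close>

lemma zmod_subspace_fg:
  assumes "finite B" "zmod.subspace H" "H \<subseteq> zmod.span B"
  shows "\<exists>C. finite C \<and> H = zmod.span C"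
  using assms
proof (induction B arbitrary: H rule: finite_induct)
  case empty
  then have "H = zmod.span {}"
    using zmod.subspace_0 by auto
  then show ?case by blast
next
  case (insert b B)
  have "zmod.subspace (H \<inter> zmod.span B)"
    by (simp add: insert.prems zmod.subspace_inter)
  from insert.IH[OF this] obtain C where C: "finite C" "H \<inter> zmod.span B = zmod.span C"
    by auto
  define J where "J = {n. \<exists>g\<in>zmod.span B. g + of_int n * b \<in> H}"
  have decomp: "\<exists>n. h - of_int n * b \<in> zmod.span B" if "h \<in> H" for h
    using that insert.prems(2) zmod.span_breakdown_eq by blast
  show ?case
  proof (cases "J \<subseteq> {0}")
    case True
    have "H \<subseteq> zmod.span B"
    proof
      fix h assume h: "h \<in> H"
      then obtain n where n: "h - of_int n * b \<in> zmod.span B" using decomp by blast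
      then have "n \<in> J" unfolding J_def using h by force
      with True n show "h \<in> zmod.span B" by auto
    qed
    then show ?thesis using C by auto
  next
    case False
    define d where "d = (ARG_MIN (\<lambda>n. nat \<bar>n\<bar>) n. n \<in> J \<and> n \<noteq> 0)"
    from False obtain n0 where "n0 \<in> J \<and> n0 \<noteq> 0" by auto
    then have d: "d \<in> J" "d \<noteq> 0" and dmin: "\<And>n. n \<in> J \<Longrightarrow> n \<noteq> 0 \<Longrightarrow> nat \<bar>d\<bar> \<le> nat \<bar>n\<bar>"
      unfolding d_def using arg_min_natI[of "\<lambda>n. n \<in> J \<and> n \<noteq> 0" n0 "\<lambda>n. nat \<bar>n\<bar>"]
        arg_min_nat_le[of "\<lambda>n. n \<in> J \<and> n \<noteq> 0" _ "\<lambda>n. nat \<bar>n\<bar>"] by blast+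
    from d obtain g where g: "g \<in> zmod.span B" "g + of_int d * b \<in> H"
      unfolding J_def by auto
    define k where "k = g + of_int d * b"
    have "H = zmod.span (insert k C)"
    proof
      show "zmod.span (insert k C) \<subseteq> H"
        by (rule zmod.span_minimal) (use C g k_def insert.prems zmod.span_superset in auto)
      show "H \<subseteq> zmod.span (insert k C)"
      proof
        fix h assume h: "h \<in> H"
        then obtain n where n: "h - of_int n * b \<in> zmod.span B" using decomp by blast
        define q where "q = n div d"
        have e: "h - of_int q * k = (h - of_int n * b - of_int q * g) + of_int (n mod d) * b"
          unfolding k_def q_def minus_div_mult_eq_mod[symmetric] by (simp add: algebra_simps)
        have hq: "h - of_int q * k \<in> H"
          using zmod.subspace_diff[OF insert.prems(1) h]
            zmod.subspace_scale[OF insert.prems(1) g(2), of q] k_def by blast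
        have s: "h - of_int n * b - of_int q * g \<in> zmod.span B"
          using zmod.span_diff[OF n] zmod.span_scale[OF g(1), of q] by blast
        have "n mod d \<in> J" unfolding J_def using s hq e by auto
        moreover have "nat \<bar>n mod d\<bar> < nat \<bar>d\<bar>"
          using d(2) by (simp add: abs_mod_less)
        ultimately have "n mod d = 0" using dmin[of "n mod d"] by linarith
        with e have "h - of_int q * k = h - of_int n * b - of_int q * g" by simp
        with s have "h - of_int q * k \<in> zmod.span B" by (simp only:)
        with hq have "h - of_int q * k \<in> zmod.span C"
          using C(2) by blast
        then show "h \<in> zmod.span (insert k C)"
          unfolding zmod.span_breakdown_eq by blast
      qed
    qed
    then show ?thesis using C by blast
  qed
qed

lemma zmod_span_image_lessThan:
  fixes f :: "nat \<Rightarrow> complex"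
  assumes "x \<in> zmod.span (f ` {..<k})"
  shows "\<exists>c. x = (\<Sum>i<k. of_int (c i) * f i)"
  using assms
proof (induction rule: zmod.span_induct)
  case base
  show ?case
    unfolding zmod.subspace_def
  proof (intro conjI allI ballI)
    show "0 \<in> {x. \<exists>c. x = (\<Sum>i<k. of_int (c i) * f i)}"
      by (auto intro!: exI[of _ "\<lambda>_. 0"])
  next
    fix x y
    assume "x \<in> {x. \<exists>c. x = (\<Sum>i<k. of_int (c i) * f i)}"
      "y \<in> {x. \<exists>c. x = (\<Sum>i<k. of_int (c i) * f i)}"
    then obtain c d where "x = (\<Sum>i<k. of_int (c i) * f i)" "y = (\<Sum>i<k. of_int (d i) * f i)"
      by auto
    then show "x + y \<in> {x. \<exists>c. x = (\<Sum>i<k. of_int (c i) * f i)}"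
      by (auto intro!: exI[of _ "\<lambda>i. c i + d i"] simp: sum.distrib algebra_simps)
  next
    fix n x
    assume "x \<in> {x. \<exists>c. x = (\<Sum>i<k. of_int (c i) * f i)}"
    then obtain c where "x = (\<Sum>i<k. of_int (c i) * f i)" by auto
    then show "of_int n * x \<in> {x. \<exists>c. x = (\<Sum>i<k. of_int (c i) * f i)}"
      by (auto intro!: exI[of _ "\<lambda>i. n * c i"] simp: sum_distrib_left algebra_simps)
  qed
next
  case (step x)
  then obtain j where "j < k" "x = f j" by auto
  then have "(\<Sum>i<k. of_int (if i = j then 1 else 0) * f i) = x"
    by (simp add: if_distrib[of of_int] if_distrib[of "\<lambda>a. a * _"] sum.delta cong: if_cong)
  then show ?case by metis
qed

text \<open>Noetherianity replaces the Cayley-Hamilton theorem: the group generated by all powers of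
  \<open>z\<close> is finitely generated, hence generated by the powers below some \<open>m\<close>,
  and expressing \<open>z ^ m\<close> through these is a monic equation.\<close>

lemma algebraic_intI_zspan:
  fixes z :: complex
  assumes "finite B" "\<And>i. z ^ i \<in> zmod.span B"
  shows "algebraic_int z"
proof -
  define H where "H = zmod.span (range (\<lambda>i. z ^ i))"
  have "H \<subseteq> zmod.span B"
    unfolding H_def by (rule zmod.span_minimal) (use assms in auto)
  then obtain C where C: "finite C" "H = zmod.span C"
    using zmod_subspace_fg[OF assms(1)] H_def by blast
  have "\<exists>k. c \<in> zmod.span ((\<lambda>i. z ^ i) ` {..<k})" if "c \<in> C" for c
  proof -
    have "c \<in> H" using that C zmod.span_superset by auto
    then obtain t r where t: "finite t" "t \<subseteq> range (\<lambda>i. z ^ i)"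
      and "c = (\<Sum>a\<in>t. of_int (r a) * a)"
      unfolding H_def zmod.span_explicit by auto
    then have ct: "c \<in> zmod.span t"
      by (simp add: zmod.span_sum zmod.span_scale zmod.span_base)
    from finite_subset_image[OF t(1,2)] obtain I where I: "finite I" "t = (\<lambda>i. z ^ i) ` I"
      by auto
    from I(1) obtain k where "I \<subseteq> {..<k}"
      using finite_nat_iff_bounded by blast
    then show ?thesis using ct I zmod.span_mono[of t "(\<lambda>i. z ^ i) ` {..<k}"] by blast
  qed
  then obtain k where k: "\<And>c. c \<in> C \<Longrightarrow> c \<in> zmod.span ((\<lambda>i. z ^ i) ` {..<k c})"
    by metis
  define m where "m = Max (insert 0 (k ` C))"
  have "C \<subseteq> zmod.span ((\<lambda>i. z ^ i) ` {..<m})"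
  proof
    fix c assume c: "c \<in> C"
    have "k c \<le> m" unfolding m_def using c C by auto
    then have "(\<lambda>i. z ^ i) ` {..<k c} \<subseteq> (\<lambda>i. z ^ i) ` {..<m}" by auto
    then show "c \<in> zmod.span ((\<lambda>i. z ^ i) ` {..<m})" using k[OF c] zmod.span_mono by blast
  qed
  then have "H \<subseteq> zmod.span ((\<lambda>i. z ^ i) ` {..<m})"
    unfolding C by (simp add: zmod.span_minimal)
  moreover have "z ^ m \<in> H" unfolding H_def by (simp add: zmod.span_base)
  ultimately obtain c where c: "z ^ m = (\<Sum>i<m. of_int (c i) * z ^ i)"
    using zmod_span_image_lessThan[of "z ^ m" "\<lambda>i. z ^ i" m] by blast
  define p where "p = monom 1 m - (\<Sum>i<m. monom (of_int (c i) :: complex) i)"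
  have co: "coeff p i = (if i = m then 1 else if i < m then - of_int (c i) else 0)" for i
    unfolding p_def by (auto simp: coeff_sum)
  have "degree p = m"
    by (rule antisym[OF degree_le le_degree]) (auto simp: co)
  moreover have "poly p z = 0"
    unfolding p_def by (simp add: poly_sum poly_monom c)
  ultimately show ?thesis
    by (intro algebraic_int.intros[of p]) (auto simp: co)
qed

lemma algebraic_int_powers_zspan:
  fixes x :: complex
  assumes "algebraic_int x"
  shows "\<exists>B. finite B \<and> (\<forall>i. x ^ i \<in> zmod.span B)"
proof -
  from assms obtain p where p: "lead_coeff p = 1" "\<And>i. coeff p i \<in> \<int>" "poly p x = 0"
    by (auto elim: algebraic_int.cases)
  define k where "k = degree p"
  define B where "B = (\<lambda>i. x ^ i) ` {..<k}"
  have pk: "x ^ k = (\<Sum>i<k. - coeff p i * x ^ i)"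
    using p(3,1) unfolding poly_altdef k_def[symmetric]
    by (simp add: lessThan_Suc_atMost[symmetric] sum_negf eq_neg_iff_add_eq_0 add.commute)
  have xk: "x ^ k \<in> zmod.span B" unfolding pk
  proof (rule zmod.span_sum)
    fix i assume i: "i \<in> {..<k}"
    obtain n where "coeff p i = of_int n" using p(2)[of i] by (auto elim: Ints_cases)
    then show "- coeff p i * x ^ i \<in> zmod.span B"
      using zmod.span_scale[OF zmod.span_base[of "x ^ i" B], of "- n"] i by (auto simp: B_def)
  qed
  have step: "x * v \<in> zmod.span B" if "v \<in> zmod.span B" for v
    using that
  proof (induction rule: zmod.span_induct)
    case base
    show ?case
      using zmod.span_add[of "x * _" B "x * _"] zmod.span_scale[of "x * _" B]
      unfolding zmod.subspace_def mem_Collect_eq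
      by (simp only: distrib_left mult.left_commute[of x])
        (auto simp: zmod.span_zero)
  next
    case (step v)
    then obtain i where i: "i < k" "v = x ^ i" unfolding B_def by auto
    show ?case
    proof (cases "Suc i = k")
      case True
      then show ?thesis using xk i by auto
    next
      case False
      then have "x ^ Suc i \<in> B" unfolding B_def using i by (intro imageI) auto
      then show ?thesis using i zmod.span_base by auto
    qed
  qed
  have "k \<noteq> 0" using pk by (cases "k = 0") auto
  have "x ^ i \<in> zmod.span B" for i
  proof (induction i)
    case 0
    have "x ^ 0 \<in> B" unfolding B_def using \<open>k \<noteq> 0\<close> by (intro imageI) auto
    then show ?case using zmod.span_base by blast
  qed (use step in simp)
  then show ?thesis unfolding B_def by blast
qed

lemma zmod_span_mult:
  assumes "a \<in> zmod.span S" "b \<in> zmod.span T"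
  shows "a * b \<in> zmod.span ((\<lambda>(s, t). s * t) ` (S \<times> T))" (is "_ \<in> ?U")
proof -
  have 1: "s * b \<in> ?U" if s: "s \<in> S" for s
    using assms(2)
  proof (induction rule: zmod.span_induct)
    case base
    show ?case
      unfolding zmod.subspace_def
      using zmod.span_add[of "s * _" _ "s * _"] zmod.span_scale[of "s * _"]
      by (simp only: distrib_left mult.left_commute[of s] mem_Collect_eq)
        (auto simp: zmod.span_zero)
  next
    case (step x)
    then show ?case using s by (intro zmod.span_base) force
  qed
  show ?thesis
    using assms(1)
  proof (induction rule: zmod.span_induct)
    case base
    show ?case
      unfolding zmod.subspace_def
      using zmod.span_add[of "_ * b" _ "_ * b"] zmod.span_scale[of "_ * b"]
      by (simp only: distrib_right mult.assoc mem_Collect_eq)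
        (auto simp: zmod.span_zero)
  qed (use 1 in auto)
qed

text \<open>The powers of a sum or product are integer combinations of products of a power of
  \<open>x\<close> and a power of \<open>y\<close>, all of which lie in one finitely generated
  group.\<close>

lemma algebraic_int_add_mult:
  fixes x y :: complex
  assumes "algebraic_int x" "algebraic_int y"
  shows "algebraic_int (x + y)" "algebraic_int (x * y)"
proof -
  obtain S where S: "finite S" "\<And>i. x ^ i \<in> zmod.span S"
    using algebraic_int_powers_zspan[OF assms(1)] by blast
  obtain T where T: "finite T" "\<And>i. y ^ i \<in> zmod.span T"
    using algebraic_int_powers_zspan[OF assms(2)] by blast
  define U where "U = (\<lambda>(s, t). s * t) ` (S \<times> T)"
  have fin: "finite U" unfolding U_def using S T by auto
  have *: "x ^ i * y ^ j \<in> zmod.span U" for i j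
    unfolding U_def by (rule zmod_span_mult[OF S(2) T(2)])
  show "algebraic_int (x * y)"
    by (rule algebraic_intI_zspan[OF fin]) (simp add: power_mult_distrib *)
  have "(x + y) ^ n \<in> zmod.span U" for n
    unfolding binomial_ring
  proof (rule zmod.span_sum)
    fix k
    show "of_nat (n choose k) * x ^ k * y ^ (n - k) \<in> zmod.span U"
      using zmod.span_scale[OF *[of k "n - k"], of "int (n choose k)"] by (simp add: mult.assoc)
  qed
  then show "algebraic_int (x + y)"
    by (rule algebraic_intI_zspan[OF fin])
qed

section \<open>Number fields\<close>

context subring begin

definition polys :: "'a poly set" where
  "polys = {p. \<forall>i. coeff p i \<in> A}"

lemma polysD: "p \<in> polys \<Longrightarrow> coeff p i \<in> A"
  by (simp add: polys_def)

lemma subring_polys: "subring polys"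
  unfolding polys_def
  by unfold_locales (auto simp: coeff_mult intro!: sum_closed closed)

lemma pCons_in_polys: "pCons a p \<in> polys \<longleftrightarrow> a \<in> A \<and> p \<in> polys"
  unfolding polys_def by (auto simp: coeff_pCons split: nat.splits)

lemma monom_in_polys: "a \<in> A \<Longrightarrow> monom a n \<in> polys"
  unfolding polys_def by (auto simp: closed)

lemma smult_in_polys: "a \<in> A \<Longrightarrow> p \<in> polys \<Longrightarrow> smult a p \<in> polys"
  unfolding polys_def by (auto intro: closed)

lemma poly_in: "p \<in> polys \<Longrightarrow> x \<in> A \<Longrightarrow> poly p x \<in> A"
  unfolding poly_altdef by (auto intro!: closed sum_closed polysD)

definition adjoin :: "'a \<Rightarrow> 'a set" where
  "adjoin b = (\<lambda>p. poly p b) ` polys"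

lemma subring_adjoin: "subring (adjoin b)"
proof -
  interpret P: subring polys by (rule subring_polys)
  show ?thesis
    unfolding adjoin_def
  proof unfold_locales
    show "1 \<in> (\<lambda>p. poly p b) ` polys"
      by (rule image_eqI[of _ _ 1]) (auto intro: P.closed)
  qed (auto simp flip: poly_diff poly_mult intro!: imageI P.closed)
qed

lemma adjoin_base: "A \<subseteq> adjoin b" and adjoin_self: "b \<in> adjoin b"
proof -
  have "a \<in> adjoin b" if "a \<in> A" for a
    unfolding adjoin_def
    by (rule image_eqI[of _ _ "monom a 0"]) (auto simp: poly_monom intro: monom_in_polys that)
  moreover have "b \<in> adjoin b"
    unfolding adjoin_def
    by (rule image_eqI[of _ _ "monom 1 1"]) (auto simp: poly_monom intro: monom_in_polys closed)
  ultimately show "A \<subseteq> adjoin b" "b \<in> adjoin b" by auto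
qed

end

section \<open>Finite rational dimension and algebraicity\<close>

interpretation ratvs: vector_space "\<lambda>(q::rat) (x::complex). of_rat q * x"
  by unfold_locales (auto simp: algebra_simps of_rat_add of_rat_mult)

lemma number_field_subring: "number_field K \<Longrightarrow> subring K"
  unfolding number_field_def subring_def by auto

lemma number_field_inverse: "number_field K \<Longrightarrow> x \<in> K \<Longrightarrow> inverse x \<in> K"
  unfolding number_field_def by auto

lemma number_field_divide: "number_field K \<Longrightarrow> x \<in> K \<Longrightarrow> y \<in> K \<Longrightarrow> x / y \<in> K"
  using subring.mult_closed[OF number_field_subring] number_field_inverse
  by (simp add: divide_inverse)

lemma number_field_of_rat: "number_field K \<Longrightarrow> of_rat q \<in> K"
  by (cases q) (auto simp: of_rat_rat intro!: number_field_divide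
      subring.of_int_closed[OF number_field_subring])

lemma number_field_finite_span:
  assumes "number_field K"
  shows "\<exists>E. finite E \<and> E \<subseteq> K \<and> K \<subseteq> ratvs.span E"
proof -
  obtain E where E: "finite E" "E \<subseteq> K"
    "\<And>x. x \<in> K \<Longrightarrow> \<exists>c :: complex \<Rightarrow> rat. x = (\<Sum>e\<in>E. of_rat (c e) * e)"
    using assms unfolding number_field_def by metis
  have "x \<in> ratvs.span E" if x: "x \<in> K" for x
  proof -
    obtain c :: "complex \<Rightarrow> rat" where "x = (\<Sum>e\<in>E. of_rat (c e) * e)" using E(3)[OF x] by auto
    then show ?thesis by (simp add: ratvs.span_sum ratvs.span_scale ratvs.span_base)
  qed
  then show ?thesis using E by blast
qed

text \<open>Stated for families, since a family with a repetition is dependent even if its set of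
  values is not; there the relation is the difference of two equal terms.\<close>

lemma ratvs_dependence:
  fixes f :: "nat \<Rightarrow> complex"
  assumes "finite E" "\<And>i. i \<le> card E \<Longrightarrow> f i \<in> ratvs.span E"
  shows "\<exists>c. (\<exists>i\<le>card E. c i \<noteq> 0) \<and> (\<Sum>i\<le>card E. of_rat (c i) * f i) = 0"
proof (cases "inj_on f {..card E}")
  case True
  then have "card (f ` {..card E}) = Suc (card E)" by (simp add: card_image)
  then have "ratvs.dependent (f ` {..card E})"
    using ratvs.independent_span_bound[OF assms(1), of "f ` {..card E}"] assms(2) by fastforce
  then obtain u v where u: "v \<in> f ` {..card E}" "u v \<noteq> 0"
    "(\<Sum>v\<in>f ` {..card E}. of_rat (u v) * v) = 0"
    using ratvs.dependent_finite[of "f ` {..card E}"] by auto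
  then show ?thesis
    by (intro exI[of _ "u \<circ> f"]) (auto simp: sum.reindex[OF True])
next
  case False
  then obtain i j where ij: "i \<le> card E" "j \<le> card E" "i \<noteq> j" "f i = f j"
    by (auto simp: inj_on_def)
  define c :: "nat \<Rightarrow> rat" where "c l = (if l = i then 1 else 0) - (if l = j then 1 else 0)" for l
  have "of_rat (c l) * f l = (if l = i then f l else 0) - (if l = j then f l else 0)" for l
    by (auto simp: c_def)
  then have "(\<Sum>l\<le>card E. of_rat (c l) * f l) = 0"
    using ij by (simp add: sum_subtractf sum.delta)
  moreover have "c i \<noteq> 0" using ij by (simp add: c_def)
  ultimately show ?thesis using ij by blast
qed

lemma algebraic_if_finite_span:
  assumes "subring A" "finite E" "A \<subseteq> ratvs.span E" "x \<in> A"
  shows "algebraic x"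
proof -
  interpret subring A by fact
  obtain c where c: "\<exists>i\<le>card E. c i \<noteq> 0" "(\<Sum>i\<le>card E. of_rat (c i) * x ^ i) = 0"
    using ratvs_dependence[OF assms(2), of "\<lambda>i. x ^ i"] assms(3) power_closed[OF assms(4)] by blast
  define p where "p = (\<Sum>i\<le>card E. monom (of_rat (c i) :: complex) i)"
  have co: "coeff p i = (if i \<le> card E then of_rat (c i) else 0)" for i
    unfolding p_def by (auto simp: coeff_sum)
  have "p \<noteq> 0" using c(1) co by (metis coeff_0 of_rat_eq_0_iff)
  moreover have "poly p x = 0" unfolding p_def by (simp add: poly_sum poly_monom c)
  ultimately show ?thesis
    unfolding algebraic_altdef by (intro exI[of _ p]) (auto simp: co)
qed

lemma number_field_algebraic: "number_field K \<Longrightarrow> x \<in> K \<Longrightarrow> algebraic x"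
  using algebraic_if_finite_span[OF number_field_subring] number_field_finite_span by blast

text \<open>Multiplying the equation of \<open>x\<close> by the power \<open>d ^ (n - 1)\<close> of
  its leading coefficient turns it into a monic integer equation for \<open>d * x\<close>.\<close>

lemma algebraic_imp_multiple_algebraic_int:
  fixes x :: complex
  assumes "algebraic x"
  shows "\<exists>N>0. algebraic_int (of_nat N * x)"
proof -
  obtain p where p: "\<And>i. coeff p i \<in> \<int>" "p \<noteq> 0" "poly p x = 0"
    using assms by (auto elim!: algebraicE)
  define n d where "n = degree p" and "d = lead_coeff p"
  have d0: "d \<noteq> 0" using p d_def by simp
  have n0: "n \<noteq> 0"
  proof
    assume "n = 0"
    then obtain a where "p = [:a:]" unfolding n_def by (auto elim!: degree_eq_zeroE)
    then show False using p by simp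
  qed
  define q where "q = monom 1 n + (\<Sum>i<n. monom (coeff p i * d ^ (n - 1 - i)) i)"
  have co: "coeff q i = (if i = n then 1 else if i < n then coeff p i * d ^ (n - 1 - i) else 0)" for i
    unfolding q_def by (auto simp: coeff_sum)
  have deg: "degree q = n"
    by (rule antisym[OF degree_le le_degree]) (auto simp: co)
  have "d * x ^ n + (\<Sum>i<n. coeff p i * x ^ i) = 0"
    using p(3) unfolding poly_altdef n_def[symmetric]
    by (simp add: lessThan_Suc_atMost[symmetric] d_def n_def add.commute)
  then have "d ^ (n - 1) * (d * x ^ n + (\<Sum>i<n. coeff p i * x ^ i)) = 0" by simp
  moreover have "d ^ (n - 1) * (d * x ^ n) = (d * x) ^ n"
    using n0 by (cases n) (auto simp: power_mult_distrib)
  moreover have "(\<Sum>i<n. d ^ (n - 1) * (coeff p i * x ^ i)) = (\<Sum>i<n. coeff p i * d ^ (n - 1 - i) * (d * x) ^ i)"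
  proof (rule sum.cong)
    fix i assume i: "i \<in> {..<n}"
    have "d ^ (n - 1) = d ^ (n - 1 - i) * d ^ i" using i by (simp flip: power_add)
    then show "d ^ (n - 1) * (coeff p i * x ^ i) = coeff p i * d ^ (n - 1 - i) * (d * x) ^ i"
      by (simp add: power_mult_distrib)
  qed simp
  ultimately have "(d * x) ^ n + (\<Sum>i<n. coeff p i * d ^ (n - 1 - i) * (d * x) ^ i) = 0"
    unfolding distrib_left sum_distrib_left by simp
  then have "poly q (d * x) = 0"
    unfolding q_def by (simp add: poly_sum poly_monom)
  then have ai: "algebraic_int (d * x)"
    using p(1) by (intro algebraic_int.intros[of q]) (auto simp: co deg d_def)
  obtain m where m: "d = of_int m" using p(1) d_def by (metis Ints_cases)
  have "algebraic_int (of_nat (nat \<bar>m\<bar>) * x)"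
    using ai m algebraic_int_minus[OF ai] by (cases "m \<ge> 0") auto
  then show ?thesis using m d0 by (intro exI[of _ "nat \<bar>m\<bar>"]) auto
qed

lemma number_fieldI:
  assumes "subring A" "\<And>q. of_rat q \<in> A" "finite E" "E \<subseteq> A" "A \<subseteq> ratvs.span E"
  shows "number_field A"
proof -
  interpret subring A by fact
  \<comment> \<open>A relation \<open>c + x * r(x) = 0\<close> with \<open>c\<close> nonzero gives
    the inverse as \<open>- r(x) / c\<close>; if \<open>c = 0\<close>, the factor \<open>x\<close>
    cancels and the induction continues with \<open>r\<close>.\<close>
  have inv: "inverse x \<in> A" if x: "x \<in> A" "x \<noteq> 0" "poly p x = 0" "p \<noteq> 0" "\<forall>i. coeff p i \<in> \<rat>"
    for x p
    using x(3-5)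
  proof (induction p)
    case (pCons c r)
    have r: "\<forall>i. coeff r i \<in> \<rat>" and c: "c \<in> \<rat>" using pCons.prems(3) by (metis coeff_pCons_Suc, metis coeff_pCons_0)
    show ?case
    proof (cases "c = 0")
      case True
      then show ?thesis using pCons r x by auto
    next
      case False
      have "r \<in> polys" unfolding polys_def using r assms(2) by (auto elim!: Rats_cases) (metis Rats_cases)
      then have rx: "poly r x \<in> A" using poly_in x by auto
      obtain q where q: "c = of_rat q" using c by (auto elim: Rats_cases)
      have "inverse x = poly r x * of_rat (- inverse q)"
        using pCons.prems False x(2) q
        by (simp add: field_simps of_rat_minus of_rat_divide eq_neg_iff_add_eq_0)
      then show ?thesis using rx assms(2) mult_closed by metis
    qed
  qed simp
  have "inverse x \<in> A" if xA: "x \<in> A" for x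
  proof (cases "x = 0")
    case False
    obtain p where "p \<noteq> 0" "poly p x = 0" "\<forall>i. coeff p i \<in> \<rat>"
      using algebraic_if_finite_span[OF assms(1,3,5) xA] by (auto simp: algebraic_altdef)
    then show ?thesis using inv xA False by blast
  qed (use closed in auto)
  moreover have "\<exists>c :: complex \<Rightarrow> rat. x = (\<Sum>e\<in>E. of_rat (c e) * e)" if "x \<in> A" for x
    using that assms(5) ratvs.span_finite[OF assms(3)] by blast
  ultimately show ?thesis
    unfolding number_field_def
    by (intro conjI ballI exI[of _ E] assms closed) auto
qed

lemma number_field_adjoin_root:
  assumes K: "number_field K" and p: "p \<in> subring.polys K" "p \<noteq> 0" "poly p c = 0"
  shows "number_field (subring.adjoin K c)"
proof -
  interpret subring K using K by (rule number_field_subring)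
  interpret L: subring "adjoin c" by (rule subring_adjoin)
  obtain E where E: "finite E" "E \<subseteq> K" "K \<subseteq> ratvs.span E"
    using number_field_finite_span[OF K] by auto
  define n where "n = degree p"
  define E' where "E' = (\<lambda>(e, i). e * c ^ i) ` (E \<times> {..<n})"
  have n0: "n \<noteq> 0"
  proof
    assume "n = 0"
    then obtain a where "p = [:a:]" unfolding n_def by (auto elim!: degree_eq_zeroE)
    then show False using p by simp
  qed
  have base: "k * c ^ i \<in> ratvs.span E'" if "k \<in> K" "i < n" for k i
  proof -
    have "k \<in> ratvs.span E" using that E by auto
    then show ?thesis
    proof (induction rule: ratvs.span_induct)
      case base
      show ?case
        unfolding ratvs.subspace_def
        using ratvs.span_add[of "_ * c ^ i" E' "_ * c ^ i"] ratvs.span_scale[of "_ * c ^ i" E']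
        by (simp only: distrib_right mult.assoc mem_Collect_eq)
          (auto simp: ratvs.span_zero)
    next
      case (step e)
      then show ?case using \<open>i < n\<close> by (intro ratvs.span_base) (auto simp: E'_def)
    qed
  qed
  define V where "V = {x. \<forall>k\<in>K. k * x \<in> ratvs.span E'}"
  \<comment> \<open>Powers beyond the degree are lowered by the equation divided by its leading
    coefficient, which stays inside \<open>K\<close>; this leaves the finitely many generators in
    \<open>E'\<close>.\<close>
  have "k * c ^ i \<in> ratvs.span E'" if "k \<in> K" for k i
    using that
  proof (induction i arbitrary: k rule: less_induct)
    case (less i)
    show ?case
    proof (cases "i < n")
      case False
      define d where "d = lead_coeff p"
      have d: "d \<in> K" "d \<noteq> 0" using p polysD d_def by auto
      have "d * c ^ n + (\<Sum>j<n. coeff p j * c ^ j) = 0"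
        using p(3) unfolding poly_altdef n_def[symmetric]
        by (simp add: lessThan_Suc_atMost[symmetric] d_def n_def add.commute)
      then have "c ^ n = - (\<Sum>j<n. coeff p j * c ^ j) / d"
        using d by (simp add: field_simps eq_neg_iff_add_eq_0)
      then have "k * c ^ i = - (k * c ^ (i - n) * (\<Sum>j<n. coeff p j * c ^ j) / d)"
        using False by (simp add: power_add[of c "i - n" n, simplified, symmetric] power_diff)
          (metis (no_types, lifting) False le_add_diff_inverse2 mult.commute mult.left_commute mult_minus_left not_le power_add times_divide_eq_left)
      also have "\<dots> = (\<Sum>j<n. (- (k * coeff p j / d)) * c ^ (i - n + j))"
        by (simp add: sum_distrib_left sum_divide_distrib power_add sum_negf[symmetric] mult_ac)
      also have "\<dots> \<in> ratvs.span E'"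
        using False n0 d less polysD[OF p(1)]
        by (intro ratvs.span_sum less.IH) (auto intro!: closed number_field_divide[OF K])
      finally show ?thesis .
    qed (use base less in auto)
  qed
  then have "poly q c \<in> ratvs.span E'" if "q \<in> polys" for q
    unfolding poly_altdef using polysD[OF that] by (intro ratvs.span_sum) auto
  then have "adjoin c \<subseteq> ratvs.span E'" unfolding adjoin_def by auto
  moreover have "E' \<subseteq> adjoin c"
    unfolding E'_def using E adjoin_base adjoin_self by (auto intro!: L.closed)
  moreover have "finite E'" unfolding E'_def using E by auto
  ultimately show ?thesis
    using number_fieldI[OF subring_adjoin] number_field_of_rat[OF K] adjoin_base by blast
qed

section \<open>Finite places and S-integers\<close>

lemma subring_ring_of_integers:
  assumes "number_field L"
  shows "subring (ring_of_integers L)"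
proof -
  interpret subring L using assms by (rule number_field_subring)
  show ?thesis
    unfolding ring_of_integers_def
    using algebraic_int_add_mult(1)[of _ "- _"] algebraic_int_add_mult(2)
    by unfold_locales (auto intro: closed)
qed

locale place =
  fixes L :: "complex set" and \<nu> :: "complex set"
  assumes number_field: "number_field L" and finite_place: "finite_place L \<nu>"
begin

sublocale O: subring "ring_of_integers L"
  using number_field by (rule subring_ring_of_integers)

lemma subset: "\<nu> \<subseteq> ring_of_integers L"
  and zero: "0 \<in> \<nu>"
  and one: "1 \<notin> \<nu>"
  and add: "a \<in> \<nu> \<Longrightarrow> b \<in> \<nu> \<Longrightarrow> a + b \<in> \<nu>"
  and mult: "a \<in> ring_of_integers L \<Longrightarrow> b \<in> \<nu> \<Longrightarrow> a * b \<in> \<nu>"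
  and prime: "a \<in> ring_of_integers L \<Longrightarrow> b \<in> ring_of_integers L \<Longrightarrow> a * b \<in> \<nu> \<Longrightarrow> a \<in> \<nu> \<or> b \<in> \<nu>"
  using finite_place unfolding finite_place_def by auto

lemma uminus: "a \<in> \<nu> \<Longrightarrow> - a \<in> \<nu>"
  using mult[of "- 1" a] O.closed by auto

lemma diff: "a \<in> \<nu> \<Longrightarrow> b \<in> \<nu> \<Longrightarrow> a - b \<in> \<nu>"
  using add[of a "- b"] uminus by auto

lemma sum: "(\<And>i. i \<in> I \<Longrightarrow> f i \<in> \<nu>) \<Longrightarrow> sum f I \<in> \<nu>"
  by (induction I rule: infinite_finite_induct) (auto intro: zero add)

lemma prod: "(\<And>i. i \<in> I \<Longrightarrow> f i \<in> ring_of_integers L - \<nu>) \<Longrightarrow> prod f I \<notin> \<nu>"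
  by (induction I rule: infinite_finite_induct)
    (use one prime in \<open>auto dest!: prime[rotated 2] intro: O.prod_closed\<close>)

lemma power: "a \<in> ring_of_integers L - \<nu> \<Longrightarrow> a ^ n \<notin> \<nu>"
  using prod[of "{..<n}" "\<lambda>_. a"] by simp

text \<open>If \<open>p\<close> did not divide \<open>n\<close>, a Bezout relation between them
  would put 1 into \<open>\<nu>\<close>.\<close>

lemma of_int_dvd:
  assumes "Factorial_Ring.prime p" "of_nat p \<in> \<nu>" "of_int n \<in> \<nu>"
  shows "int p dvd n"
proof (rule ccontr)
  assume "\<not> int p dvd n"
  then have "coprime (int p) n" using assms(1) by (simp add: prime_imp_coprime)
  then obtain u v where "u * int p + v * n = 1"
    using bezout_int[of "int p" n] by auto
  then have "of_int (u * int p + v * n) = (1 :: complex)" by simp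
  moreover have "of_int (u * int p + v * n) \<in> \<nu>"
    using assms(2,3) by (auto intro!: add mult O.of_int_closed)
  ultimately show False using one by simp
qed

end

text \<open>For \<open>x\<close> in \<open>\<mu>\<close> but not in \<open>\<nu>\<close>, a monic
  integer polynomial cannot take a value in \<open>\<nu>\<close> at \<open>x\<close>: its constant
  term is an integer in \<open>\<mu>\<close>, hence divisible by \<open>p\<close> and in
  \<open>\<nu>\<close>, so \<open>x\<close> cancels and the degree drops. The integral equation of
  \<open>x\<close> contradicts this, 0 being in \<open>\<nu>\<close>.\<close>

lemma finite_place_incomparable:
  assumes "number_field L" "finite_place L \<nu>" "finite_place L \<mu>" "\<nu> \<subseteq> \<mu>"
    and p: "Factorial_Ring.prime p" "of_nat p \<in> \<nu>"
  shows "\<nu> = \<mu>"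
proof (rule ccontr)
  interpret N: place L \<nu> by unfold_locales fact+
  interpret M: place L \<mu> by unfold_locales fact+
  assume "\<nu> \<noteq> \<mu>"
  then obtain x where x: "x \<in> \<mu>" "x \<notin> \<nu>" using assms by auto
  then have xO: "x \<in> ring_of_integers L" using M.subset by auto
  have *: False if "poly q x \<in> \<nu>" "lead_coeff q = 1" "\<forall>i. coeff q i \<in> \<int>" for q
    using that
  proof (induction q)
    case (pCons c r)
    have r: "\<forall>i. coeff r i \<in> \<int>" and "c \<in> \<int>"
      using pCons.prems(3) by (metis coeff_pCons_Suc, metis coeff_pCons_0)
    then obtain n where n: "c = of_int n" by (auto elim: Ints_cases)
    show ?case
    proof (cases "r = 0")
      case True
      then show ?thesis using pCons.prems N.one by auto
    next
      case False
      have "r \<in> N.O.polys" unfolding N.O.polys_def using r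
        by (auto elim!: Ints_cases) (metis Ints_cases N.O.of_int_closed)
      then have rx: "poly r x \<in> ring_of_integers L" using xO by (rule N.O.poly_in)
      have s: "of_int n + x * poly r x \<in> \<nu>" using pCons.prems n by simp
      have "x * poly r x \<in> \<mu>" using M.mult[OF rx x(1)] by (simp add: mult.commute)
      then have "of_int n \<in> \<mu>" using M.diff[of "of_int n + x * poly r x" "x * poly r x"] s assms(4) by auto
      then have "int p dvd n" using M.of_int_dvd p assms(4) by auto
      then obtain k where "n = k * int p" by (metis dvdE mult.commute)
      then have "of_int n \<in> \<nu>" using N.mult[OF N.O.of_int_closed p(2), of k] by simp
      then have "x * poly r x \<in> \<nu>" using N.diff[OF s] by force
      then have "poly r x \<in> \<nu>" using N.prime xO rx x by blast
      then show False using pCons.IH pCons.prems(2) r False by simp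
    qed
  qed (use N.one in auto)
  obtain q where "lead_coeff q = 1" "\<forall>i. coeff q i \<in> \<int>" "poly q x = 0"
    using xO unfolding ring_of_integers_def by (auto elim: algebraic_int.cases)
  then show False using *[of q] N.zero by simp
qed

lemma common_denominator:
  fixes c :: "'a \<Rightarrow> rat"
  assumes "finite I"
  shows "\<exists>N. N \<noteq> 0 \<and> (\<forall>i\<in>I. \<exists>d. of_int N * c i = of_int d)"
  using assms
proof (induction I rule: finite_induct)
  case (insert i I)
  then obtain N where N: "N \<noteq> 0" "\<And>j. j \<in> I \<Longrightarrow> \<exists>d. of_int N * c j = of_int d" by auto
  obtain a b where ab: "c i = Rat.Fract a b" "b > 0" by (metis Rat_cases)
  have "\<exists>d. of_int (N * b) * c j = of_int d" if "j \<in> insert i I" for j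
  proof (cases "j = i")
    case True
    then have "of_int (N * b) * c j = of_int (N * a)"
      using ab by (simp add: Fract_of_int_quotient)
    then show ?thesis by blast
  next
    case False
    with that have "j \<in> I" by auto
    then obtain d where d: "of_int N * c j = of_int d" using N by blast
    have "of_int (N * b) * c j = of_int b * (of_int N * c j)" by simp
    then show ?thesis unfolding d by (metis of_int_mult)
  qed
  then show ?case using N ab by (intro exI[of _ "N * b"]) auto
qed (auto intro: exI[of _ 1])

text \<open>
  Distinct places \<open>\<nu> i\<close> above \<open>p\<close> admit integers \<open>e i\<close> lying in every \<open>\<nu> j\<close> except \<open>\<nu> i\<close>. They are
  linearly independent over the rationals, which bounds the number of places by the degree of \<open>L\<close>.
\<close>

lemma finite_places_over_prime:
  assumes L: "number_field L" and p: "Factorial_Ring.prime p"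
  shows "finite {\<nu>. finite_place L \<nu> \<and> of_nat p \<in> \<nu>}" (is "finite ?S")
proof (rule ccontr)
  assume "infinite ?S"
  then obtain \<nu> :: "nat \<Rightarrow> complex set" where \<nu>: "inj \<nu>" "range \<nu> \<subseteq> ?S"
    using infinite_countable_subset by blast
  have place: "place L (\<nu> i)" for i
    using \<nu> L by unfold_locales auto
  interpret O: subring "ring_of_integers L" using L by (rule subring_ring_of_integers)
  obtain E where E: "finite E" "E \<subseteq> L" "L \<subseteq> ratvs.span E"
    using number_field_finite_span[OF L] by auto
  define n where "n = card E"
  have "\<exists>a. a \<in> \<nu> j - \<nu> i" if "i \<noteq> j" for i j
  proof (rule ccontr)
    assume "\<nexists>a. a \<in> \<nu> j - \<nu> i"
    then have "\<nu> j \<subseteq> \<nu> i" by auto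
    then have "\<nu> j = \<nu> i" using finite_place_incomparable[OF L _ _ _ p] \<nu> by blast
    then show False using that \<nu>(1) by (auto dest: injD)
  qed
  then obtain a where a: "\<And>i j. i \<noteq> j \<Longrightarrow> a i j \<in> \<nu> j - \<nu> i" by metis
  have aO: "a i j \<in> ring_of_integers L" if "i \<noteq> j" for i j
    using a[OF that] place.subset[OF place] by blast
  \<comment> \<open>\<open>n\<close> is the size of a rational spanning set of \<open>L\<close>, so
    the \<open>n + 1\<close> elements \<open>e 0\<close>, ..., \<open>e n\<close> satisfy a linear
    relation.\<close>
  define e where "e i = (\<Prod>j\<in>{..n} - {i}. a i j)" for i
  have eO: "e i \<in> ring_of_integers L" for i
    unfolding e_def using aO by (intro O.prod_closed) auto
  have e1: "e i \<notin> \<nu> i" for i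
    unfolding e_def using aO a by (intro place.prod[OF place]) auto
  have e2: "e i \<in> \<nu> j" if "i \<noteq> j" "j \<le> n" for i j
  proof -
    have "e i = (\<Prod>k\<in>{..n} - {i} - {j}. a i k) * a i j"
      unfolding e_def using that by (subst prod.remove[of _ j]) (auto simp: mult.commute)
    moreover have "(\<Prod>k\<in>{..n} - {i} - {j}. a i k) \<in> ring_of_integers L"
      using aO by (intro O.prod_closed) auto
    ultimately show ?thesis
      using place.mult[OF place] a[OF that(1)] by auto
  qed
  have "e i \<in> ratvs.span E" for i using eO E unfolding ring_of_integers_def by blast
  then obtain c i0 where c: "i0 \<le> n" "c i0 \<noteq> 0" "(\<Sum>i\<le>n. of_rat (c i) * e i) = 0"
    using ratvs_dependence[OF E(1), of e] unfolding n_def by auto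
  obtain N d where N: "N \<noteq> 0" and d: "\<And>i. i \<le> n \<Longrightarrow> of_int N * c i = of_int (d i)"
    using common_denominator[of "{..n}" c] by (metis atMost_iff finite_atMost)
  define rel where "rel d \<longleftrightarrow> (\<exists>i\<le>n. d i \<noteq> 0) \<and> (\<Sum>i\<le>n. of_int (d i) * e i) = 0" for d :: "nat \<Rightarrow> int"
  have "of_int (d i) * e i = of_int N * (of_rat (c i) * e i)" if "i \<le> n" for i
    using arg_cong[OF d[OF that], of "\<lambda>q. of_rat q :: complex"] by (simp add: of_rat_mult)
  then have "(\<Sum>i\<le>n. of_int (d i) * e i) = of_int N * (\<Sum>i\<le>n. of_rat (c i) * e i)"
    unfolding sum_distrib_left by (intro sum.cong) auto
  moreover have "d i0 \<noteq> 0" using d[OF c(1)] N c(2) by auto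
  ultimately have "rel d" unfolding rel_def using c by auto
  \<comment> \<open>In an integer relation of least total size the coefficients are not all
    divisible by \<open>p\<close>, since division by \<open>p\<close> would give a smaller relation.
    A coefficient \<open>d i\<close> not divisible by \<open>p\<close> then contradicts
    \<open>e i \<notin> \<nu> i\<close>, as all other terms lie in \<open>\<nu> i\<close>.\<close>
  then obtain d where d: "rel d"
    and dmin: "\<And>d'. rel d' \<Longrightarrow> (\<Sum>i\<le>n. nat \<bar>d i\<bar>) \<le> (\<Sum>i\<le>n. nat \<bar>d' i\<bar>)"
    using arg_min_natI[of rel d "\<lambda>d. \<Sum>i\<le>n. nat \<bar>d i\<bar>"]
      arg_min_nat_le[of rel _ "\<lambda>d. \<Sum>i\<le>n. nat \<bar>d i\<bar>"] by blast
  have "\<exists>i\<le>n. \<not> int p dvd d i"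
  proof (rule ccontr)
    assume "\<not> (\<exists>i\<le>n. \<not> int p dvd d i)"
    then have "\<exists>k. d i = int p * k" if "i \<le> n" for i using that by auto
    then obtain d' where d': "\<And>i. i \<le> n \<Longrightarrow> d i = int p * d' i" by metis
    have p2: "p \<ge> 2" using p prime_ge_2_nat by auto
    have "(\<Sum>i\<le>n. of_int (d i) * e i) = of_nat p * (\<Sum>i\<le>n. of_int (d' i) * e i)"
      using d' by (simp add: sum_distrib_left mult.assoc)
    then have "rel d'" using d d' p2 unfolding rel_def by auto
    then have "(\<Sum>i\<le>n. nat \<bar>d i\<bar>) \<le> (\<Sum>i\<le>n. nat \<bar>d' i\<bar>)" by (rule dmin)
    moreover have "(\<Sum>i\<le>n. nat \<bar>d' i\<bar>) < (\<Sum>i\<le>n. nat \<bar>d i\<bar>)"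
    proof (rule sum_strict_mono_ex1)
      show "\<forall>i\<in>{..n}. nat \<bar>d' i\<bar> \<le> nat \<bar>d i\<bar>"
        using d' p2 by (auto simp: abs_mult nat_mult_distrib)
      obtain i where i: "i \<le> n" "d' i \<noteq> 0" using \<open>rel d'\<close> unfolding rel_def by auto
      have "nat \<bar>d' i\<bar> * 1 < nat \<bar>d' i\<bar> * p" using i p2 by (intro mult_strict_left_mono) auto
      then show "\<exists>i\<in>{..n}. nat \<bar>d' i\<bar> < nat \<bar>d i\<bar>"
        using d'[OF i(1)] i by (intro bexI[of _ i]) (auto simp: abs_mult nat_mult_distrib mult.commute)
    qed auto
    ultimately show False by linarith
  qed
  then obtain i where i: "i \<le> n" "\<not> int p dvd d i" by auto
  interpret place L "\<nu> i" by (rule place)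
  have "(\<Sum>j\<in>{..n} - {i}. of_int (d j) * e j) \<in> \<nu> i"
    using e2 i(1) by (intro sum mult O.of_int_closed) auto
  moreover have "of_int (d i) * e i = - (\<Sum>j\<in>{..n} - {i}. of_int (d j) * e j)"
    using d i(1) unfolding rel_def
    by (subst (asm) sum.remove[of _ i]) (auto simp: eq_neg_iff_add_eq_0)
  ultimately have "of_int (d i) * e i \<in> \<nu> i" using uminus by simp
  then have "of_int (d i) \<in> \<nu> i" using prime eO e1 O.of_int_closed by blast
  then show False using of_int_dvd[OF p] \<nu>(2) i by auto
qed

lemma finite_places_over:
  assumes L: "number_field L" and M: "M > 0"
  shows "finite {\<nu>. finite_place L \<nu> \<and> of_nat M \<in> \<nu>}"
  using M
proof (induction M rule: prime_divisors_induct)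
  case (factor p M)
  have "{\<nu>. finite_place L \<nu> \<and> of_nat (p * M) \<in> \<nu>} \<subseteq>
      {\<nu>. finite_place L \<nu> \<and> of_nat p \<in> \<nu>} \<union> {\<nu>. finite_place L \<nu> \<and> of_nat M \<in> \<nu>}"
    using place.prime[OF place.intro[OF L], of _ "of_nat p" "of_nat M"]
      subring.of_nat_closed[OF subring_ring_of_integers[OF L]] by auto
  then show ?case
    using factor finite_places_over_prime[OF L, of p] by (auto intro: finite_subset)
next
  case (unit M)
  then have "{\<nu>. finite_place L \<nu> \<and> of_nat M \<in> \<nu>} = {}"
    by (auto dest: place.one[OF place.intro[OF L]])
  then show ?case by (simp only: finite.emptyI)
qed auto

text \<open>This is \<open>ring_of_integers L\<close> with \<open>1 / M\<close> adjoined. A single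
  positive integer \<open>M\<close> encodes the set of places: those containing \<open>M\<close>
  make up \<open>S\<close>, which is finite by \<open>finite_places_over\<close>.\<close>

definition S_integers :: "complex set \<Rightarrow> nat \<Rightarrow> complex set" where
  "S_integers L M = {a \<in> L. \<exists>k. of_nat M ^ k * a \<in> ring_of_integers L}"

lemma subring_S_integers:
  assumes L: "number_field L"
  shows "subring (S_integers L M)"
proof -
  interpret L: subring L using L by (rule number_field_subring)
  interpret O: subring "ring_of_integers L" using L by (rule subring_ring_of_integers)
  show ?thesis
  proof
    show "1 \<in> S_integers L M"
      unfolding S_integers_def using L.closed O.closed by (auto intro!: exI[of _ 0])
  next
    fix x y assume "x \<in> S_integers L M" "y \<in> S_integers L M"
    then obtain k l where k: "x \<in> L" "of_nat M ^ k * x \<in> ring_of_integers L"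
      and l: "y \<in> L" "of_nat M ^ l * y \<in> ring_of_integers L"
      unfolding S_integers_def by auto
    have "of_nat M ^ (k + l) * (x - y) = of_nat M ^ l * (of_nat M ^ k * x) - of_nat M ^ k * (of_nat M ^ l * y)"
      by (simp add: power_add algebra_simps)
    also have "\<dots> \<in> ring_of_integers L" by (intro O.closed k l)
    finally show "x - y \<in> S_integers L M" unfolding S_integers_def using L.diff_closed[OF k(1) l(1)] by blast
    have "of_nat M ^ (k + l) * (x * y) = (of_nat M ^ k * x) * (of_nat M ^ l * y)"
      by (simp add: power_add algebra_simps)
    also have "\<dots> \<in> ring_of_integers L" by (intro O.closed k l)
    finally show "x * y \<in> S_integers L M" unfolding S_integers_def using L.mult_closed[OF k(1) l(1)] by blast
  qed
qed

lemma number_field_multiple_algebraic_int: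
  assumes "number_field L" "x \<in> L"
  shows "\<exists>N>0. of_nat N * x \<in> ring_of_integers L"
  using algebraic_imp_multiple_algebraic_int[OF number_field_algebraic[OF assms]]
    subring.closed(6)[OF number_field_subring[OF assms(1)]]
    subring.of_nat_closed[OF number_field_subring[OF assms(1)]] assms(2)
  unfolding ring_of_integers_def by blast

text \<open>Every nonzero element of \<open>X\<close> becomes a unit; since
  \<open>inverse 0 = 0\<close>, constants that may vanish can be included without a case
  distinction. The factor 2 in \<open>M\<close> makes 2 a unit.\<close>

lemma finite_subset_S_integers:
  assumes L: "number_field L" and X: "finite X" "X \<subseteq> L"
  shows "\<exists>M>0. even M \<and> (\<forall>x\<in>X. x \<in> S_integers L M \<and> inverse x \<in> S_integers L M)"
proof -
  interpret O: subring "ring_of_integers L" using L by (rule subring_ring_of_integers)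
  define Y where "Y = X \<union> inverse ` X"
  have Y: "finite Y" "Y \<subseteq> L" unfolding Y_def using X number_field_inverse[OF L] by auto
  then have "\<exists>N>0. of_nat N * x \<in> ring_of_integers L" if "x \<in> Y" for x
    using number_field_multiple_algebraic_int[OF L] that by blast
  then obtain N where N: "\<And>x. x \<in> Y \<Longrightarrow> N x > 0 \<and> of_nat (N x) * x \<in> ring_of_integers L"
    by metis
  define M where "M = 2 * (\<Prod>x\<in>Y. N x)"
  have "x \<in> S_integers L M" if "x \<in> Y" for x
  proof -
    have "M = (2 * (\<Prod>x\<in>Y - {x}. N x)) * N x"
      unfolding M_def using that Y by (subst prod.remove[of _ x]) auto
    then have "of_nat M * x = of_nat (2 * (\<Prod>x\<in>Y - {x}. N x)) * (of_nat (N x) * x)"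
      by simp
    also have "\<dots> \<in> ring_of_integers L" using N[OF that] by (blast intro: O.mult_closed O.of_nat_closed)
    finally show ?thesis unfolding S_integers_def using that Y by (auto intro!: exI[of _ 1])
  qed
  moreover have "M > 0" unfolding M_def using N by (simp add: prod_pos)
  moreover have "even M" unfolding M_def by simp
  ultimately show ?thesis unfolding Y_def by blast
qed

lemma inverse_dvd_S_integers:
  assumes L: "number_field L" and M: "M > 0" and d: "d dvd M"
  shows "inverse (of_nat d) \<in> S_integers L M"
proof -
  interpret L: subring L using L by (rule number_field_subring)
  interpret O: subring "ring_of_integers L" using L by (rule subring_ring_of_integers)
  obtain k where k: "M = d * k" using d by auto
  then have "of_nat M * inverse (of_nat d) = (of_nat k :: complex)" using M by auto
  then show ?thesis
    unfolding S_integers_def using O.closed number_field_inverse[OF L] L.closed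
    by (auto intro!: exI[of _ 1])
qed

section \<open>Specialization of finitely generated rings to number fields\<close>

locale subring_hom = subring A for A :: "complex set" +
  fixes \<phi> :: "complex \<Rightarrow> complex"
  assumes hom_one: "\<phi> 1 = 1"
    and hom_diff: "\<And>x y. x \<in> A \<Longrightarrow> y \<in> A \<Longrightarrow> \<phi> (x - y) = \<phi> x - \<phi> y"
    and hom_mult: "\<And>x y. x \<in> A \<Longrightarrow> y \<in> A \<Longrightarrow> \<phi> (x * y) = \<phi> x * \<phi> y"
begin

lemma hom_zero: "\<phi> 0 = 0"
  using hom_diff[OF one_closed one_closed] by simp

lemma hom_add: "x \<in> A \<Longrightarrow> y \<in> A \<Longrightarrow> \<phi> (x + y) = \<phi> x + \<phi> y"
  using hom_diff[of x "0 - y"] hom_diff[of 0 y] hom_zero closed by auto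

lemma hom_power: "x \<in> A \<Longrightarrow> \<phi> (x ^ n) = \<phi> x ^ n"
  by (induction n) (auto simp: hom_one hom_mult closed)

lemma hom_sum: "(\<And>i. i \<in> I \<Longrightarrow> f i \<in> A) \<Longrightarrow> \<phi> (sum f I) = (\<Sum>i\<in>I. \<phi> (f i))"
  by (induction I rule: infinite_finite_induct) (auto simp: hom_zero hom_add sum_closed)

lemma coeff_map: "coeff (map_poly \<phi> p) i = \<phi> (coeff p i)"
  by (simp add: coeff_map_poly hom_zero)

lemma map_poly_diff: "p \<in> polys \<Longrightarrow> q \<in> polys \<Longrightarrow> map_poly \<phi> (p - q) = map_poly \<phi> p - map_poly \<phi> q"
  by (intro poly_eqI) (simp add: coeff_map hom_diff polysD)

lemma map_poly_mult: "p \<in> polys \<Longrightarrow> q \<in> polys \<Longrightarrow> map_poly \<phi> (p * q) = map_poly \<phi> p * map_poly \<phi> q"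
  by (intro poly_eqI) (simp add: coeff_map coeff_mult hom_mult hom_sum polysD closed)

lemma map_poly_smult: "a \<in> A \<Longrightarrow> p \<in> polys \<Longrightarrow> map_poly \<phi> (smult a p) = smult (\<phi> a) (map_poly \<phi> p)"
  by (intro poly_eqI) (simp add: coeff_map hom_mult polysD)

lemma map_poly_monom: "map_poly \<phi> (monom a n) = monom (\<phi> a) n"
  by (intro poly_eqI) (simp add: coeff_map hom_zero)

text \<open>The assumption makes the image independent of the polynomial that represents an element
  of \<open>adjoin b\<close>: two choices differ by a polynomial vanishing at
  \<open>b\<close>.\<close>

lemma hom_adjoin:
  assumes c: "\<And>p. p \<in> polys \<Longrightarrow> poly p b = 0 \<Longrightarrow> poly (map_poly \<phi> p) c = 0"
  shows "\<exists>\<psi>. subring_hom (adjoin b) \<psi> \<and> (\<forall>p\<in>polys. \<psi> (poly p b) = poly (map_poly \<phi> p) c)"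
proof -
  interpret P: subring polys by (rule subring_polys)
  define \<psi> where "\<psi> z = poly (map_poly \<phi> (SOME p. p \<in> polys \<and> poly p b = z)) c" for z
  have \<psi>: "\<psi> (poly p b) = poly (map_poly \<phi> p) c" if p: "p \<in> polys" for p
  proof -
    define q where "q = (SOME q. q \<in> polys \<and> poly q b = poly p b)"
    have q: "q \<in> polys \<and> poly q b = poly p b"
      unfolding q_def by (rule someI[of _ p]) (use p in auto)
    then have "poly (map_poly \<phi> (q - p)) c = 0" using p by (intro c) (auto intro: P.closed)
    then show ?thesis unfolding \<psi>_def q_def[symmetric] using p q by (simp add: map_poly_diff)
  qed
  have "subring_hom (adjoin b) \<psi>"
  proof (intro subring_hom.intro subring_adjoin subring_hom_axioms.intro)
    have "map_poly \<phi> 1 = 1"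
      by (simp add: one_pCons map_poly_pCons hom_one hom_zero)
    then show "\<psi> 1 = 1" using \<psi>[OF P.one_closed] by simp
  next
    fix x y assume "x \<in> adjoin b" "y \<in> adjoin b"
    then obtain p q where pq: "p \<in> polys" "q \<in> polys" "x = poly p b" "y = poly q b"
      unfolding adjoin_def by auto
    show "\<psi> (x - y) = \<psi> x - \<psi> y"
      using \<psi>[OF P.diff_closed[OF pq(1,2)]] \<psi> pq by (simp add: map_poly_diff)
    show "\<psi> (x * y) = \<psi> x * \<psi> y"
      using \<psi>[OF P.mult_closed[OF pq(1,2)]] \<psi> pq by (simp add: map_poly_mult)
  qed
  then show ?thesis using \<psi> by blast
qed

end

text \<open>\<open>A\<close> need not be a field, so a power of the leading coefficient of the
  divisor clears the denominators of the usual division.\<close>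

lemma (in subring) pseudo_division:
  assumes f: "f \<in> polys" "f \<noteq> 0" and "p \<in> polys"
  shows "\<exists>m q r. q \<in> polys \<and> r \<in> polys \<and> smult (lead_coeff f ^ m) p = q * f + r \<and>
    (r = 0 \<or> degree r < degree f)"
  using assms(3)
proof (induction "degree p" arbitrary: p rule: less_induct)
  case less
  interpret P: subring polys by (rule subring_polys)
  show ?case
  proof (cases "p = 0 \<or> degree p < degree f")
    case True
    then show ?thesis using less.prems P.closed
      by (intro exI[of _ 0] exI[of _ p]) auto
  next
    case False
    define t where "t = monom (lead_coeff p) (degree p - degree f)"
    define p' where "p' = smult (lead_coeff f) p - t * f"
    have t: "t \<in> polys" unfolding t_def using less.prems by (intro monom_in_polys polysD)
    have p': "p' \<in> polys"
      unfolding p'_def using t f less.prems by (intro P.closed smult_in_polys polysD)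
    have le: "degree p' \<le> degree p"
      unfolding p'_def t_def using False
      by (intro degree_diff_le degree_smult_le order.trans[OF degree_mult_le])
        (auto intro: order.trans[OF add_right_mono[OF degree_monom_le]])
    have z: "coeff p' (degree p) = 0"
      unfolding p'_def t_def using False by (simp add: coeff_monom_mult)
    have "\<exists>m q r. q \<in> polys \<and> r \<in> polys \<and> smult (lead_coeff f ^ m) p' = q * f + r \<and>
      (r = 0 \<or> degree r < degree f)"
    proof (cases "p' = 0")
      case True
      then show ?thesis using P.closed by (intro exI[of _ 0]) auto
    next
      case False
      then have "degree p' \<noteq> degree p" using z by (metis leading_coeff_0_iff)
      then show ?thesis using le p' by (intro less.hyps) auto
    qed
    then obtain m q r where qr: "q \<in> polys" "r \<in> polys"
      "smult (lead_coeff f ^ m) p' = q * f + r" "r = 0 \<or> degree r < degree f" by blast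
    have "smult (lead_coeff f ^ Suc m) p = (q + smult (lead_coeff f ^ m) t) * f + r"
      using qr(3) unfolding p'_def
      by (simp add: smult_diff_right algebra_simps mult.commute[of _ "lead_coeff f"])
    moreover have "q + smult (lead_coeff f ^ m) t \<in> polys"
      using qr t f by (intro P.closed smult_in_polys power_closed polysD)
    ultimately show ?thesis using qr by blast
  qed
qed

text \<open>This does the work of a norm. Among the polynomials in \<open>H\<close>, whose values at
  \<open>b\<close> are nonzero multiples of \<open>z\<close>, one of least degree is constant:
  dividing \<open>f\<close> by it leaves remainder 0, and by minimality of \<open>f\<close> the
  quotient, which vanishes at \<open>b\<close>, has the full degree of \<open>f\<close>.\<close>

lemma algebraic_multiple_in_base:
  fixes A :: "'a::idom set"
  assumes "subring A"
  defines "polys \<equiv> subring.polys A" and "adjoin \<equiv> subring.adjoin A"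
  assumes f: "f \<in> polys" "f \<noteq> 0" "poly f b = 0"
    and fmin: "\<And>g. g \<in> polys \<Longrightarrow> g \<noteq> 0 \<Longrightarrow> poly g b = 0 \<Longrightarrow> degree f \<le> degree g"
    and z: "z \<in> adjoin b" "z \<noteq> 0"
  shows "\<exists>u\<in>adjoin b. u * z \<in> A \<and> u * z \<noteq> 0"
proof -
  interpret subring A
    rewrites "subring.polys A \<equiv> polys" and "subring.adjoin A \<equiv> adjoin"
    using assms by auto
  interpret P: subring polys by (rule subring_polys)
  define H where "H = {h \<in> polys. poly h b \<noteq> 0 \<and> (\<exists>U\<in>polys. poly h b = poly U b * z)}"
  obtain p0 where "p0 \<in> polys" "z = poly p0 b" using z by (auto simp: adjoin_def)
  then have "p0 \<in> H" unfolding H_def using z P.closed by (auto intro!: bexI[of _ 1])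
  then obtain h where h: "h \<in> H" and hmin: "\<And>g. g \<in> H \<Longrightarrow> degree h \<le> degree g"
    using arg_min_natI[of "\<lambda>h. h \<in> H" p0 degree] arg_min_nat_le[of "\<lambda>h. h \<in> H" _ degree] by blast
  have hp: "h \<in> polys" "poly h b \<noteq> 0" "h \<noteq> 0" using h by (auto simp: H_def)
  obtain U where U: "U \<in> polys" "poly h b = poly U b * z" using h by (auto simp: H_def)
  \<comment> \<open>The remainder of \<open>h\<close> modulo \<open>f\<close> has the same value at
    \<open>b\<close> up to a nonzero factor, hence lies in \<open>H\<close>, and minimality bounds
    the degree of \<open>h\<close> by that of the remainder.\<close>
  have lt: "degree h < degree f"
  proof -
    obtain m q r where qr: "q \<in> polys" "r \<in> polys"
      "smult (lead_coeff f ^ m) h = q * f + r" "r = 0 \<or> degree r < degree f"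
      using pseudo_division[OF f(1,2) hp(1)] by blast
    have r: "poly r b = lead_coeff f ^ m * poly h b"
      using arg_cong[OF qr(3), of "\<lambda>p. poly p b"] f(3) by simp
    then have "poly r b \<noteq> 0" using hp f by simp
    moreover have "poly r b = poly (smult (lead_coeff f ^ m) U) b * z" using r U by simp
    moreover have "smult (lead_coeff f ^ m) U \<in> polys"
      using U f by (intro smult_in_polys power_closed polysD)
    ultimately have "r \<in> H" unfolding H_def using qr by blast
    then show ?thesis using hmin[of r] qr(4) \<open>poly r b \<noteq> 0\<close> by auto
  qed
  obtain m q r where qr: "q \<in> polys" "r \<in> polys"
    "smult (lead_coeff h ^ m) f = q * h + r" "r = 0 \<or> degree r < degree h"
    using pseudo_division[OF hp(1,3) f(1)] by blast
  have lc: "lead_coeff h ^ m \<noteq> 0" using hp by simp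
  have s: "poly q b * poly h b + poly r b = 0"
    using arg_cong[OF qr(3), of "\<lambda>p. poly p b"] f(3) by simp
  have "poly r b = 0"
  proof (rule ccontr)
    assume r: "poly r b \<noteq> 0"
    have "poly r b = poly (0 - q * U) b * z" using s U by (simp add: eq_neg_iff_add_eq_0 algebra_simps)
    moreover have "0 - q * U \<in> polys" using qr U by (intro P.closed)
    ultimately have "r \<in> H" unfolding H_def using r qr by blast
    then show False using hmin[of r] qr(4) r by auto
  qed
  then have "r = 0" using fmin[of r] qr lt by force
  then have q: "q * h = smult (lead_coeff h ^ m) f" using qr by simp
  then have "q \<noteq> 0" using lc f by auto
  then have "degree q + degree h = degree f"
    using arg_cong[OF q, of degree] lc hp by (simp add: degree_mult_eq)
  moreover have "poly q b = 0" using s \<open>poly r b = 0\<close> hp by simp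
  ultimately have "degree h = 0" using fmin[of q] qr \<open>q \<noteq> 0\<close> by simp
  then obtain a where "h = [:a:]" by (auto elim!: degree_eq_zeroE)
  then have "poly h b = a" "a \<in> A" using hp polysD[of h 0] by auto
  then show ?thesis using U hp unfolding adjoin_def by (intro bexI[of _ "poly U b"]) auto
qed

text \<open>Keeping one prescribed element nonzero is the strengthening that lets the property pass
  to \<open>adjoin A b\<close>, where the image of a leading coefficient must survive.\<close>

definition specializes :: "complex set \<Rightarrow> complex set \<Rightarrow> bool" where
  "specializes K A \<longleftrightarrow> subring A \<and> K \<subseteq> A \<and>
     (\<forall>a\<in>A. a \<noteq> 0 \<longrightarrow> (\<exists>L \<phi>. number_field L \<and> K \<subseteq> L \<and> subring_hom A \<phi> \<and> \<phi> ` A \<subseteq> L \<and>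
        (\<forall>x\<in>K. \<phi> x = x) \<and> \<phi> a \<noteq> 0))"

lemma specializes_base: "number_field K \<Longrightarrow> specializes K K"
  unfolding specializes_def
  using number_field_subring[of K]
  by (auto intro!: exI[of _ K] exI[of _ "\<lambda>x. x"] simp: subring_hom_def subring_hom_axioms_def)

text \<open>If \<open>b\<close> is algebraic over \<open>A\<close>, it is sent to a root of the
  image of an equation of least degree, at the cost of a finite extension of the number field; if it
  is transcendental, it is sent to a natural number.\<close>

lemma specializes_adjoin:
  assumes "specializes K A"
  shows "specializes K (subring.adjoin A b)"
proof -
  interpret subring A using assms by (simp add: specializes_def)
  interpret P: subring polys by (rule subring_polys)
  interpret B: subring "adjoin b" by (rule subring_adjoin)
  have KA: "K \<subseteq> A" using assms by (simp add: specializes_def)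
  have "\<exists>L \<psi>. number_field L \<and> K \<subseteq> L \<and> subring_hom (adjoin b) \<psi> \<and> \<psi> ` adjoin b \<subseteq> L \<and>
        (\<forall>x\<in>K. \<psi> x = x) \<and> \<psi> z \<noteq> 0" if z: "z \<in> adjoin b" "z \<noteq> 0" for z
  proof -
    have "\<exists>L \<phi> c. number_field L \<and> K \<subseteq> L \<and> subring_hom A \<phi> \<and> \<phi> ` A \<subseteq> L \<and> (\<forall>x\<in>K. \<phi> x = x) \<and> c \<in> L \<and>
      (\<forall>p\<in>polys. poly p b = 0 \<longrightarrow> poly (map_poly \<phi> p) c = 0) \<and>
      (\<forall>p\<in>polys. poly p b = z \<longrightarrow> poly (map_poly \<phi> p) c \<noteq> 0)"
    proof (cases "\<exists>f\<in>polys. f \<noteq> 0 \<and> poly f b = 0")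
      case True
      then obtain f where f: "f \<in> polys" "f \<noteq> 0" "poly f b = 0"
        and fmin: "\<And>g. g \<in> polys \<Longrightarrow> g \<noteq> 0 \<Longrightarrow> poly g b = 0 \<Longrightarrow> degree f \<le> degree g"
        using ex_has_least_nat[of "\<lambda>f. f \<in> polys \<and> f \<noteq> 0 \<and> poly f b = 0" _ degree] by metis
      obtain u where u: "u \<in> adjoin b" "u * z \<in> A" "u * z \<noteq> 0"
        using algebraic_multiple_in_base[OF subring_axioms f fmin z] by blast
      have lc: "lead_coeff f \<in> A" "lead_coeff f \<noteq> 0" using f polysD by auto
      \<comment> \<open>One element controls both requirements: if its image is nonzero, then the
        equation of \<open>b\<close> keeps its degree, and so has a root, and the multiple
        \<open>u * z\<close> of \<open>z\<close> is not sent to 0.\<close>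
      have "lead_coeff f * (u * z) \<in> A" "lead_coeff f * (u * z) \<noteq> 0"
        using lc u mult_closed by auto
      then obtain L \<phi> where L: "number_field L" "K \<subseteq> L" and \<phi>: "subring_hom A \<phi>" "\<phi> ` A \<subseteq> L" "\<forall>x\<in>K. \<phi> x = x"
        and nz: "\<phi> (lead_coeff f * (u * z)) \<noteq> 0"
        using assms unfolding specializes_def by blast
      interpret \<phi>: subring_hom A \<phi> by (rule \<phi>(1))
      interpret L: subring L using L(1) by (rule number_field_subring)
      have nz: "\<phi> (lead_coeff f) \<noteq> 0" "\<phi> (u * z) \<noteq> 0"
        using nz \<phi>.hom_mult[OF lc(1) u(2)] by auto
      have "degree f \<noteq> 0"
      proof
        assume "degree f = 0"
        then obtain a where "f = [:a:]" by (rule degree_eq_zeroE)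
        then show False using f by simp
      qed
      moreover have "degree f \<le> degree (map_poly \<phi> f)"
        using nz by (intro le_degree) (simp add: \<phi>.coeff_map)
      ultimately have "\<not> constant (poly (map_poly \<phi> f))"
        by (simp add: constant_degree)
      then obtain c where c: "poly (map_poly \<phi> f) c = 0"
        using fundamental_theorem_of_algebra by blast
      have f': "map_poly \<phi> f \<in> L.polys" "map_poly \<phi> f \<noteq> 0"
        using \<open>degree f \<noteq> 0\<close> \<open>degree f \<le> _\<close> \<phi>(2) polysD[OF f(1)] unfolding L.polys_def
        by (auto simp: \<phi>.coeff_map)
      have L': "number_field (L.adjoin c)"
        by (rule number_field_adjoin_root[OF L(1) f' c])
      \<comment> \<open>Pseudo-division by the minimal \<open>f\<close> leaves a remainder vanishing
        at \<open>b\<close>, hence zero; the power of the leading coefficient cancels because its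
        image is nonzero.\<close>
      have van: "poly (map_poly \<phi> p) c = 0" if p: "p \<in> polys" "poly p b = 0" for p
      proof -
        obtain m q r where qr: "q \<in> polys" "r \<in> polys"
          "smult (lead_coeff f ^ m) p = q * f + r" "r = 0 \<or> degree r < degree f"
          using pseudo_division[OF f(1,2) p(1)] by blast
        have "poly r b = 0"
          using arg_cong[OF qr(3), of "\<lambda>p. poly p b"] f(3) p(2) by simp
        then have "r = 0" using fmin[of r] qr by force
        then have e: "smult (lead_coeff f ^ m) p = q * f" using qr by simp
        have "smult (\<phi> (lead_coeff f) ^ m) (map_poly \<phi> p) = map_poly \<phi> (smult (lead_coeff f ^ m) p)"
          using \<phi>.map_poly_smult[OF power_closed[OF lc(1)] p(1)] \<phi>.hom_power[OF lc(1)] by simp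
        also have "\<dots> = map_poly \<phi> q * map_poly \<phi> f"
          unfolding e by (rule \<phi>.map_poly_mult[OF qr(1) f(1)])
        finally have "smult (\<phi> (lead_coeff f) ^ m) (map_poly \<phi> p) = map_poly \<phi> q * map_poly \<phi> f" .
        from arg_cong[OF this, of "\<lambda>p. poly p c"] show ?thesis using c nz by simp
      qed
      moreover have "poly (map_poly \<phi> p) c \<noteq> 0" if p: "p \<in> polys" "poly p b = z" for p
      proof
        assume 0: "poly (map_poly \<phi> p) c = 0"
        obtain U where U: "U \<in> polys" "u = poly U b" using u by (auto simp: adjoin_def)
        have "U * p - [:u * z:] \<in> polys"
          using U p u by (intro P.closed) (auto simp: pCons_in_polys P.closed)
        moreover have "poly (U * p - [:u * z:]) b = 0" using U p by simp
        ultimately have "poly (map_poly \<phi> (U * p - [:u * z:])) c = 0" by (rule van)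
        moreover have "[:u * z:] \<in> polys" using u by (auto simp: pCons_in_polys P.closed)
        moreover have "map_poly \<phi> [:u * z:] = [:\<phi> (u * z):]"
          by (simp add: map_poly_pCons \<phi>.hom_zero)
        ultimately show False
          using 0 nz U p by (simp add: \<phi>.map_poly_diff \<phi>.map_poly_mult P.closed)
      qed
      moreover have "L \<subseteq> L.adjoin c" "c \<in> L.adjoin c" by (rule L.adjoin_base, rule L.adjoin_self)
      ultimately show ?thesis
        using L L' \<phi> by (intro exI[of _ "L.adjoin c"] exI[of _ \<phi>] exI[of _ c]) auto
    next
      case False
      obtain p0 where p0: "p0 \<in> polys" "z = poly p0 b" using z by (auto simp: adjoin_def)
      then have "lead_coeff p0 \<in> A" "lead_coeff p0 \<noteq> 0" using z polysD by auto
      then obtain L \<phi> where L: "number_field L" "K \<subseteq> L" and \<phi>: "subring_hom A \<phi>" "\<phi> ` A \<subseteq> L" "\<forall>x\<in>K. \<phi> x = x"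
        and nz: "\<phi> (lead_coeff p0) \<noteq> 0"
        using assms unfolding specializes_def by blast
      interpret \<phi>: subring_hom A \<phi> by (rule \<phi>(1))
      interpret L: subring L using L(1) by (rule number_field_subring)
      have "map_poly \<phi> p0 \<noteq> 0" using nz by (metis \<phi>.coeff_map coeff_0)
      then have "finite {x. poly (map_poly \<phi> p0) x = 0}" by (rule poly_roots_finite)
      moreover have "infinite (range (of_nat :: nat \<Rightarrow> complex))"
        by (rule range_inj_infinite) (rule inj_of_nat)
      \<comment> \<open>With no nonzero polynomial over \<open>A\<close> vanishing at
        \<open>b\<close>, any value off the roots of the image of \<open>p0\<close> will do, and
        natural numbers lie in \<open>L\<close>.\<close>
      ultimately obtain n :: nat where n: "poly (map_poly \<phi> p0) (of_nat n) \<noteq> 0"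
        by (meson finite_subset image_subsetI mem_Collect_eq)
      have "p = p0" if "p \<in> polys" "poly p b = z" for p
      proof (rule ccontr)
        assume "p \<noteq> p0"
        moreover have "p - p0 \<in> polys" using that p0 by (intro P.closed)
        ultimately show False using False that p0 by force
      qed
      moreover have "poly (map_poly \<phi> p) (of_nat n) = 0" if "p \<in> polys" "poly p b = 0" for p
      proof -
        have "p = 0" using False that by auto
        then show ?thesis by simp
      qed
      ultimately show ?thesis
        using L \<phi> n L.of_nat_closed
        by (intro exI[of _ L] exI[of _ \<phi>] exI[of _ "of_nat n"]) auto
    qed
    then obtain L \<phi> c where L: "number_field L" "K \<subseteq> L"
      and \<phi>: "subring_hom A \<phi>" "\<phi> ` A \<subseteq> L" "\<forall>x\<in>K. \<phi> x = x" and c: "c \<in> L"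
      and v: "\<And>p. p \<in> polys \<Longrightarrow> poly p b = 0 \<Longrightarrow> poly (map_poly \<phi> p) c = 0"
      and nv: "\<And>p. p \<in> polys \<Longrightarrow> poly p b = z \<Longrightarrow> poly (map_poly \<phi> p) c \<noteq> 0"
      by metis
    interpret \<phi>: subring_hom A \<phi> by (rule \<phi>(1))
    interpret L: subring L using L(1) by (rule number_field_subring)
    obtain \<psi> where \<psi>: "subring_hom (adjoin b) \<psi>" "\<And>p. p \<in> polys \<Longrightarrow> \<psi> (poly p b) = poly (map_poly \<phi> p) c"
      using \<phi>.hom_adjoin[of b c] v by blast
    have "\<psi> ` adjoin b \<subseteq> L"
    proof -
      have "poly (map_poly \<phi> p) c \<in> L" if "p \<in> polys" for p
        using c \<phi>(2) polysD[OF that]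
        by (intro L.poly_in) (auto simp: L.polys_def \<phi>.coeff_map)
      then show ?thesis using \<psi>(2) by (auto simp: adjoin_def)
    qed
    moreover have "\<psi> x = x" if "x \<in> K" for x
      using \<psi>(2)[of "monom x 0"] \<phi>(3) that KA monom_in_polys[of x 0]
      by (auto simp: \<phi>.map_poly_monom poly_monom)
    moreover have "\<psi> z \<noteq> 0" using z nv \<psi>(2) by (auto simp: adjoin_def)
    ultimately show ?thesis using L \<psi>(1) by blast
  qed
  then show ?thesis
    unfolding specializes_def using subring_adjoin order.trans[OF KA adjoin_base] by blast
qed

lemma specialization:
  assumes K: "number_field K" and X: "finite X"
  shows "\<exists>A L \<phi>. K \<union> X \<subseteq> A \<and> number_field L \<and> K \<subseteq> L \<and> subring_hom A \<phi> \<and> \<phi> ` A \<subseteq> L \<and>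
    (\<forall>x\<in>K. \<phi> x = x)"
proof -
  have "\<exists>A. specializes K A \<and> X \<subseteq> A"
    using X
  proof (induction X rule: finite_induct)
    case (insert b X)
    then obtain A where A: "specializes K A" "X \<subseteq> A" by auto
    then interpret subring A by (simp add: specializes_def)
    show ?case
      using specializes_adjoin[OF A(1), of b] A(2) adjoin_base[of b] adjoin_self[of b] by blast
  qed (use specializes_base[OF K] in auto)
  then obtain A where A: "specializes K A" "X \<subseteq> A" by auto
  then interpret subring A by (simp add: specializes_def)
  show ?thesis
    using A one_closed unfolding specializes_def
    by (metis Un_least zero_neq_one)
qed

section \<open>Cubic forms and projective points\<close>

lemma eval_poly_superset:
  assumes "finite S" "Poly_Mapping.keys f \<subseteq> S"
  shows "eval_poly f x = (\<Sum>m\<in>S. Poly_Mapping.lookup f m * (\<Prod>i\<in>UNIV. (x $ i) ^ Poly_Mapping.lookup m i))"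
  unfolding eval_poly_def using assms
  by (intro sum.mono_neutral_left) (auto simp: in_keys_iff)

lemma eval_poly_add: "eval_poly (f + g) x = eval_poly f x + eval_poly g x"
proof -
  let ?S = "Poly_Mapping.keys f \<union> Poly_Mapping.keys g"
  have "finite ?S" "Poly_Mapping.keys (f + g) \<subseteq> ?S" "Poly_Mapping.keys f \<subseteq> ?S" "Poly_Mapping.keys g \<subseteq> ?S"
    using keys_add[of f g] by auto
  then show ?thesis
    by (simp add: eval_poly_superset[of ?S] lookup_add algebra_simps sum.distrib)
qed

lemma eval_poly_0 [simp]: "eval_poly 0 x = 0"
  by (simp add: eval_poly_def)

lemma eval_poly_sum: "eval_poly (sum f I) x = (\<Sum>i\<in>I. eval_poly (f i) x)"
  by (induction I rule: infinite_finite_induct) (auto simp: eval_poly_add)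

lemma eval_poly_single:
  "eval_poly (Poly_Mapping.single m c) x = c * (\<Prod>i\<in>UNIV. (x $ i) ^ Poly_Mapping.lookup m i)"
  by (subst eval_poly_superset[of "{m}"]) auto

lemma lookup_partial_deriv:
  fixes f :: "'n::finite cpoly"
  shows "Poly_Mapping.lookup (partial_deriv i f) m =
    of_nat (Poly_Mapping.lookup m i + 1) * Poly_Mapping.lookup f (m + Poly_Mapping.single i 1)"
proof -
  let ?e = "Poly_Mapping.single i (1::nat)"
  \<comment> \<open>Subtraction of exponents is truncated: if the variable \<open>i\<close> does not
    occur in \<open>k\<close>, then \<open>k - ?e\<close> is \<open>k\<close> itself, and the factor
    \<open>Poly_Mapping.lookup k i = 0\<close> removes the term.\<close>
  have *: "(of_nat (Poly_Mapping.lookup k i) * Poly_Mapping.lookup f k when k - ?e = m) =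
    (if k = m + ?e then of_nat (Poly_Mapping.lookup k i) * Poly_Mapping.lookup f k else 0)" for k
  proof (cases "Poly_Mapping.lookup k i = 0")
    case True
    then have "k \<noteq> m + ?e" by (auto simp: lookup_add)
    with True show ?thesis by (simp add: when_def)
  next
    case False
    have "(k - ?e) + ?e = k"
      using False by (intro poly_mapping_eqI) (auto simp: lookup_add lookup_minus lookup_single when_def)
    then have "k - ?e = m \<longleftrightarrow> k = m + ?e" by auto
    then show ?thesis by (simp add: when_def)
  qed
  have "Poly_Mapping.lookup (partial_deriv i f) m =
    (\<Sum>k\<in>Poly_Mapping.keys f. if k = m + ?e then of_nat (Poly_Mapping.lookup k i) * Poly_Mapping.lookup f k else 0)"
    unfolding partial_deriv_def lookup_sum lookup_single * ..
  also have "\<dots> = of_nat (Poly_Mapping.lookup m i + 1) * Poly_Mapping.lookup f (m + ?e)"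
    by (auto simp: sum.delta in_keys_iff lookup_add)
  finally show ?thesis .
qed

lemma euler_identity:
  fixes f :: "'n::finite cpoly"
  assumes "homogeneous d f"
  shows "(\<Sum>i\<in>UNIV. x $ i * eval_poly (partial_deriv i f) x) = of_nat d * eval_poly f x"
proof -
  have *: "x $ i * (of_nat (Poly_Mapping.lookup k i) *
      (\<Prod>j\<in>UNIV. (x $ j) ^ Poly_Mapping.lookup (k - Poly_Mapping.single i 1) j)) =
    of_nat (Poly_Mapping.lookup k i) * (\<Prod>j\<in>UNIV. (x $ j) ^ Poly_Mapping.lookup k j)" for i k
  proof (cases "Poly_Mapping.lookup k i = 0")
    case False
    have "(\<Prod>j\<in>UNIV. (x $ j) ^ Poly_Mapping.lookup k j) =
      x $ i ^ Poly_Mapping.lookup k i * (\<Prod>j\<in>UNIV - {i}. (x $ j) ^ Poly_Mapping.lookup k j)"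
      by (subst prod.remove[of _ i]) auto
    moreover have "(\<Prod>j\<in>UNIV. (x $ j) ^ Poly_Mapping.lookup (k - Poly_Mapping.single i 1) j) =
      x $ i ^ (Poly_Mapping.lookup k i - 1) * (\<Prod>j\<in>UNIV - {i}. (x $ j) ^ Poly_Mapping.lookup k j)"
      by (subst prod.remove[of _ i]) (auto simp: lookup_minus lookup_single when_def intro!: prod.cong)
    moreover have "x $ i * x $ i ^ (Poly_Mapping.lookup k i - 1) = x $ i ^ Poly_Mapping.lookup k i"
      using False by (simp flip: power_Suc)
    ultimately show ?thesis by (simp add: mult_ac)
  qed simp
  have "(\<Sum>i\<in>UNIV. x $ i * eval_poly (partial_deriv i f) x) =
    (\<Sum>i\<in>UNIV. \<Sum>k\<in>Poly_Mapping.keys f. Poly_Mapping.lookup f k * (of_nat (Poly_Mapping.lookup k i) *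
      (\<Prod>j\<in>UNIV. (x $ j) ^ Poly_Mapping.lookup k j)))"
    unfolding partial_deriv_def eval_poly_sum eval_poly_single sum_distrib_left
  proof (intro sum.cong refl)
    fix i k
    show "x $ i * (of_nat (Poly_Mapping.lookup k i) * Poly_Mapping.lookup f k *
        (\<Prod>j\<in>UNIV. (x $ j) ^ Poly_Mapping.lookup (k - Poly_Mapping.single i 1) j)) =
      Poly_Mapping.lookup f k * (of_nat (Poly_Mapping.lookup k i) *
        (\<Prod>j\<in>UNIV. (x $ j) ^ Poly_Mapping.lookup k j))"
      using arg_cong[OF *[of i k], of "\<lambda>z. Poly_Mapping.lookup f k * z"] by (simp only: mult_ac)
  qed
  also have "\<dots> = (\<Sum>k\<in>Poly_Mapping.keys f. \<Sum>i\<in>UNIV. Poly_Mapping.lookup f k * (of_nat (Poly_Mapping.lookup k i) *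
      (\<Prod>j\<in>UNIV. (x $ j) ^ Poly_Mapping.lookup k j)))"
    by (rule sum.swap)
  also have "\<dots> = (\<Sum>k\<in>Poly_Mapping.keys f. of_nat (\<Sum>i\<in>UNIV. Poly_Mapping.lookup k i) *
      (Poly_Mapping.lookup f k * (\<Prod>j\<in>UNIV. (x $ j) ^ Poly_Mapping.lookup k j)))"
    by (simp add: sum_distrib_left sum_distrib_right mult_ac)
  also have "\<dots> = of_nat d * eval_poly f x"
    using assms unfolding homogeneous_def eval_poly_def sum_distrib_left
    by (intro sum.cong) auto
  finally show ?thesis .
qed

lemma homogeneous_partial_deriv:
  assumes "homogeneous (Suc d) f"
  shows "homogeneous d (partial_deriv i f)"
  unfolding homogeneous_def
proof
  fix m assume "m \<in> Poly_Mapping.keys (partial_deriv i f)"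
  then have "m + Poly_Mapping.single i 1 \<in> Poly_Mapping.keys f"
    by (simp add: in_keys_iff lookup_partial_deriv)
  then have "(\<Sum>j\<in>UNIV. Poly_Mapping.lookup (m + Poly_Mapping.single i 1) j) = Suc d"
    using assms unfolding homogeneous_def by blast
  then show "(\<Sum>j\<in>UNIV. Poly_Mapping.lookup m j) = d"
    by (simp add: lookup_add lookup_single when_def sum.distrib sum.delta)
qed

lemma coeffs_in_partial_deriv:
  assumes "subring A" "coeffs_in A f"
  shows "coeffs_in A (partial_deriv i f)"
proof -
  interpret subring A by fact
  show ?thesis
    using assms(2) of_nat_closed mult_closed unfolding coeffs_in_def lookup_partial_deriv by blast
qed

lemma partial_deriv_commute: "partial_deriv i (partial_deriv j f) = partial_deriv j (partial_deriv i f)"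
proof (cases "i = j")
  case False
  have "m + Poly_Mapping.single i 1 + Poly_Mapping.single j 1 =
    m + Poly_Mapping.single j 1 + Poly_Mapping.single i (1::nat)" for m
    by (simp add: add_ac)
  then show ?thesis using False
    by (intro poly_mapping_eqI) (simp add: lookup_partial_deriv lookup_add lookup_single when_def)
qed simp

lemma eval_poly_homogeneous_0:
  assumes "homogeneous 0 f"
  shows "eval_poly f x = Poly_Mapping.lookup f 0"
proof -
  have "Poly_Mapping.keys f \<subseteq> {0}"
    using assms unfolding homogeneous_def by (auto intro!: poly_mapping_eqI)
  then show ?thesis by (subst eval_poly_superset[of "{0}"]) auto
qed

lemma eval_poly_scale:
  assumes "homogeneous d f"
  shows "eval_poly f (c *s x) = c ^ d * eval_poly f x"
  unfolding eval_poly_def sum_distrib_left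
proof (rule sum.cong)
  fix m assume "m \<in> Poly_Mapping.keys f"
  then have "(\<Sum>i\<in>UNIV. Poly_Mapping.lookup m i) = d" using assms by (auto simp: homogeneous_def)
  then have "(\<Prod>i\<in>UNIV. (c *s x) $ i ^ Poly_Mapping.lookup m i) = c ^ d * (\<Prod>i\<in>UNIV. x $ i ^ Poly_Mapping.lookup m i)"
    by (simp add: power_mult_distrib prod.distrib flip: power_sum)
  then show "Poly_Mapping.lookup f m * (\<Prod>i\<in>UNIV. (c *s x) $ i ^ Poly_Mapping.lookup m i) =
    c ^ d * (Poly_Mapping.lookup f m * (\<Prod>i\<in>UNIV. x $ i ^ Poly_Mapping.lookup m i))" by simp
qed simp

section \<open>Linear forms and the polarization of a cubic form\<close>

definition lin :: "complex ^ 'n \<Rightarrow> complex ^ 'n \<Rightarrow> complex" where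
  "lin c x = (\<Sum>i\<in>UNIV. c $ i * x $ i)"

lemma lin_add: "lin c (x + y) = lin c x + lin c y"
  and lin_diff: "lin c (x - y) = lin c x - lin c y"
  and lin_scale: "lin c (a *s x) = a * lin c x"
  by (simp_all add: lin_def sum.distrib sum_subtractf sum_distrib_left algebra_simps)

lemmas lin_simps = lin_add lin_diff lin_scale

lemma eval_poly_homogeneous_1:
  fixes l :: "'n::finite cpoly"
  assumes "homogeneous 1 l"
  shows "eval_poly l x = lin (\<chi> i. Poly_Mapping.lookup l (Poly_Mapping.single i 1)) x"
proof -
  have "eval_poly (partial_deriv i l) x = Poly_Mapping.lookup l (Poly_Mapping.single i 1)" for i
    using assms homogeneous_partial_deriv[of 0 l i]
    by (subst eval_poly_homogeneous_0) (auto simp: lookup_partial_deriv)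
  then show ?thesis using euler_identity[OF assms, of x] by (simp add: lin_def mult.commute)
qed

text \<open>The polarization of a cubic form: if \<open>F\<close> is homogeneous of degree 3, then
  \<open>F x = tri F x x x\<close>. The third partial derivatives are then constants, read off as
  coefficients at the zero exponent; 6 is 3 factorial.\<close>

definition tri :: "'n::finite cpoly \<Rightarrow> complex ^ 'n \<Rightarrow> complex ^ 'n \<Rightarrow> complex ^ 'n \<Rightarrow> complex" where
  "tri F a b c = (\<Sum>i\<in>UNIV. \<Sum>j\<in>UNIV. \<Sum>k\<in>UNIV.
     Poly_Mapping.lookup (partial_deriv i (partial_deriv j (partial_deriv k F))) 0 / 6 * a $ i * b $ j * c $ k)"

lemma tri_add: "tri F (a + a') b c = tri F a b c + tri F a' b c"
  unfolding tri_def by (simp only: vector_add_component distrib_left distrib_right sum.distrib)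

lemma tri_scale: "tri F (s *s a) b c = s * tri F a b c"
  unfolding tri_def by (simp add: sum_distrib_left mult_ac)

lemma tri_commute12: "tri F a b c = tri F b a c"
  unfolding tri_def
  by (subst sum.swap) (simp add: partial_deriv_commute[of _ _ "partial_deriv _ F"] mult_ac)

lemma tri_commute23: "tri F a b c = tri F a c b"
  unfolding tri_def
  by (rule sum.cong[OF refl], subst sum.swap) (simp add: partial_deriv_commute[of _ _ F] mult_ac)

lemma tri_expand:
  "tri F a (b + b') c = tri F a b c + tri F a b' c" "tri F a (s *s b) c = s * tri F a b c"
  "tri F a b (c + c') = tri F a b c + tri F a b c'" "tri F a b (s *s c) = s * tri F a b c"
  by (metis tri_add tri_scale tri_commute12 tri_commute23)+

lemmas tri_simps = tri_add tri_scale tri_expand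

context
  fixes F :: "'n::finite cpoly"
  assumes hom: "homogeneous 3 F"
begin

lemma eval_second_deriv:
  "eval_poly (partial_deriv j (partial_deriv k F)) x =
    (\<Sum>i\<in>UNIV. x $ i * Poly_Mapping.lookup (partial_deriv i (partial_deriv j (partial_deriv k F))) 0)"
proof -
  have h1: "homogeneous 1 (partial_deriv j (partial_deriv k F))"
    using hom by (auto intro!: homogeneous_partial_deriv simp: numeral_eq_Suc)
  have "homogeneous 0 (partial_deriv i (partial_deriv j (partial_deriv k F)))" for i
    using h1 by (auto intro!: homogeneous_partial_deriv)
  then show ?thesis using euler_identity[OF h1, of x] by (simp add: eval_poly_homogeneous_0)
qed

lemma hessian_form_tri: "hessian_form F x v w = 6 * tri F x v w"
proof -
  have "hessian_form F x v w = (\<Sum>j\<in>UNIV. \<Sum>k\<in>UNIV. \<Sum>i\<in>UNIV.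
     Poly_Mapping.lookup (partial_deriv i (partial_deriv j (partial_deriv k F))) 0 * x $ i * v $ j * w $ k)"
    unfolding hessian_form_def eval_second_deriv
    by (simp add: sum_distrib_right sum_distrib_left mult_ac)
  also have "\<dots> = (\<Sum>j\<in>UNIV. \<Sum>i\<in>UNIV. \<Sum>k\<in>UNIV.
     Poly_Mapping.lookup (partial_deriv i (partial_deriv j (partial_deriv k F))) 0 * x $ i * v $ j * w $ k)"
    by (rule sum.cong[OF refl], rule sum.swap)
  also have "\<dots> = (\<Sum>i\<in>UNIV. \<Sum>j\<in>UNIV. \<Sum>k\<in>UNIV.
     Poly_Mapping.lookup (partial_deriv i (partial_deriv j (partial_deriv k F))) 0 * x $ i * v $ j * w $ k)"
    by (rule sum.swap)
  also have "\<dots> = 6 * tri F x v w"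
    unfolding tri_def by (simp add: sum_distrib_left)
  finally show ?thesis .
qed

text \<open>Euler's identity for the quadratic partial derivatives expresses the gradient through
  the Hessian form; the factor 3 is the 6 of \<open>hessian_form_tri\<close> divided by the degree
  2.\<close>

lemma sum_partial_deriv_tri:
  "(\<Sum>i\<in>UNIV. w $ i * eval_poly (partial_deriv i F) x) = 3 * tri F w x x"
proof -
  have "2 * eval_poly (partial_deriv k F) x = (\<Sum>j\<in>UNIV. x $ j * eval_poly (partial_deriv j (partial_deriv k F)) x)" for k
  proof -
    have "homogeneous 2 (partial_deriv k F)"
      using hom by (auto intro!: homogeneous_partial_deriv simp: numeral_eq_Suc)
    from euler_identity[OF this, of x] show ?thesis by simp
  qed
  then have "2 * (\<Sum>k\<in>UNIV. w $ k * eval_poly (partial_deriv k F) x) =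
    (\<Sum>k\<in>UNIV. w $ k * (\<Sum>j\<in>UNIV. x $ j * eval_poly (partial_deriv j (partial_deriv k F)) x))"
    unfolding sum_distrib_left[of 2] by (intro sum.cong refl) (metis mult.left_commute)
  also have "\<dots> = hessian_form F x x w"
    unfolding hessian_form_def sum_distrib_left
    by (subst sum.swap) (simp add: mult_ac)
  also have "\<dots> = 6 * tri F w x x"
    unfolding hessian_form_tri by (metis tri_commute12 tri_commute23)
  finally show ?thesis by simp
qed

lemma eval_poly_tri: "eval_poly F x = tri F x x x"
  using sum_partial_deriv_tri[of x x] euler_identity[OF hom, of x] by simp

lemma partial_derivs_zero_iff_tri:
  "(\<forall>i. eval_poly (partial_deriv i F) x = 0) \<longleftrightarrow> (\<forall>w. tri F w x x = 0)"
proof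
  assume "\<forall>i. eval_poly (partial_deriv i F) x = 0"
  then show "\<forall>w. tri F w x x = 0" using sum_partial_deriv_tri[of _ x] by simp
next
  assume *: "\<forall>w. tri F w x x = 0"
  show "\<forall>i. eval_poly (partial_deriv i F) x = 0"
  proof
    fix i
    have "(\<Sum>j\<in>UNIV. axis i 1 $ j * eval_poly (partial_deriv j F) x) = 0"
      using * sum_partial_deriv_tri[of "axis i 1" x] by simp
    then show "eval_poly (partial_deriv i F) x = 0"
      by (simp add: axis_def if_distrib[of "\<lambda>a. a * _"] cong: if_cong)
  qed
qed

end

lemma tri_in:
  fixes a b c :: "complex ^ 'n::finite"
  assumes "subring A" "inverse 6 \<in> A" "coeffs_in A F"
    and "\<And>i. a $ i \<in> A" "\<And>i. b $ i \<in> A" "\<And>i. c $ i \<in> A"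
  shows "tri F a b c \<in> A"
proof -
  interpret subring A by fact
  have "coeffs_in A (partial_deriv i (partial_deriv j (partial_deriv k F)))" for i j k
    using assms by (intro coeffs_in_partial_deriv)
  then show ?thesis
    using assms(2,4-) unfolding tri_def divide_inverse coeffs_in_def
    by (intro sum_closed mult_closed) auto
qed

section \<open>Homogeneous coordinates of projective points\<close>

lemma hom_coords_nonzero: "x \<in> hom_coords P \<Longrightarrow> x \<noteq> 0"
  by (simp add: hom_coords_def)

lemma hom_coords_span:
  fixes P :: "'n::finite proj"
  assumes x: "x \<in> hom_coords P"
  shows "Rep_proj P = vec.span {x}"
proof -
  have P: "vec.subspace (Rep_proj P)" "vec.dim (Rep_proj P) = 1" using Rep_proj[of P] by auto
  have "{x} \<subseteq> Rep_proj P" "x \<noteq> 0" using x by (auto simp: hom_coords_def)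
  moreover have "vec.independent {x}" using \<open>x \<noteq> 0\<close> by (simp add: vec.dependent_single)
  ultimately have "Rep_proj P \<subseteq> vec.span {x}"
    using P by (intro vec.card_ge_dim_independent) auto
  moreover have "vec.span {x} \<subseteq> Rep_proj P"
    using \<open>{x} \<subseteq> Rep_proj P\<close> P(1) by (rule vec.span_minimal)
  ultimately show ?thesis by auto
qed

lemma hom_coords_iff:
  assumes "x \<in> hom_coords P"
  shows "y \<in> hom_coords P \<longleftrightarrow> (\<exists>c. c \<noteq> 0 \<and> y = c *s x)"
proof -
  have "Rep_proj P = range (\<lambda>c. c *s x)"
    unfolding hom_coords_span[OF assms] by (rule vec.span_singleton)
  then show ?thesis
    using hom_coords_nonzero[OF assms] unfolding hom_coords_def by (auto simp: vec_eq_iff)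
qed

lemma hom_coords_exists:
  fixes x :: "complex ^ 'n::finite"
  assumes "x \<noteq> 0"
  shows "\<exists>P. x \<in> hom_coords P"
proof -
  have "vec.dim {x} = 1"
    using assms by (subst vec.dim_eq_card_independent) (auto simp: vec.dependent_single)
  then have "Rep_proj (Abs_proj (vec.span {x})) = vec.span {x}"
    by (intro Abs_proj_inverse) (simp add: vec.dim_span vec.subspace_span)
  then have "x \<in> hom_coords (Abs_proj (vec.span {x}))"
    using assms by (simp add: hom_coords_def vec.span_base)
  then show ?thesis ..
qed

lemma proj_zeros_iff:
  assumes "x \<in> hom_coords P" "homogeneous d f"
  shows "P \<in> proj_zeros {f} \<longleftrightarrow> eval_poly f x = 0"
  unfolding proj_zeros_def using hom_coords_iff[OF assms(1)] assms
  by (auto simp: eval_poly_scale)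

section \<open>Points with two unit coordinates are integral\<close>

context place
begin

lemma nonzero_outside: "b \<notin> \<nu> \<Longrightarrow> b \<noteq> 0"
  using zero by auto

lemma local_ringI: "a \<in> ring_of_integers L \<Longrightarrow> b \<in> ring_of_integers L \<Longrightarrow> b \<notin> \<nu> \<Longrightarrow> a / b \<in> local_ring L \<nu>"
  unfolding local_ring_def by blast

lemma local_ringE:
  assumes "x \<in> local_ring L \<nu>"
  obtains a b where "x = a / b" "a \<in> ring_of_integers L" "b \<in> ring_of_integers L" "b \<notin> \<nu>"
  using assms unfolding local_ring_def by blast

lemma local_max_idealI: "a \<in> \<nu> \<Longrightarrow> b \<in> ring_of_integers L \<Longrightarrow> b \<notin> \<nu> \<Longrightarrow> a / b \<in> local_max_ideal L \<nu>"
  unfolding local_max_ideal_def by blast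

lemma local_max_idealE:
  assumes "x \<in> local_max_ideal L \<nu>"
  obtains a b where "x = a / b" "a \<in> \<nu>" "b \<in> ring_of_integers L" "b \<notin> \<nu>"
  using assms unfolding local_max_ideal_def by blast

lemma local_ring_mult:
  assumes "x \<in> local_ring L \<nu>" "y \<in> local_ring L \<nu>"
  shows "x * y \<in> local_ring L \<nu>"
proof -
  obtain a b where ab: "x = a / b" "a \<in> ring_of_integers L" "b \<in> ring_of_integers L" "b \<notin> \<nu>"
    using assms(1) by (rule local_ringE)
  obtain c d where cd: "y = c / d" "c \<in> ring_of_integers L" "d \<in> ring_of_integers L" "d \<notin> \<nu>"
    using assms(2) by (rule local_ringE)
  have "a * c / (b * d) \<in> local_ring L \<nu>"
    using prime[OF ab(3) cd(3)] ab cd by (intro local_ringI O.mult_closed) auto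
  then show ?thesis using ab cd by simp
qed

lemma local_ring_add:
  assumes "x \<in> local_ring L \<nu>" "y \<in> local_ring L \<nu>"
  shows "x + y \<in> local_ring L \<nu>"
proof -
  obtain a b where ab: "x = a / b" "a \<in> ring_of_integers L" "b \<in> ring_of_integers L" "b \<notin> \<nu>"
    using assms(1) by (rule local_ringE)
  obtain c d where cd: "y = c / d" "c \<in> ring_of_integers L" "d \<in> ring_of_integers L" "d \<notin> \<nu>"
    using assms(2) by (rule local_ringE)
  have "(a * d + c * b) / (b * d) \<in> local_ring L \<nu>"
    using prime[OF ab(3) cd(3)] ab cd by (intro local_ringI O.mult_closed O.add_closed) auto
  then show ?thesis
    unfolding ab(1) cd(1)
    using nonzero_outside[OF ab(4)] nonzero_outside[OF cd(4)] by (simp add: add_frac_eq)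
qed

lemma local_ring_of_int: "x \<in> ring_of_integers L \<Longrightarrow> x \<in> local_ring L \<nu>"
  using local_ringI[OF _ O.one_closed one, of x] by simp

lemma local_ring_sum: "(\<And>i. i \<in> I \<Longrightarrow> h i \<in> local_ring L \<nu>) \<Longrightarrow> sum h I \<in> local_ring L \<nu>"
  using local_ring_of_int[OF O.zero_closed]
  by (induction I rule: infinite_finite_induct) (auto intro: local_ring_add)

lemma local_max_ideal_mult:
  assumes "x \<in> local_max_ideal L \<nu>" "y \<in> local_ring L \<nu>"
  shows "x * y \<in> local_max_ideal L \<nu>"
proof -
  obtain a b where ab: "x = a / b" "a \<in> \<nu>" "b \<in> ring_of_integers L" "b \<notin> \<nu>"
    using assms(1) by (rule local_max_idealE)
  obtain c d where cd: "y = c / d" "c \<in> ring_of_integers L" "d \<in> ring_of_integers L" "d \<notin> \<nu>"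
    using assms(2) by (rule local_ringE)
  have "c * a / (b * d) \<in> local_max_ideal L \<nu>"
    using prime[OF ab(3) cd(3)] ab cd by (intro local_max_idealI O.mult_closed mult) auto
  then show ?thesis using ab cd by (simp add: mult.commute)
qed

lemma local_max_ideal_one: "1 \<notin> local_max_ideal L \<nu>"
proof
  assume "1 \<in> local_max_ideal L \<nu>"
  then obtain a b where *: "1 = a / b" "a \<in> \<nu>" "b \<notin> \<nu>" by (rule local_max_idealE)
  then show False using nonzero_outside[of b] by simp
qed

lemma local_max_ideal_prime:
  assumes "x \<in> local_ring L \<nu>" "y \<in> local_ring L \<nu>" "x * y \<in> local_max_ideal L \<nu>"
  shows "x \<in> local_max_ideal L \<nu> \<or> y \<in> local_max_ideal L \<nu>"
proof -
  obtain a b where ab: "x = a / b" "a \<in> ring_of_integers L" "b \<in> ring_of_integers L" "b \<notin> \<nu>"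
    using assms(1) by (rule local_ringE)
  obtain c d where cd: "y = c / d" "c \<in> ring_of_integers L" "d \<in> ring_of_integers L" "d \<notin> \<nu>"
    using assms(2) by (rule local_ringE)
  obtain r s where rs: "x * y = r / s" "r \<in> \<nu>" "s \<in> ring_of_integers L" "s \<notin> \<nu>"
    using assms(3) by (rule local_max_idealE)
  have "a = x * b" "c = y * d" "r = x * y * s"
    using ab(1) cd(1) rs(1) nonzero_outside[OF ab(4)] nonzero_outside[OF cd(4)] nonzero_outside[OF rs(4)]
    by simp_all
  then have "(a * c) * s = (b * d) * r" by (simp only: mult_ac)
  also have "\<dots> \<in> \<nu>" using ab cd rs by (intro mult O.mult_closed)
  finally have "a * c \<in> \<nu>" using prime[of "a * c" s] ab cd rs O.mult_closed by auto
  then have "a \<in> \<nu> \<or> c \<in> \<nu>" using prime ab cd by auto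
  then show ?thesis using ab cd local_max_idealI by auto
qed

lemma S_integers_local_ring:
  assumes "of_nat M \<notin> \<nu>" "x \<in> S_integers L M"
  shows "x \<in> local_ring L \<nu>"
proof -
  obtain k where k: "of_nat M ^ k * x \<in> ring_of_integers L"
    using assms unfolding S_integers_def by auto
  have "of_nat M ^ k \<notin> \<nu>" using power assms O.of_nat_closed by auto
  with k have "(of_nat M ^ k * x) / of_nat M ^ k \<in> local_ring L \<nu>"
    by (intro local_ringI O.power_closed O.of_nat_closed)
  then show ?thesis using nonzero_outside[OF assms(1)] by simp
qed

lemma S_unit_notin_local_max_ideal:
  assumes "of_nat M \<notin> \<nu>" "inverse x \<in> S_integers L M" "x \<noteq> 0"
  shows "x \<notin> local_max_ideal L \<nu>"
  using local_max_ideal_mult[OF _ S_integers_local_ring[OF assms(1,2)], of x] assms(3)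
    local_max_ideal_one by auto

end

lemma prod_power_single: "(\<Prod>k\<in>UNIV. (x $ k) ^ Poly_Mapping.lookup (Poly_Mapping.single i 1) k) = x $ i"
  for x :: "complex ^ 'n::finite"
  by (subst prod.remove[of _ i]) (auto simp: lookup_single when_def)

lemma product_of_linear_forms:
  fixes c d :: "complex ^ 'n::finite"
  assumes "subring A" "\<And>i. c $ i \<in> A" "\<And>i. d $ i \<in> A"
  obtains f :: "'n cpoly" where "homogeneous 2 f" "coeffs_in A f" "\<And>x. eval_poly f x = lin c x * lin d x"
proof -
  interpret subring A by fact
  define f :: "'n cpoly" where "f = (\<Sum>i\<in>UNIV. \<Sum>j\<in>UNIV.
    Poly_Mapping.single (Poly_Mapping.single i 1 + Poly_Mapping.single j 1) (c $ i * d $ j))"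
  have lk: "Poly_Mapping.lookup f m = (\<Sum>i\<in>UNIV. \<Sum>j\<in>UNIV.
    (c $ i * d $ j when Poly_Mapping.single i 1 + Poly_Mapping.single j 1 = m))" for m
    unfolding f_def lookup_sum lookup_single ..
  have "coeffs_in A f"
    unfolding coeffs_in_def lk when_def using assms by (auto intro!: sum_closed closed)
  moreover have "homogeneous 2 f"
    unfolding homogeneous_def
  proof
    fix m assume "m \<in> Poly_Mapping.keys f"
    then have "Poly_Mapping.lookup f m \<noteq> 0" by (simp add: in_keys_iff)
    then have "\<exists>i j. Poly_Mapping.single i 1 + Poly_Mapping.single j 1 = m"
      unfolding lk by (rule contrapos_np) (auto simp: when_def intro!: sum.neutral)
    then obtain i j where "Poly_Mapping.single i 1 + Poly_Mapping.single j 1 = m" by blast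
    then show "(\<Sum>i\<in>UNIV. Poly_Mapping.lookup m i) = 2"
      by (auto simp: lookup_add lookup_single when_def sum.distrib sum.delta)
  qed
  moreover have "eval_poly f x = lin c x * lin d x" for x
    unfolding f_def eval_poly_sum eval_poly_single lookup_add power_add prod.distrib prod_power_single
    by (simp add: lin_def sum_product mult_ac)
  ultimately show ?thesis using that by blast
qed

text \<open>The product of the two linear forms vanishes on the divisor. If
  \<open>y = a *s x\<close> exhibited a reduction into it, then \<open>a ^ 2\<close> times a local
  unit would lie in the maximal ideal; so would \<open>a\<close>, and with it every coordinate of
  \<open>y\<close>, against the normalization of \<open>y\<close>.\<close>

lemma integral_pointI:
  fixes l\<^sub>1 l\<^sub>2 :: "'n::finite cpoly" and c\<^sub>1 c\<^sub>2 x :: "complex ^ 'n"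
  assumes L: "number_field L"
    and l: "homogeneous 1 l\<^sub>1" "homogeneous 1 l\<^sub>2"
    and lc: "\<And>x. eval_poly l\<^sub>1 x = lin c\<^sub>1 x" "\<And>x. eval_poly l\<^sub>2 x = lin c\<^sub>2 x"
    and c: "\<And>i. c\<^sub>1 $ i \<in> S_integers L M" "\<And>i. c\<^sub>2 $ i \<in> S_integers L M"
    and P: "P \<in> B" "x \<in> hom_coords P" "\<And>i. x $ i \<in> S_integers L M"
    and nz: "lin c\<^sub>1 x \<noteq> 0" "lin c\<^sub>2 x \<noteq> 0"
    and inv: "inverse (lin c\<^sub>1 x) \<in> S_integers L M" "inverse (lin c\<^sub>2 x) \<in> S_integers L M"
  shows "P \<in> integral_points L {\<nu>. finite_place L \<nu> \<and> of_nat M \<in> \<nu>} B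
    (B \<inter> proj_zeros {l\<^sub>1} \<union> B \<inter> proj_zeros {l\<^sub>2})" (is "_ \<in> integral_points _ _ _ ?D")
proof -
  interpret R: subring "S_integers L M" using L by (rule subring_S_integers)
  have "P \<notin> proj_zeros {l\<^sub>1}" "P \<notin> proj_zeros {l\<^sub>2}"
    using proj_zeros_iff[OF P(2) l(1)] proj_zeros_iff[OF P(2) l(2)] nz lc by auto
  moreover have "rational_point L P"
    using P(2,3) unfolding rational_point_def S_integers_def by auto
  moreover have "\<not> reduces_into L \<nu> ?D P" if \<nu>: "finite_place L \<nu>" "of_nat M \<notin> \<nu>" for \<nu>
  proof
    interpret place L \<nu> by unfold_locales fact+
    assume "reduces_into L \<nu> ?D P"
    then obtain y :: "complex ^ 'n" and i where y: "y \<in> hom_coords P" "\<And>i. y $ i \<in> local_ring L \<nu>" "y $ i \<notin> local_max_ideal L \<nu>"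
      and red: "\<And>d f. homogeneous d f \<Longrightarrow> coeffs_in (local_ring L \<nu>) f \<Longrightarrow> ?D \<subseteq> proj_zeros {f} \<Longrightarrow>
        eval_poly f y \<in> local_max_ideal L \<nu>"
      unfolding reduces_into_def by blast
    obtain a where a: "a \<noteq> 0" "y = a *s x" using y(1) hom_coords_iff[OF P(2)] by auto
    note loc = S_integers_local_ring[OF \<nu>(2)]
    have "lin c\<^sub>1 y \<in> local_ring L \<nu>"
      unfolding lin_def using y(2) c loc by (intro local_ring_sum local_ring_mult) auto
    then have "lin c\<^sub>1 y * inverse (lin c\<^sub>1 x) \<in> local_ring L \<nu>"
      using inv loc by (intro local_ring_mult) auto
    \<comment> \<open>The scaling factor is locally integral, being the quotient of
      \<open>lin c\<^sub>1 y\<close> by the unit \<open>lin c\<^sub>1 x\<close>.\<close>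
    then have aL: "a \<in> local_ring L \<nu>" using nz a by (simp add: lin_scale mult.assoc)
    obtain f where f: "homogeneous 2 f" "coeffs_in (S_integers L M) f"
      "\<And>x. eval_poly f x = lin c\<^sub>1 x * lin c\<^sub>2 x"
      using product_of_linear_forms[OF R.subring_axioms c] by blast
    have "?D \<subseteq> proj_zeros {f}"
      using l lc unfolding proj_zeros_def by (auto simp: f(3))
    then have "eval_poly f y \<in> local_max_ideal L \<nu>"
      using f loc by (intro red) (auto simp: coeffs_in_def)
    then have m: "a * (a * (lin c\<^sub>1 x * lin c\<^sub>2 x)) \<in> local_max_ideal L \<nu>"
      unfolding f(3) a(2) lin_scale by (simp add: mult_ac)
    have x1: "lin c\<^sub>1 x \<in> local_ring L \<nu>" "lin c\<^sub>2 x \<in> local_ring L \<nu>"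
      unfolding lin_def using P(3) c by (auto intro!: loc R.sum_closed R.mult_closed)
    have x2: "lin c\<^sub>1 x \<notin> local_max_ideal L \<nu>" "lin c\<^sub>2 x \<notin> local_max_ideal L \<nu>"
      using S_unit_notin_local_max_ideal[OF \<nu>(2)] inv nz by auto
    have x12: "lin c\<^sub>1 x * lin c\<^sub>2 x \<in> local_ring L \<nu>" using x1 by (rule local_ring_mult)
    have "lin c\<^sub>1 x * lin c\<^sub>2 x \<notin> local_max_ideal L \<nu>"
      using local_max_ideal_prime[OF x1] x2 by auto
    then have "a \<in> local_max_ideal L \<nu>"
      using local_max_ideal_prime[OF aL local_ring_mult[OF aL x12] m]
        local_max_ideal_prime[OF aL x12] by auto
    then have "y $ i \<in> local_max_ideal L \<nu>"
      using local_max_ideal_mult loc P(3) a(2) by simp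
    then show False using y(3) by simp
  qed
  ultimately show ?thesis using P(1) unfolding integral_points_def by blast
qed

section \<open>Zariski density on a nodal cubic\<close>

text \<open>Polynomials are handled as functions, so that forms composed with parametrized curves
  need no explicit coefficients.\<close>

definition poly_fun :: "(complex \<Rightarrow> complex) \<Rightarrow> bool" where
  "poly_fun h \<longleftrightarrow> (\<exists>p. \<forall>x. h x = poly p x)"

lemma poly_fun_const: "poly_fun (\<lambda>_. c)"
  unfolding poly_fun_def by (intro exI[of _ "[:c:]"]) simp

lemma poly_fun_ident: "poly_fun (\<lambda>x. x)"
  unfolding poly_fun_def by (intro exI[of _ "[:0, 1:]"]) simp

lemma poly_fun_add: "poly_fun g \<Longrightarrow> poly_fun h \<Longrightarrow> poly_fun (\<lambda>x. g x + h x)"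
  unfolding poly_fun_def by (metis poly_add)

lemma poly_fun_diff: "poly_fun g \<Longrightarrow> poly_fun h \<Longrightarrow> poly_fun (\<lambda>x. g x - h x)"
  unfolding poly_fun_def by (metis poly_diff)

lemma poly_fun_mult: "poly_fun g \<Longrightarrow> poly_fun h \<Longrightarrow> poly_fun (\<lambda>x. g x * h x)"
  unfolding poly_fun_def by (metis poly_mult)

lemma poly_fun_power: "poly_fun g \<Longrightarrow> poly_fun (\<lambda>x. g x ^ n)"
  by (induction n) (auto intro: poly_fun_const poly_fun_mult)

lemma poly_fun_sum: "(\<And>i. i \<in> I \<Longrightarrow> poly_fun (g i)) \<Longrightarrow> poly_fun (\<lambda>x. \<Sum>i\<in>I. g i x)"
  by (induction I rule: infinite_finite_induct) (auto intro: poly_fun_const poly_fun_add)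

lemma poly_fun_prod: "(\<And>i. i \<in> I \<Longrightarrow> poly_fun (g i)) \<Longrightarrow> poly_fun (\<lambda>x. \<Prod>i\<in>I. g i x)"
  by (induction I rule: infinite_finite_induct) (auto intro: poly_fun_const poly_fun_mult)

lemmas poly_fun_intros = poly_fun_const poly_fun_ident poly_fun_add poly_fun_diff poly_fun_mult
  poly_fun_power poly_fun_sum poly_fun_prod

lemma poly_fun_infinite_zeros:
  assumes "poly_fun h" "infinite {x. h x = 0}"
  shows "h x = 0"
proof -
  obtain p where p: "\<And>x. h x = poly p x" using assms(1) by (auto simp: poly_fun_def)
  then have "p = 0" using assms(2) poly_roots_finite[of p] by auto
  then show ?thesis by (simp add: p)
qed

definition vec_poly_fun :: "(complex \<Rightarrow> complex ^ 'n) \<Rightarrow> bool" where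
  "vec_poly_fun X \<longleftrightarrow> (\<forall>i. poly_fun (\<lambda>t. X t $ i))"

lemma vec_poly_fun_const: "vec_poly_fun (\<lambda>_. v)"
  by (simp add: vec_poly_fun_def poly_fun_const)

lemma vec_poly_fun_add: "vec_poly_fun X \<Longrightarrow> vec_poly_fun Y \<Longrightarrow> vec_poly_fun (\<lambda>t. X t + Y t)"
  by (simp add: vec_poly_fun_def poly_fun_add)

lemma vec_poly_fun_diff: "vec_poly_fun X \<Longrightarrow> vec_poly_fun Y \<Longrightarrow> vec_poly_fun (\<lambda>t. X t - Y t)"
  by (simp add: vec_poly_fun_def poly_fun_diff)

lemma vec_poly_fun_scale: "poly_fun h \<Longrightarrow> vec_poly_fun X \<Longrightarrow> vec_poly_fun (\<lambda>t. h t *s X t)"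
  by (simp add: vec_poly_fun_def poly_fun_mult)

lemma poly_fun_eval_poly:
  assumes "vec_poly_fun X"
  shows "poly_fun (\<lambda>t. eval_poly G (X t))"
  using assms unfolding eval_poly_def vec_poly_fun_def by (intro poly_fun_intros) auto

lemma poly_fun_tri:
  assumes "vec_poly_fun X" "vec_poly_fun Y" "vec_poly_fun Z"
  shows "poly_fun (\<lambda>t. tri F (X t) (Y t) (Z t))"
  using assms unfolding tri_def vec_poly_fun_def by (intro poly_fun_intros) auto

lemma poly_fun_lin:
  assumes "vec_poly_fun X"
  shows "poly_fun (\<lambda>t. lin c (X t))"
  using assms unfolding lin_def vec_poly_fun_def by (intro poly_fun_intros) auto

lemmas vec_poly_fun_intros = vec_poly_fun_const vec_poly_fun_add vec_poly_fun_diff vec_poly_fun_scale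
  poly_fun_tri poly_fun_lin

text \<open>\<open>nf\<close>, \<open>ne\<close> and \<open>np\<close> are coordinate forms for
  \<open>f\<close>, \<open>e\<close> and \<open>p\<close>, while \<open>c\<^sub>1\<close> and
  \<open>c\<^sub>2\<close> play this role for \<open>a\<^sub>0\<close> and \<open>a\<^sub>1\<close>.
  \<open>nondegenerate\<close> is the ordinary double point condition freed from a chart: the kernel
  of the bilinear form \<open>tri F p\<close> is no larger than the line of
  \<open>p\<close>.\<close>

locale nodal_frame =
  fixes F :: "'n::finite cpoly"
    and c\<^sub>1 c\<^sub>2 nf ne np a\<^sub>0 a\<^sub>1 f e p :: "complex ^ 'n"
  assumes hom: "homogeneous 3 F"
    and expand: "\<And>z. z = lin c\<^sub>1 z *s a\<^sub>0 + lin c\<^sub>2 z *s a\<^sub>1 + lin nf z *s f + lin ne z *s e + lin np z *s p"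
    and dual: "lin c\<^sub>1 a\<^sub>0 = 1" "lin c\<^sub>1 a\<^sub>1 = 0" "lin c\<^sub>1 f = 0" "lin c\<^sub>1 e = 0" "lin c\<^sub>1 p = 0"
      "lin c\<^sub>2 a\<^sub>0 = 0" "lin c\<^sub>2 a\<^sub>1 = 1" "lin c\<^sub>2 f = 0" "lin c\<^sub>2 e = 0" "lin c\<^sub>2 p = 0"
      "lin nf f = 1" "lin nf e = 0" "lin nf p = 0" "lin ne e = 1" "lin ne p = 0"
    and singular: "\<And>w. tri F w p p = 0"
    and isotropic: "tri F p e e = 0"
    and nondegenerate: "\<And>v. (\<And>w. tri F p v w = 0) \<Longrightarrow> \<exists>c. v = c *s p"
    and unique_singular: "\<And>x. x \<noteq> 0 \<Longrightarrow> (\<And>w. tri F w x x = 0) \<Longrightarrow> \<exists>c. x = c *s p"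
begin

lemma singular': "tri F p p w = 0" "tri F p w p = 0"
  using singular[of w] tri_commute12 tri_commute23 by metis+

text \<open>The factor 3 makes \<open>Q y\<close> the coefficient of \<open>r\<close> in
  \<open>F (y + r *s p)\<close>: polarization contributes three equal terms linear in
  \<open>p\<close>.\<close>

definition Q :: "complex ^ 'n \<Rightarrow> complex" where "Q y = 3 * tri F p y y"
definition C :: "complex ^ 'n \<Rightarrow> complex" where "C y = tri F y y y"
text \<open>The inverse of the projection from the node, with the denominator \<open>Q y\<close>
  cleared. It depends on \<open>y\<close> only modulo \<open>p\<close>, which is why
  \<open>p\<close> is absent from \<open>affine_point\<close>.\<close>

definition proj_inv :: "complex ^ 'n \<Rightarrow> complex ^ 'n" where "proj_inv y = Q y *s y - C y *s p"
definition affine_point :: "complex \<Rightarrow> complex \<Rightarrow> complex \<Rightarrow> complex ^ 'n" where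
  "affine_point u s t = a\<^sub>0 + u *s a\<^sub>1 + s *s f + t *s e"

lemma Q_add: "Q (y + w) = Q y + 6 * tri F p y w + Q w"
  unfolding Q_def by (simp add: tri_simps tri_commute23[of F p w y] algebra_simps)

lemma Q_scale: "Q (c *s y) = c ^ 2 * Q y"
  unfolding Q_def by (simp add: tri_simps power2_eq_square)

lemma Q_vertex: "Q (y + r *s p) = Q y"
  unfolding Q_def by (simp add: tri_simps singular singular')

lemma C_add: "C (y + w) = C y + 3 * tri F y y w + 3 * tri F y w w + C w"
proof -
  have "tri F y w y = tri F y y w" "tri F w y y = tri F y y w" "tri F w y w = tri F y w w"
    "tri F w w y = tri F y w w"
    by (metis tri_commute12 tri_commute23)+
  then show ?thesis unfolding C_def by (simp add: tri_simps algebra_simps)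
qed

lemma C_scale: "C (c *s y) = c ^ 3 * C y"
  unfolding C_def by (simp add: tri_simps power3_eq_cube)

lemma C_vertex: "C (y + r *s p) = C y + r * Q y"
proof -
  have "tri F y y p = tri F p y y" by (metis tri_commute12 tri_commute23)
  then show ?thesis
    unfolding C_add C_scale by (simp add: tri_simps singular singular' Q_def C_def)
qed

lemma eval_F: "eval_poly F (y + r *s p) = C y + r * Q y"
  using eval_poly_tri[OF hom] C_vertex C_def by metis

lemma proj_inv_vertex: "proj_inv (y + r *s p) = proj_inv y"
  unfolding proj_inv_def Q_vertex C_vertex by (simp add: vec_eq_iff algebra_simps)

lemma proj_inv_scale: "proj_inv (c *s y) = c ^ 3 *s proj_inv y"
  unfolding proj_inv_def Q_scale C_scale
  by (simp add: vec_eq_iff algebra_simps power2_eq_square power3_eq_cube)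

lemma proj_inv_on_cubic:
  assumes "C y + r * Q y = 0"
  shows "proj_inv y = Q y *s (y + r *s p)"
proof -
  have "C y = - r * Q y" using assms by (simp add: eq_neg_iff_add_eq_0)
  then show ?thesis unfolding proj_inv_def by (simp add: vec_eq_iff algebra_simps)
qed

lemma vec_poly_fun_proj_inv: "vec_poly_fun X \<Longrightarrow> vec_poly_fun (\<lambda>t. proj_inv (X t))"
  unfolding proj_inv_def Q_def C_def by (intro vec_poly_fun_intros poly_fun_intros)

text \<open>A polynomial in \<open>u\<close>, \<open>s\<close>, \<open>t\<close> with nested
  infinite zero sets vanishes identically, one variable at a time from the inside. Homogeneity and
  invariance under adding multiples of \<open>p\<close> carry this from \<open>affine_point\<close>
  to every \<open>y\<close> off the first hyperplane.\<close>

lemma zero_on_proj_inv: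
  assumes G: "homogeneous d G"
    and dense: "infinite {u. infinite {s. infinite {t. eval_poly G (proj_inv (affine_point u s t)) = 0}}}"
    and y: "lin c\<^sub>1 y \<noteq> 0"
  shows "eval_poly G (proj_inv y) = 0"
proof -
  define h where "h u s t = eval_poly G (proj_inv (affine_point u s t))" for u s t
  have pf: "poly_fun (\<lambda>t. h u s t)" "poly_fun (\<lambda>s. h u s t)" "poly_fun (\<lambda>u. h u s t)" for u s t
    unfolding h_def affine_point_def
    by (intro poly_fun_eval_poly vec_poly_fun_proj_inv vec_poly_fun_intros poly_fun_intros)+
  have 1: "h u s t = 0" if "infinite {t. h u s t = 0}" for u s t
    using poly_fun_infinite_zeros[OF pf(1) that] .
  have 2: "h u s t = 0" if u: "infinite {s. infinite {t. h u s t = 0}}" for u s t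
  proof -
    have "{s. infinite {t. h u s t = 0}} \<subseteq> {s. h u s t = 0}"
      using 1 by (intro Collect_mono) blast
    then have "infinite {s. h u s t = 0}" using u infinite_super by blast
    then show ?thesis using poly_fun_infinite_zeros[OF pf(2)] by blast
  qed
  have 3: "h u s t = 0" for u s t
  proof -
    have "{u. infinite {s. infinite {t. h u s t = 0}}} \<subseteq> {u. h u s t = 0}"
      using 2 by (intro Collect_mono) blast
    then have "infinite {u. h u s t = 0}" using infinite_super dense[folded h_def] by blast
    then show ?thesis using poly_fun_infinite_zeros[OF pf(3)] by blast
  qed
  define a where "a = lin c\<^sub>1 y"
  have "y = lin c\<^sub>1 y *s a\<^sub>0 + lin c\<^sub>2 y *s a\<^sub>1 + lin nf y *s f + lin ne y *s e + lin np y *s p"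
    by (rule expand)
  also have "\<dots> = a *s affine_point (lin c\<^sub>2 y / a) (lin nf y / a) (lin ne y / a) + lin np y *s p"
    using y unfolding a_def[symmetric] by (simp add: affine_point_def vec_eq_iff distrib_left)
  finally have "proj_inv y = a ^ 3 *s proj_inv (affine_point (lin c\<^sub>2 y / a) (lin nf y / a) (lin ne y / a))"
    using proj_inv_vertex proj_inv_scale by metis
  then show ?thesis using 3 eval_poly_scale[OF G] h_def by simp
qed

text \<open>Up to factors, \<open>\<alpha>\<close> and \<open>\<beta>\<close> are the differentials
  at \<open>y\<close> of the tangent cone form and of the cubic. \<open>\<alpha>\<close> is nonzero
  because \<open>y\<close> is not a multiple of \<open>p\<close>. If \<open>\<beta>\<close> were a
  multiple of \<open>\<alpha>\<close>, some \<open>y + m *s p\<close> would be a second singular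
  point. Hence the two are independent.\<close>

lemma transversal_direction:
  assumes y: "lin c\<^sub>1 y \<noteq> 0"
  shows "\<exists>w. tri F y y w = 0 \<and> tri F p y w \<noteq> 0"
proof -
  define \<alpha> \<beta> where "\<alpha> w = tri F p y w" and "\<beta> w = tri F y y w" for w
  have lin\<alpha>: "\<alpha> (v + w) = \<alpha> v + \<alpha> w" "\<alpha> (c *s v) = c * \<alpha> v"
    and lin\<beta>: "\<beta> (v + w) = \<beta> v + \<beta> w" "\<beta> (c *s v) = c * \<beta> v" for v w c
    by (simp_all add: \<alpha>_def \<beta>_def tri_simps)
  have diff\<alpha>: "\<alpha> (v - w) = \<alpha> v - \<alpha> w" and diff\<beta>: "\<beta> (v - w) = \<beta> v - \<beta> w" for v w
    using lin\<alpha>(1)[of v "(-1) *s w"] lin\<beta>(1)[of v "(-1) *s w"] lin\<alpha>(2)[of "-1" w] lin\<beta>(2)[of "-1" w] by simp_all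
  have notp: "z \<noteq> c *s p" if "lin c\<^sub>1 z \<noteq> 0" for z c
    using that dual by (auto simp: lin_simps)
  obtain w1 where w1: "\<alpha> w1 \<noteq> 0"
    using nondegenerate[of y] notp[OF y] unfolding \<alpha>_def by blast
  define \<kappa> where "\<kappa> = \<beta> w1 / \<alpha> w1"
  have "\<exists>w. \<beta> w \<noteq> \<kappa> * \<alpha> w"
  proof (rule ccontr)
    assume *: "\<nexists>w. \<beta> w \<noteq> \<kappa> * \<alpha> w"
    \<comment> \<open>\<open>tri F w x x\<close> equals
      \<open>\<beta> w + 2 * m * \<alpha> w\<close>, as the term in \<open>m ^ 2\<close> vanishes at
      the node; this \<open>m\<close> makes it 0.\<close>
    define m where "m = - \<kappa> / 2"
    define x where "x = y + m *s p"
    have "tri F w x x = 0" for w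
    proof -
      have "tri F w x x = \<beta> w + 2 * m * \<alpha> w"
        unfolding x_def \<alpha>_def \<beta>_def
        using tri_commute12[of F w y y] tri_commute12[of F w p y] tri_commute23[of F y w y]
          tri_commute23[of F p w y] tri_commute23[of F w y p]
        by (simp add: tri_simps singular algebra_simps)
      then show ?thesis using * by (simp add: m_def)
    qed
    moreover have "lin c\<^sub>1 x \<noteq> 0" using y dual by (simp add: x_def lin_simps)
    moreover from this have "x \<noteq> 0" by (auto simp: lin_def)
    ultimately show False using unique_singular[of x] notp[of x] by blast
  qed
  then obtain w2 where w2: "\<beta> w2 \<noteq> \<kappa> * \<alpha> w2" by blast
  define w3 where "w3 = w2 + (- (\<alpha> w2 / \<alpha> w1)) *s w1"
  have w3: "\<alpha> w3 = 0" "\<beta> w3 \<noteq> 0"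
    using w1 w2 by (auto simp: w3_def lin\<alpha> lin\<beta> diff\<alpha> diff\<beta> \<kappa>_def)
  define w where "w = w1 + (- \<beta> w1 / \<beta> w3) *s w3"
  have "\<alpha> w \<noteq> 0" "\<beta> w = 0"
    using w1 w3 by (auto simp: w_def lin\<alpha> lin\<beta> diff\<alpha> diff\<beta>)
  then show ?thesis unfolding \<alpha>_def \<beta>_def by blast
qed

text \<open>
  The points of the cubic with \<open>Q z = 0\<close> are not in the image of the parametrization; they are
  limits of it along a line in a direction transversal to the tangent cone.
\<close>

lemma zero_on_cubic:
  assumes G: "homogeneous d G"
    and dense: "infinite {u. infinite {s. infinite {t. eval_poly G (proj_inv (affine_point u s t)) = 0}}}"
    and z: "eval_poly F z = 0" "lin c\<^sub>1 z \<noteq> 0"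
  shows "eval_poly G z = 0"
proof (cases "Q z = 0")
  case False
  have "C z = 0" using z eval_poly_tri[OF hom] by (simp add: C_def)
  then have "proj_inv z = Q z *s z" unfolding proj_inv_def by simp
  then show ?thesis
    using zero_on_proj_inv[OF G dense z(2)] False eval_poly_scale[OF G] by simp
next
  case True
  have Cz: "C z = 0" using z eval_poly_tri[OF hom] by (simp add: C_def)
  obtain w where w: "tri F z z w = 0" "tri F p z w \<noteq> 0"
    using transversal_direction[OF z(2)] by auto
  \<comment> \<open>The quotients of \<open>Q (z + \<epsilon> *s w)\<close> and
    \<open>C (z + \<epsilon> *s w)\<close> by \<open>\<epsilon>\<close>: both forms vanish at
    \<open>z\<close>, and the choice of \<open>w\<close> makes the second quotient vanish again at
    0, so \<open>X 0\<close> is a nonzero multiple of \<open>z\<close>.\<close>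
  define q c where "q \<epsilon> = 6 * tri F p z w + \<epsilon> * Q w"
    and "c \<epsilon> = \<epsilon> * (3 * tri F z w w + \<epsilon> * C w)" for \<epsilon>
  define X where "X \<epsilon> = q \<epsilon> *s (z + \<epsilon> *s w) - c \<epsilon> *s p" for \<epsilon>
  have X: "proj_inv (z + \<epsilon> *s w) = \<epsilon> *s X \<epsilon>" for \<epsilon>
    unfolding proj_inv_def X_def Q_add C_add Q_scale C_scale q_def c_def
    by (simp add: True Cz w tri_simps vec_eq_iff algebra_simps power2_eq_square power3_eq_cube)
  have "vec_poly_fun X"
    unfolding X_def q_def c_def Q_def C_def by (intro vec_poly_fun_intros poly_fun_intros)
  then have pf: "poly_fun (\<lambda>\<epsilon>. eval_poly G (X \<epsilon>))" by (rule poly_fun_eval_poly)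
  \<comment> \<open>Its roots are the excluded parameters: 0, where \<open>\<epsilon>\<close> cannot
    be cancelled, and the one, if any, at which the line meets the first hyperplane.\<close>
  define b where "b = [:lin c\<^sub>1 z, lin c\<^sub>1 w:] * [:0, 1:]"
  have "b \<noteq> 0" unfolding b_def using z(2) by simp
  then have "finite {\<epsilon>. poly b \<epsilon> = 0}" by (rule poly_roots_finite)
  then have "infinite (UNIV - {\<epsilon>. poly b \<epsilon> = 0})"
    using infinite_UNIV_char_0 by (metis Diff_infinite_finite)
  moreover have "eval_poly G (X \<epsilon>) = 0" if "poly b \<epsilon> \<noteq> 0" for \<epsilon>
  proof -
    have "\<epsilon> \<noteq> 0" "lin c\<^sub>1 (z + \<epsilon> *s w) \<noteq> 0" using that by (auto simp: b_def lin_simps)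
    then have "eval_poly G (\<epsilon> *s X \<epsilon>) = 0"
      using zero_on_proj_inv[OF G dense, of "z + \<epsilon> *s w"] X by simp
    then show ?thesis using eval_poly_scale[OF G] \<open>\<epsilon> \<noteq> 0\<close> by simp
  qed
  ultimately have "infinite {\<epsilon>. eval_poly G (X \<epsilon>) = 0}"
    by (elim infinite_super[rotated]) auto
  then have "eval_poly G (X 0) = 0" by (rule poly_fun_infinite_zeros[OF pf])
  moreover have "X 0 = (6 * tri F p z w) *s z" by (simp add: X_def q_def c_def vec_eq_iff)
  ultimately show ?thesis using eval_poly_scale[OF G] w by simp
qed

end

section \<open>Unit values of the tangent cone form\<close>

definition S_units :: "complex set \<Rightarrow> nat \<Rightarrow> complex set" where
  "S_units L M = {v \<in> S_integers L M. v \<noteq> 0 \<and> inverse v \<in> S_integers L M}"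

lemma S_units_mult:
  assumes "number_field L" "v \<in> S_units L M" "w \<in> S_units L M"
  shows "v * w \<in> S_units L M"
  using assms subring.mult_closed[OF subring_S_integers[OF assms(1)]]
  unfolding S_units_def by (auto simp: inverse_mult_distrib)

lemma S_units_power:
  assumes "number_field L" "v \<in> S_units L M"
  shows "v ^ n \<in> S_units L M"
proof (induction n)
  case 0
  then show ?case
    using subring.one_closed[OF subring_S_integers[OF assms(1)]] by (simp add: S_units_def)
qed (use assms S_units_mult in auto)

lemma S_units_two:
  assumes "number_field L" "M > 0" "even M"
  shows "2 \<in> S_units L M"
  using inverse_dvd_S_integers[OF assms] subring.numeral_closed[OF subring_S_integers[OF assms(1)]]
  by (simp add: S_units_def)

lemma inj_power_two: "inj (\<lambda>n. (2::complex) ^ n)"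
proof (rule injI)
  fix m n assume "(2::complex) ^ m = 2 ^ n"
  then have "of_nat (2 ^ m) = (of_nat (2 ^ n) :: complex)" by simp
  then have "(2::nat) ^ m = 2 ^ n" by (simp only: of_nat_eq_iff)
  then show "m = n" by simp
qed

lemma odd_multiple_S_integers:
  assumes L: "number_field L" and M: "M > 0" "even M" and d: "d \<in> L"
  shows "\<exists>N. odd N \<and> of_nat N * d \<in> S_integers L M"
proof -
  interpret R: subring "S_integers L M" using L by (rule subring_S_integers)
  obtain N where N: "N > 0" "of_nat N * d \<in> ring_of_integers L"
    using number_field_multiple_algebraic_int[OF L d] by auto
  define k where "k = multiplicity 2 N"
  obtain m where km: "N = 2 ^ k * m" "odd m"
    unfolding k_def by (rule multiplicity_decompose'[of N 2]) (use N in auto)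
  have "of_nat N * d \<in> S_integers L M"
    using N(2) unfolding S_integers_def ring_of_integers_def by (auto intro!: exI[of _ 0])
  moreover have "inverse (2 ^ k) \<in> S_integers L M"
    using S_units_power[OF L S_units_two[OF L M]] by (simp add: S_units_def)
  ultimately have "inverse (2 ^ k) * (of_nat N * d) \<in> S_integers L M"
    using R.mult_closed by blast
  moreover have "inverse (2 ^ k) * (of_nat N * d) = of_nat m * d" by (simp add: km)
  ultimately have "of_nat m * d \<in> S_integers L M" by (simp only:)
  then show ?thesis using km(2) by blast
qed

text \<open>Two powers of 2 agree modulo \<open>N\<close> by finiteness, and the smaller one cancels
  because \<open>N\<close> is odd.\<close>

lemma odd_dvd_power_two_minus_one:
  fixes N :: int
  assumes "odd N"
  shows "\<exists>k>0. \<forall>n. N dvd (2 ^ k) ^ n - 1"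
proof -
  have "N \<noteq> 0" using assms by auto
  then have "2 ^ n mod N \<in> {- \<bar>N\<bar>..\<bar>N\<bar>}" for n :: nat
    using abs_mod_less[of N "2 ^ n"] by auto
  then have "range (\<lambda>n. 2 ^ n mod N) \<subseteq> {- \<bar>N\<bar>..\<bar>N\<bar>}" by blast
  then have "\<not> inj (\<lambda>n. 2 ^ n mod N)"
    using finite_subset range_inj_infinite by blast
  then obtain m m' where mm: "m \<noteq> m'" "2 ^ m mod N = 2 ^ m' mod N"
    by (auto simp: inj_def)
  define a k where "a = min m m'" and "k = max m m' - a"
  have "2 ^ (a + k) mod N = 2 ^ a mod N" using mm by (auto simp: a_def k_def min_def max_def)
  then have "N dvd 2 ^ a * (2 ^ k - 1)"
    by (simp add: mod_eq_dvd_iff power_add algebra_simps)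
  moreover have "coprime N (2 ^ a)" using assms by simp
  ultimately have N: "N dvd 2 ^ k - 1" by (simp add: coprime_dvd_mult_right_iff)
  have "N dvd (2 ^ k) ^ n - 1" for n
    using N dvd_trans[OF _ dvd_triv_left] power_diff_1_eq[of "2 ^ k :: int" n] by metis
  moreover have "k > 0" using mm by (auto simp: a_def k_def)
  ultimately show ?thesis by blast
qed

text \<open>
  If \<open>g\<close> is congruent to a unit \<open>v\<close> modulo \<open>d\<close>, then so is it to every unit \<open>v * (2 ^ k) ^ n\<close>, where
  \<open>2 ^ k\<close> is congruent to \<open>1\<close> modulo an odd integer multiple of \<open>d\<close>.
\<close>

lemma infinite_unit_values:
  assumes L: "number_field L" and M: "M > 0" "even M"
    and d: "d \<in> S_integers L M" "d \<noteq> 0" and v: "v \<in> S_units L M" and h: "h \<in> S_integers L M"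
    and g: "g = v + d * h"
  shows "infinite {t \<in> S_integers L M. t * d + g \<in> S_units L M}"
proof -
  interpret R: subring "S_integers L M" using L by (rule subring_S_integers)
  obtain N where N: "odd N" "of_nat N * inverse d \<in> S_integers L M"
    using odd_multiple_S_integers[OF L M, of "inverse d"] d number_field_inverse[OF L]
    by (auto simp: S_integers_def)
  obtain k where k: "k > 0" "\<And>n. int N dvd (2 ^ k) ^ n - 1"
    using odd_dvd_power_two_minus_one[of "int N"] N(1) by auto
  \<comment> \<open>The solution of \<open>t n * d + g = v * (2 ^ k) ^ n\<close>. It is S-integral
    because \<open>N / d\<close> is, and \<open>N\<close> divides
    \<open>(2 ^ k) ^ n - 1\<close>.\<close>
  define t where "t n = v * ((2 ^ k) ^ n - 1) / d - h" for n
  have t: "t n \<in> S_integers L M" for n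
  proof -
    obtain q where "(2 ^ k) ^ n - 1 = int N * q" using k(2)[of n] by auto
    then have "of_int ((2 ^ k) ^ n - 1) = (of_int (int N * q) :: complex)" by (simp only:)
    then have "(2 ^ k) ^ n - 1 = (of_nat N * of_int q :: complex)" by simp
    then have "t n = v * (of_int q * (of_nat N * inverse d)) - h"
      by (simp add: t_def divide_inverse mult_ac)
    also have "\<dots> \<in> S_integers L M"
      using v h R.mult_closed[OF R.of_int_closed N(2)]
      by (intro R.diff_closed R.mult_closed[of v]) (auto simp: S_units_def)
    finally show ?thesis .
  qed
  have "t n * d + g = v * (2 ^ k) ^ n" for n
    using d(2) by (simp add: t_def g left_diff_distrib[of _ h] mult.commute[of h d] right_diff_distrib)
  then have "t n * d + g \<in> S_units L M" for n
    using S_units_mult[OF L v] S_units_power[OF L S_units_power[OF L S_units_two[OF L M]]] by simp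
  with t have "range t \<subseteq> {t \<in> S_integers L M. t * d + g \<in> S_units L M}" by auto
  moreover have "inj t"
  proof (rule injI)
    fix m n assume "t m = t n"
    then have "(2::complex) ^ (k * m) = 2 ^ (k * n)"
      using d(2) v by (simp add: t_def S_units_def power_mult)
    then have "k * m = k * n" using inj_power_two by (auto dest: injD)
    then show "m = n" using k by simp
  qed
  ultimately show ?thesis using range_inj_infinite infinite_super by blast
qed

context nodal_frame
begin

text \<open>\<open>6 * tri F p\<close> is the polar form of \<open>Q\<close>, so
  \<open>\<alpha>\<close>, \<open>\<beta>\<close>, \<open>\<gamma>\<close> are the pairings of
  \<open>e\<close> with \<open>a\<^sub>0\<close>, \<open>a\<^sub>1\<close>, \<open>f\<close>, and
  \<open>slope u s\<close> is the coefficient of \<open>t\<close> in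
  \<open>Q (affine_point u s t)\<close>.\<close>

definition \<alpha> :: complex where "\<alpha> = 6 * tri F p e a\<^sub>0"
definition \<beta> :: complex where "\<beta> = 6 * tri F p e a\<^sub>1"
definition \<gamma> :: complex where "\<gamma> = 6 * tri F p e f"
definition slope :: "complex \<Rightarrow> complex \<Rightarrow> complex" where "slope u s = \<alpha> + \<beta> * u + \<gamma> * s"
definition g :: "complex \<Rightarrow> complex \<Rightarrow> complex" where "g u s = Q (affine_point u s 0)"

lemma Q_affine_point: "Q (affine_point u s t) = t * slope u s + g u s"
proof -
  have "Q (t *s e) = 0" unfolding Q_scale by (simp add: Q_def isotropic)
  moreover have "affine_point u s t = affine_point u s 0 + t *s e" by (simp add: affine_point_def)
  ultimately have "Q (affine_point u s t) = g u s + t * (6 * tri F p (affine_point u s 0) e)"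
    by (simp only: Q_add g_def tri_expand) simp
  moreover have "tri F p (affine_point u s 0) e = tri F p e a\<^sub>0 + u * tri F p e a\<^sub>1 + s * tri F p e f"
    unfolding affine_point_def by (subst tri_commute23) (simp add: tri_simps)
  ultimately show ?thesis
    by (simp add: slope_def \<alpha>_def \<beta>_def \<gamma>_def algebra_simps)
qed

text \<open>\<open>e\<close> is orthogonal to itself and to \<open>p\<close>; if it were orthogonal
  to the other frame vectors too, it would lie on the line of \<open>p\<close>, which the form
  \<open>ne\<close> excludes.\<close>

lemma coefficients_nonzero: "\<alpha> \<noteq> 0 \<or> \<beta> \<noteq> 0 \<or> \<gamma> \<noteq> 0"
proof (rule ccontr)
  assume 0: "\<not> (\<alpha> \<noteq> 0 \<or> \<beta> \<noteq> 0 \<or> \<gamma> \<noteq> 0)"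
  have "tri F p e w = 0" for w
    by (subst expand[of w]) (use 0 in \<open>simp add: tri_simps \<alpha>_def \<beta>_def \<gamma>_def isotropic singular'\<close>)
  then obtain c where "e = c *s p" using nondegenerate by blast
  then have "lin ne e = 0" using dual by (simp add: lin_scale)
  then show False using dual by simp
qed

text \<open>
  Otherwise \<open>f\<close>, \<open>e\<close> and \<open>a\<^sub>0 - (\<alpha> / \<beta>) a\<^sub>1\<close> would span an isotropic subspace of dimension three,
  too large for a nondegenerate quadratic form in four variables.
\<close>

lemma exists_g_nonzero:
  assumes "\<gamma> = 0" "\<beta> \<noteq> 0"
  shows "\<exists>s\<in>{0, 1, -1}. g (- \<alpha> / \<beta>) s \<noteq> 0"
proof (rule ccontr)
  assume *: "\<not> ?thesis"
  define u where "u = - \<alpha> / \<beta>"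
  define b where "b = a\<^sub>0 + u *s a\<^sub>1"
  have gs: "g u s = Q b + s * (6 * tri F p b f) + s ^ 2 * Q f" for s
    unfolding g_def affine_point_def by (simp add: Q_add Q_scale b_def[symmetric] tri_simps)
  \<comment> \<open>Three zeros of the polynomial \<open>g u s\<close>, quadratic in
    \<open>s\<close>, annihilate all its coefficients; hence the set
    \<open>{0, 1, -1}\<close>.\<close>
  have "g u 0 = 0" "g u 1 = 0" "g u (- 1) = 0" using * by (auto simp: u_def)
  then have "Q b = 0" "6 * tri F p b f + Q f = 0" "- (6 * tri F p b f) + Q f = 0"
    by (simp_all add: gs)
  then have bf: "tri F p b f = 0" and ff: "tri F p f f = 0" by (auto simp: Q_def)
  have fe: "tri F p e f = 0" "tri F p f e = 0"
    using assms tri_commute23[of F p e f] by (auto simp: \<gamma>_def)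
  have "6 * tri F p e b = \<alpha> + \<beta> * u"
    unfolding b_def by (simp add: tri_simps \<alpha>_def \<beta>_def)
  then have eb: "tri F p e b = 0" "tri F p f b = 0"
    using assms(2) bf tri_commute23[of F p b f] by (simp_all add: u_def)
  \<comment> \<open>The combination of \<open>f\<close> and \<open>e\<close> orthogonal to
    \<open>a\<^sub>1\<close>. It is also orthogonal to \<open>b\<close>, \<open>f\<close>,
    \<open>e\<close> and \<open>p\<close>, so it lies in the kernel, although its coefficient at
    \<open>f\<close> is \<open>\<beta> / 6\<close>, which is nonzero.\<close>
  define v where "v = tri F p e a\<^sub>1 *s f + (- tri F p f a\<^sub>1) *s e"
  have va: "tri F p v a\<^sub>1 = 0" "tri F p v b = 0" "tri F p v f = 0" "tri F p v e = 0" "tri F p v p = 0"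
    unfolding v_def tri_expand using eb fe ff isotropic singular' by simp_all
  moreover have a0: "a\<^sub>0 = b + (- u) *s a\<^sub>1" by (simp add: b_def vec_eq_iff)
  ultimately have "tri F p v a\<^sub>0 = 0" by (subst a0) (simp only: tri_expand, simp)
  then have "tri F p v w = 0" for w
    using va by (subst expand[of w]) (simp add: tri_simps)
  then obtain c where "v = c *s p" using nondegenerate by blast
  then have "lin nf v = 0" using dual by (simp add: lin_scale)
  then have "tri F p e a\<^sub>1 = 0" unfolding v_def using dual by (simp add: lin_simps)
  then show False using assms by (simp add: \<beta>_def)
qed

text \<open>A Taylor expansion: modulo \<open>l\<close>, the value of \<open>g\<close> depends only
  on its arguments modulo \<open>l\<close>. It is applied with \<open>l\<close> the slope.\<close>

lemma g_shift:
  "g (u + l * m) (s + l * k) = g u s + l *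
    (6 * tri F p (affine_point u s 0) (m *s a\<^sub>1 + k *s f) + l * Q (m *s a\<^sub>1 + k *s f))"
proof -
  define w where "w = m *s a\<^sub>1 + k *s f"
  have "affine_point (u + l * m) (s + l * k) 0 = affine_point u s 0 + l *s w"
    by (simp add: affine_point_def w_def vec_eq_iff algebra_simps)
  then show ?thesis unfolding g_def w_def[symmetric]
    by (simp only: Q_add Q_scale tri_expand) (simp add: power2_eq_square algebra_simps)
qed

lemma infinite_unit_Q:
  assumes L: "number_field L" and M: "M > 0" "even M"
    and R: "\<And>i. a\<^sub>0 $ i \<in> S_integers L M" "\<And>i. a\<^sub>1 $ i \<in> S_integers L M"
      "\<And>i. f $ i \<in> S_integers L M" "\<And>i. e $ i \<in> S_integers L M" "\<And>i. p $ i \<in> S_integers L M"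
      "inverse 6 \<in> S_integers L M" "coeffs_in (S_integers L M) F"
    and inv: "inverse \<alpha> \<in> S_integers L M" "inverse \<beta> \<in> S_integers L M" "inverse \<gamma> \<in> S_integers L M"
      "\<And>s. s \<in> {0, 1, -1} \<Longrightarrow> inverse (g (- \<alpha> / \<beta>) s) \<in> S_integers L M"
  shows "infinite {u \<in> S_units L M. infinite {s \<in> S_integers L M.
    infinite {t \<in> S_integers L M. Q (affine_point u s t) \<in> S_units L M}}}"
proof -
  interpret R: subring "S_integers L M" using L by (rule subring_S_integers)
  note tri_R = tri_in[OF R.subring_axioms R(6,7)]
  have Q_R: "Q y \<in> S_integers L M" if "\<And>i. y $ i \<in> S_integers L M" for y :: "complex ^ 'n"
    unfolding Q_def using that R by (intro R.closed tri_R)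
  have aff_R: "affine_point u s t $ i \<in> S_integers L M"
    if "u \<in> S_integers L M" "s \<in> S_integers L M" "t \<in> S_integers L M" for u s t i
    using that R unfolding affine_point_def by (auto intro!: R.closed)
  have coef_R: "\<alpha> \<in> S_integers L M" "\<beta> \<in> S_integers L M" "\<gamma> \<in> S_integers L M"
    unfolding \<alpha>_def \<beta>_def \<gamma>_def using R by (auto intro!: R.closed tri_R)
  have g_R: "g u s \<in> S_integers L M" if "u \<in> S_integers L M" "s \<in> S_integers L M" for u s
    unfolding g_def using that by (intro Q_R aff_R) (auto intro: R.closed)
  have slope_R: "slope u s \<in> S_integers L M" if "u \<in> S_integers L M" "s \<in> S_integers L M" for u s
    unfolding slope_def using that coef_R by (auto intro!: R.closed)
  define U where "U = range (\<lambda>n. (2::complex) ^ n)"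
  have U: "U \<subseteq> S_units L M" "infinite U"
    unfolding U_def using S_units_power[OF L S_units_two[OF L M]] inj_power_two range_inj_infinite by auto
  have US: "u \<in> S_integers L M" if "u \<in> S_units L M" for u using that by (simp add: S_units_def)
  have one: "1 \<in> S_units L M" using S_units_power[OF L S_units_two[OF L M], of 0] by simp
  have good: "infinite {t \<in> S_integers L M. Q (affine_point u s t) \<in> S_units L M}"
    if "u \<in> S_integers L M" "s \<in> S_integers L M" "slope u s \<noteq> 0" "v \<in> S_units L M" "h \<in> S_integers L M"
      "g u s = v + slope u s * h" for u s v h
    unfolding Q_affine_point using that slope_R by (intro infinite_unit_values[OF L M]) auto
  \<comment> \<open>Modulo a unit every value is congruent to 1, so a unit slope leaves no
    congruence condition.\<close>
  have good_unit: "infinite {t \<in> S_integers L M. Q (affine_point u s t) \<in> S_units L M}"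
    if "u \<in> S_integers L M" "s \<in> S_integers L M" "slope u s \<in> S_units L M" for u s
  proof (rule good[OF that(1,2) _ one, of "(g u s - 1) * inverse (slope u s)"])
    show "(g u s - 1) * inverse (slope u s) \<in> S_integers L M"
      using that g_R by (intro R.closed) (auto simp: S_units_def)
    show "g u s = 1 + slope u s * ((g u s - 1) * inverse (slope u s))" "slope u s \<noteq> 0"
      using that by (simp_all add: S_units_def field_simps)
  qed
  have naturals: "infinite (range (of_nat :: nat \<Rightarrow> complex))"
    by (rule range_inj_infinite) (rule inj_of_nat)
  consider (a) "\<gamma> \<noteq> 0" | (b) "\<gamma> = 0" "\<alpha> = 0 \<or> \<beta> = 0" | (c) "\<gamma> = 0" "\<alpha> \<noteq> 0" "\<beta> \<noteq> 0" by blast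
  then show ?thesis
  proof cases
    case a
    have "infinite {s \<in> S_integers L M. infinite {t \<in> S_integers L M. Q (affine_point u s t) \<in> S_units L M}}"
      if u: "u \<in> U" for u
    proof -
      \<comment> \<open>Chosen so that the slope takes the prescribed value \<open>w\<close>, a
        power of 2.\<close>
      define s where "s w = (w - \<alpha> - \<beta> * u) * inverse \<gamma>" for w
      have "slope u (s w) = w" for w using a by (simp add: slope_def s_def field_simps)
      moreover have "s w \<in> S_integers L M" if "w \<in> U" for w
        unfolding s_def using that u U US coef_R inv by (intro R.closed) auto
      ultimately have "s ` U \<subseteq> {s \<in> S_integers L M. infinite {t \<in> S_integers L M. Q (affine_point u s t) \<in> S_units L M}}"
        using good_unit[OF US, of u "s _"] u U by (intro image_subsetI CollectI conjI) (auto simp: subset_iff)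
      moreover have "inj s" using a by (auto simp: inj_def s_def)
      then have "infinite (s ` U)" using U(2) finite_imageD inj_on_subset by blast
      ultimately show ?thesis using infinite_super by blast
    qed
    then have "U \<subseteq> {u \<in> S_units L M. infinite {s \<in> S_integers L M.
        infinite {t \<in> S_integers L M. Q (affine_point u s t) \<in> S_units L M}}}"
      using U by auto
    then show ?thesis using U(2) infinite_super by blast
  next
    case b
    have "infinite {s \<in> S_integers L M. infinite {t \<in> S_integers L M. Q (affine_point u s t) \<in> S_units L M}}"
      if u: "u \<in> U" for u
    proof -
      \<comment> \<open>Exactly one coefficient is nonzero, so the slope is \<open>\<alpha>\<close>
        or \<open>\<beta> * u\<close>, a unit whatever \<open>s\<close> is.\<close>
      have "\<alpha> \<in> S_units L M \<and> \<beta> = 0 \<or> \<alpha> = 0 \<and> \<beta> \<in> S_units L M"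
        using b coefficients_nonzero coef_R inv by (auto simp: S_units_def)
      then have "slope u s \<in> S_units L M" for s
        using b(1) S_units_mult[OF L, of \<beta> M u] u U by (auto simp: slope_def)
      then have "range of_nat \<subseteq> {s \<in> S_integers L M. infinite {t \<in> S_integers L M. Q (affine_point u s t) \<in> S_units L M}}"
        using good_unit u U US R.of_nat_closed by auto
      then show ?thesis using naturals infinite_super by blast
    qed
    then have "U \<subseteq> {u \<in> S_units L M. infinite {s \<in> S_integers L M.
        infinite {t \<in> S_integers L M. Q (affine_point u s t) \<in> S_units L M}}}"
      using U by auto
    then show ?thesis using U(2) infinite_super by blast
  next
    case c
    \<comment> \<open>The root of the slope. For other \<open>u\<close> the difference
      \<open>u - u0\<close> is the slope \<open>l\<close> divided by \<open>\<beta>\<close>; with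
      \<open>s\<close> running through \<open>s0 + l * of_nat k\<close>, \<open>g_shift\<close>
      makes \<open>g u s\<close> congruent modulo \<open>l\<close> to the fixed unit
      \<open>g u0 s0\<close>.\<close>
    define u0 where "u0 = - \<alpha> / \<beta>"
    have u0: "u0 \<in> S_integers L M" unfolding u0_def divide_inverse using coef_R inv by (intro R.closed)
    obtain s0 where s0: "s0 \<in> {0, 1, -1}" "g u0 s0 \<noteq> 0"
      using exists_g_nonzero[OF c(1,3)] unfolding u0_def by blast
    have s0_R: "s0 \<in> S_integers L M" using s0(1) by (auto intro: R.closed)
    have v: "g u0 s0 \<in> S_units L M"
      using s0 inv(4)[OF s0(1)] g_R[OF u0 s0_R] by (simp add: S_units_def u0_def)
    have "infinite {s \<in> S_integers L M. infinite {t \<in> S_integers L M. Q (affine_point u s t) \<in> S_units L M}}"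
      if u: "u \<in> U - {u0}" for u
    proof -
      define l where "l = \<alpha> + \<beta> * u"
      have l: "slope u s = l" for s using c(1) by (simp add: slope_def l_def)
      have uR: "u \<in> S_integers L M" using u U US by auto
      have l_R: "l \<in> S_integers L M" unfolding l_def using coef_R uR by (intro R.closed)
      have l0: "l \<noteq> 0" using u c(3) by (auto simp: l_def u0_def field_simps eq_neg_iff_add_eq_0)
      have ul: "u = u0 + l * inverse \<beta>" using c(3) by (simp add: l_def u0_def field_simps)
      define s where "s k = s0 + l * of_nat k" for k
      have s_R: "s k \<in> S_integers L M" for k
        unfolding s_def using s0_R l_R by (intro R.closed)
      have "infinite {t \<in> S_integers L M. Q (affine_point u (s k) t) \<in> S_units L M}" for k
      proof (rule good[OF uR s_R _ v])
        let ?w = "inverse \<beta> *s a\<^sub>1 + of_nat k *s f"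
        show "g u (s k) = g u0 s0 + slope u (s k) * (6 * tri F p (affine_point u0 s0 0) ?w + l * Q ?w)"
          unfolding l by (subst ul) (simp only: s_def g_shift)
        have w: "?w $ i \<in> S_integers L M" for i
          using R inv by (auto intro!: R.closed)
        show "6 * tri F p (affine_point u0 s0 0) ?w + l * Q ?w \<in> S_integers L M"
          using R w l_R u0 s0_R aff_R[OF u0 s0_R R.zero_closed]
          by (intro R.add_closed R.mult_closed R.numeral_closed tri_R Q_R) auto
      qed (use l l0 in auto)
      then have "range s \<subseteq> {s \<in> S_integers L M. infinite {t \<in> S_integers L M. Q (affine_point u s t) \<in> S_units L M}}"
        using s_R by auto
      moreover have "inj s" using l0 by (auto simp: inj_def s_def)
      ultimately show ?thesis using range_inj_infinite infinite_super by blast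
    qed
    then have "U - {u0} \<subseteq> {u \<in> S_units L M. infinite {s \<in> S_integers L M.
        infinite {t \<in> S_integers L M. Q (affine_point u s t) \<in> S_units L M}}}"
      using U by auto
    moreover have "infinite (U - {u0})" using U(2) by simp
    ultimately show ?thesis using infinite_super by blast
  qed
qed

end

section \<open>Rational frames and the theorem\<close>

lemma linear_functional_lin:
  fixes h :: "complex ^ 'n \<Rightarrow> complex"
  assumes "\<And>x y. h (x + y) = h x + h y" "\<And>c x. h (c *s x) = c * h x"
  shows "h z = lin (\<chi> i. h (axis i 1)) z"
proof -
  have h0: "h 0 = 0" using assms(2)[of 0 0] by simp
  have hs: "h (sum g I) = (\<Sum>i\<in>I. h (g i))" if "finite I" for g :: "'n \<Rightarrow> complex ^ 'n" and I
    using that by (induction I rule: finite_induct) (auto simp: h0 assms(1))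
  have "h z = h (\<Sum>i\<in>UNIV. z $ i *s axis i 1)" by (simp only: basis_expansion)
  also have "\<dots> = lin (\<chi> i. h (axis i 1)) z"
    by (simp add: hs assms(2) lin_def mult.commute)
  finally show ?thesis .
qed

lemma lin_0: "lin c 0 = 0"
  by (simp add: lin_def)

lemma exists_dual_pair:
  fixes c\<^sub>1 c\<^sub>2 :: "complex ^ 'n"
  assumes "c\<^sub>1 \<noteq> 0" "\<And>\<kappa>. c\<^sub>2 \<noteq> \<kappa> *s c\<^sub>1"
  obtains a\<^sub>0 a\<^sub>1 where "lin c\<^sub>1 a\<^sub>0 = 1" "lin c\<^sub>1 a\<^sub>1 = 0" "lin c\<^sub>2 a\<^sub>0 = 0" "lin c\<^sub>2 a\<^sub>1 = 1"
proof -
  have ax: "lin c (axis i 1) = c $ i" for c :: "complex ^ 'n" and i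
    by (simp add: lin_def axis_def if_distrib cong: if_cong)
  obtain i where "c\<^sub>1 $ i \<noteq> 0" using assms(1) by (auto simp: vec_eq_iff)
  then obtain z1 where z1: "lin c\<^sub>1 z1 \<noteq> 0" using ax by metis
  define \<kappa> where "\<kappa> = lin c\<^sub>2 z1 / lin c\<^sub>1 z1"
  obtain j where "c\<^sub>2 $ j \<noteq> \<kappa> * c\<^sub>1 $ j" using assms(2)[of \<kappa>] by (auto simp: vec_eq_iff)
  then obtain z2 where z2: "lin c\<^sub>2 z2 \<noteq> \<kappa> * lin c\<^sub>1 z2" using ax by metis
  define z3 where "z3 = z2 - (lin c\<^sub>1 z2 / lin c\<^sub>1 z1) *s z1"
  have z3: "lin c\<^sub>1 z3 = 0" "lin c\<^sub>2 z3 \<noteq> 0"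
    using z1 z2 by (auto simp: z3_def lin_simps \<kappa>_def)
  define a\<^sub>1 where "a\<^sub>1 = inverse (lin c\<^sub>2 z3) *s z3"
  have a1: "lin c\<^sub>1 a\<^sub>1 = 0" "lin c\<^sub>2 a\<^sub>1 = 1" using z3 by (simp_all add: a\<^sub>1_def lin_simps)
  define a\<^sub>0 where "a\<^sub>0 = inverse (lin c\<^sub>1 z1) *s (z1 - lin c\<^sub>2 z1 *s a\<^sub>1)"
  have "lin c\<^sub>1 a\<^sub>0 = 1" "lin c\<^sub>2 a\<^sub>0 = 0" using z1 a1 by (simp_all add: a\<^sub>0_def lin_simps)
  then show ?thesis using that a1 by blast
qed

text \<open>\<open>B\<close> is a basis of the common kernel containing \<open>S\<close>. Together
  with \<open>a\<^sub>0\<close> and \<open>a\<^sub>1\<close> it spans because subtracting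
  \<open>lin c\<^sub>1 z *s a\<^sub>0\<close> and \<open>lin c\<^sub>2 z *s a\<^sub>1\<close> moves
  \<open>z\<close> into the kernel.\<close>

lemma extend_to_frame:
  fixes c\<^sub>1 c\<^sub>2 a\<^sub>0 a\<^sub>1 :: "complex ^ 'n::finite"
  assumes dual: "lin c\<^sub>1 a\<^sub>0 = 1" "lin c\<^sub>1 a\<^sub>1 = 0" "lin c\<^sub>2 a\<^sub>0 = 0" "lin c\<^sub>2 a\<^sub>1 = 1"
    and S: "vec.independent S" "\<And>z. z \<in> S \<Longrightarrow> lin c\<^sub>1 z = 0 \<and> lin c\<^sub>2 z = 0"
  obtains B where "S \<subseteq> B" "finite B" "card B + 2 = CARD('n)" "\<And>z. z \<in> B \<Longrightarrow> lin c\<^sub>1 z = 0 \<and> lin c\<^sub>2 z = 0"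
    "vec.independent (insert a\<^sub>0 (insert a\<^sub>1 B))" "vec.span (insert a\<^sub>0 (insert a\<^sub>1 B)) = UNIV"
proof -
  define W where "W = {z. lin c\<^sub>1 z = 0 \<and> lin c\<^sub>2 z = 0}"
  have W: "vec.subspace W" unfolding W_def vec.subspace_def by (auto simp: lin_simps lin_0)
  have W': "vec.subspace {z. lin c\<^sub>1 z = 0}" unfolding vec.subspace_def by (auto simp: lin_simps lin_0)
  have "S \<subseteq> W" using S(2) by (auto simp: W_def)
  then obtain B where B: "S \<subseteq> B" "B \<subseteq> W" "vec.independent B" "W \<subseteq> vec.span B"
    using vec.maximal_independent_subset_extend[of S W] S(1) by blast
  have fin: "finite B" using B(3) vec.independent_bound_general by blast
  have "vec.span B \<subseteq> W" using B(2) W by (rule vec.span_minimal)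
  then have a1: "a\<^sub>1 \<notin> vec.span B" using dual by (auto simp: W_def)
  have "vec.span (insert a\<^sub>1 B) \<subseteq> {z. lin c\<^sub>1 z = 0}"
    using B(2) dual W' by (intro vec.span_minimal) (auto simp: W_def)
  then have a0: "a\<^sub>0 \<notin> vec.span (insert a\<^sub>1 B)" using dual by auto
  have notin: "a\<^sub>1 \<notin> B" "a\<^sub>0 \<notin> insert a\<^sub>1 B" using a0 a1 vec.span_base by blast+
  then have ind: "vec.independent (insert a\<^sub>0 (insert a\<^sub>1 B))"
    using a0 a1 B(3) by (simp add: vec.independent_insert)
  have sp: "vec.span (insert a\<^sub>0 (insert a\<^sub>1 B)) = UNIV"
  proof -
    have "z \<in> vec.span (insert a\<^sub>0 (insert a\<^sub>1 B))" for z
    proof -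
      have "z - lin c\<^sub>1 z *s a\<^sub>0 - lin c\<^sub>2 z *s a\<^sub>1 \<in> W" using dual by (simp add: W_def lin_simps)
      then show ?thesis using B(4) unfolding vec.span_breakdown_eq by blast
    qed
    then show ?thesis by auto
  qed
  have "card (insert a\<^sub>0 (insert a\<^sub>1 B)) = CARD('n)"
    using vec.dim_span_eq_card_independent[OF ind] unfolding sp vec_dim_card by (rule sym)
  then have "card B + 2 = CARD('n)" using notin fin by (simp add: card_insert_if)
  moreover have "lin c\<^sub>1 z = 0 \<and> lin c\<^sub>2 z = 0" if "z \<in> B" for z using that B(2) by (auto simp: W_def)
  ultimately show ?thesis using that[OF B(1) fin _ _ ind sp] by blast
qed

lemma quadratic_root:
  fixes a b c :: complex
  assumes "a \<noteq> 0"
  shows "\<exists>x. a * x ^ 2 + b * x + c = 0"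
proof -
  have "\<not> constant (poly [:c, b, a:])" using assms by (simp add: constant_degree)
  then obtain x where "poly [:c, b, a:] x = 0" using fundamental_theorem_of_algebra by blast
  then show ?thesis by (intro exI[of _ x]) (simp add: algebra_simps power2_eq_square)
qed

text \<open>In dimension 5 the common kernel has two dimensions beside \<open>p\<close>, and a
  binary quadratic form over the complex numbers has a nontrivial zero \<open>e\<close> there. The
  kernel basis is then rebuilt from \<open>{e, p}\<close>, which yields \<open>f\<close>;
  \<open>nf\<close>, \<open>ne\<close> and \<open>np\<close> are coordinate functionals of the new
  basis.\<close>

lemma exists_frame:
  fixes c\<^sub>1 c\<^sub>2 p :: "complex ^ 'n::finite"
  assumes "CARD('n) = 5" "c\<^sub>1 \<noteq> 0" "\<And>\<kappa>. c\<^sub>2 \<noteq> \<kappa> *s c\<^sub>1" "p \<noteq> 0" "lin c\<^sub>1 p = 0" "lin c\<^sub>2 p = 0"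
  shows "\<exists>a\<^sub>0 a\<^sub>1 f e nf ne np.
    (\<forall>z. z = lin c\<^sub>1 z *s a\<^sub>0 + lin c\<^sub>2 z *s a\<^sub>1 + lin nf z *s f + lin ne z *s e + lin np z *s p) \<and>
    lin c\<^sub>1 a\<^sub>0 = 1 \<and> lin c\<^sub>1 a\<^sub>1 = 0 \<and> lin c\<^sub>1 f = 0 \<and> lin c\<^sub>1 e = 0 \<and>
    lin c\<^sub>2 a\<^sub>0 = 0 \<and> lin c\<^sub>2 a\<^sub>1 = 1 \<and> lin c\<^sub>2 f = 0 \<and> lin c\<^sub>2 e = 0 \<and>
    lin nf f = 1 \<and> lin nf e = 0 \<and> lin nf p = 0 \<and> lin ne e = 1 \<and> lin ne p = 0 \<and>
    tri F p e e = 0"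
proof -
  obtain a\<^sub>0 a\<^sub>1 where a: "lin c\<^sub>1 a\<^sub>0 = 1" "lin c\<^sub>1 a\<^sub>1 = 0" "lin c\<^sub>2 a\<^sub>0 = 0" "lin c\<^sub>2 a\<^sub>1 = 1"
    using exists_dual_pair[OF assms(2,3)] by blast
  have ip: "vec.independent {p}" using assms(4) by (simp add: vec.dependent_single)
  obtain B0 where B0: "{p} \<subseteq> B0" "finite B0" "card B0 + 2 = CARD('n)"
    "\<And>z. z \<in> B0 \<Longrightarrow> lin c\<^sub>1 z = 0 \<and> lin c\<^sub>2 z = 0" "vec.independent (insert a\<^sub>0 (insert a\<^sub>1 B0))"
    "vec.span (insert a\<^sub>0 (insert a\<^sub>1 B0)) = UNIV"
    by (rule extend_to_frame[OF a ip]) (use assms(5,6) in auto)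
  have "card (B0 - {p}) = 2" using B0(1,2,3) assms(1) by simp
  then obtain w1 w2 where w: "B0 - {p} = {w1, w2}" "w1 \<noteq> w2" by (auto simp: card_2_iff)
  have "B0 = {w1, w2, p}" using w B0(1) by auto
  then have iw: "vec.independent {w1, w2, p}"
    using B0(5) vec.independent_mono by (metis subset_insertI)
  have wne: "w1 \<notin> {w2, p}" "w2 \<notin> {p}" using w by auto
  have n1: "w1 \<notin> vec.span {w2, p}" and n2: "w2 \<notin> vec.span {p}"
    using iw wne by (simp_all add: vec.independent_insert)
  have lw: "lin c\<^sub>1 w1 = 0" "lin c\<^sub>2 w1 = 0" "lin c\<^sub>1 w2 = 0" "lin c\<^sub>2 w2 = 0" using B0(4) w by auto
  obtain e where e: "tri F p e e = 0" "e \<notin> vec.span {p}" "lin c\<^sub>1 e = 0" "lin c\<^sub>2 e = 0"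
  proof (cases "tri F p w2 w2 = 0")
    case True
    then show ?thesis using that n2 lw by blast
  next
    case False
    then obtain x where x: "tri F p w2 w2 * x ^ 2 + (tri F p w1 w2 + tri F p w2 w1) * x + tri F p w1 w1 = 0"
      using quadratic_root by blast
    define e where "e = w1 + x *s w2"
    have "tri F p e e = 0" using x by (simp add: e_def tri_simps algebra_simps power2_eq_square)
    moreover have "e \<notin> vec.span {p}"
    proof
      assume "e \<in> vec.span {p}"
      then have "e \<in> vec.span {w2, p}" using vec.span_mono[of "{p}" "{w2, p}"] by blast
      moreover have "x *s w2 \<in> vec.span {w2, p}" by (intro vec.span_scale vec.span_base) simp
      ultimately have "e - x *s w2 \<in> vec.span {w2, p}" by (rule vec.span_diff)
      then show False using n1 by (simp add: e_def)
    qed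
    moreover have "lin c\<^sub>1 e = 0" "lin c\<^sub>2 e = 0" using lw by (simp_all add: e_def lin_simps)
    ultimately show ?thesis using that by blast
  qed
  have "e \<noteq> p" using e(2) vec.span_base by blast
  then have iep: "vec.independent {e, p}" using e(2) ip by (simp add: vec.independent_insert)
  obtain B where B: "{e, p} \<subseteq> B" "finite B" "card B + 2 = CARD('n)"
    "\<And>z. z \<in> B \<Longrightarrow> lin c\<^sub>1 z = 0 \<and> lin c\<^sub>2 z = 0" "vec.independent (insert a\<^sub>0 (insert a\<^sub>1 B))"
    "vec.span (insert a\<^sub>0 (insert a\<^sub>1 B)) = UNIV"
    by (rule extend_to_frame[OF a iep]) (use e(3,4) assms(5,6) in auto)
  have "card (B - {e, p}) = 1"
    using B(1,2,3) assms(1) \<open>e \<noteq> p\<close> by (subst card_Diff_subset) auto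
  then obtain f where f: "B - {e, p} = {f}" by (auto simp: card_1_singleton_iff)
  have Beq: "B = {f, e, p}" "f \<notin> {e, p}" using f B(1) by auto
  define B' where "B' = insert a\<^sub>0 (insert a\<^sub>1 B)"
  have ind: "vec.independent B'" and sp: "\<And>z. z \<in> vec.span B'" using B by (simp_all add: B'_def)
  define n where "n b = (\<chi> i. vec.representation B' (axis i 1) b)" for b
  have n: "vec.representation B' z b = lin (n b) z" for z b
    unfolding n_def
    by (rule linear_functional_lin)
      (simp_all add: vec.representation_add[OF ind sp sp] vec.representation_scale[OF ind sp])
  have nb: "lin (n b) b' = (if b' = b then 1 else 0)" if "b' \<in> B'" for b b'
    unfolding n[symmetric] using vec.representation_basis[OF ind that] by auto
  have lf: "lin c\<^sub>1 f = 0" "lin c\<^sub>2 f = 0" using B(4) Beq by auto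
  have dist: "a\<^sub>0 \<notin> {a\<^sub>1, f, e, p}" "a\<^sub>1 \<notin> {f, e, p}" using a lf e assms(5,6) by auto
  have ex: "z = lin (n a\<^sub>0) z *s a\<^sub>0 + lin (n a\<^sub>1) z *s a\<^sub>1 + lin (n f) z *s f + lin (n e) z *s e + lin (n p) z *s p" for z
  proof -
    have "finite B'" using B(2) by (simp add: B'_def)
    from vec.sum_representation_eq[OF ind sp this order_refl, of z]
    have "z = (\<Sum>b\<in>B'. lin (n b) z *s b)" unfolding n by (rule sym)
    also have "\<dots> = lin (n a\<^sub>0) z *s a\<^sub>0 + lin (n a\<^sub>1) z *s a\<^sub>1 + lin (n f) z *s f + lin (n e) z *s e + lin (n p) z *s p"
      using dist Beq \<open>e \<noteq> p\<close> by (simp add: B'_def add_ac)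
    finally show ?thesis .
  qed
  have "lin c\<^sub>1 z = lin (n a\<^sub>0) z" "lin c\<^sub>2 z = lin (n a\<^sub>1) z" for z
    by (subst ex[of z], simp add: lin_simps a lf e assms(5,6))+
  with ex have "z = lin c\<^sub>1 z *s a\<^sub>0 + lin c\<^sub>2 z *s a\<^sub>1 + lin (n f) z *s f + lin (n e) z *s e + lin (n p) z *s p" for z
    by metis
  moreover have "lin (n f) f = 1" "lin (n f) e = 0" "lin (n f) p = 0" "lin (n e) e = 1" "lin (n e) p = 0"
    using nb Beq \<open>e \<noteq> p\<close> by (auto simp: B'_def)
  ultimately show ?thesis using a lf e by blast
qed

text \<open>Identities between coordinates survive the homomorphism, but \<open>nondeg\<close> and
  \<open>unique\<close> quantify over all complex vectors and cannot be specialized. They carry over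
  because \<open>V p\<close> is a nonzero multiple of \<open>p\<close>.\<close>

lemma nodal_frame_over_number_field:
  fixes c\<^sub>1 c\<^sub>2 p :: "complex ^ 'n::finite"
  assumes K: "number_field K" and F: "homogeneous 3 F" "coeffs_in K F"
    and card: "CARD('n) = 5"
    and c: "\<And>i. c\<^sub>1 $ i \<in> K" "\<And>i. c\<^sub>2 $ i \<in> K" "c\<^sub>1 \<noteq> 0" "\<And>\<kappa>. c\<^sub>2 \<noteq> \<kappa> *s c\<^sub>1"
    and p: "p $ i\<^sub>0 = 1" "lin c\<^sub>1 p = 0" "lin c\<^sub>2 p = 0" "\<And>w. tri F w p p = 0"
    and nondeg: "\<And>v. (\<And>w. tri F p v w = 0) \<Longrightarrow> \<exists>c. v = c *s p"
    and unique: "\<And>x. x \<noteq> 0 \<Longrightarrow> (\<And>w. tri F w x x = 0) \<Longrightarrow> \<exists>c. x = c *s p"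
  obtains L and nf ne np a\<^sub>0 a\<^sub>1 f e p' :: "complex ^ 'n" where "number_field L" "K \<subseteq> L"
    "nodal_frame F c\<^sub>1 c\<^sub>2 nf ne np a\<^sub>0 a\<^sub>1 f e p'"
    "\<forall>i. a\<^sub>0 $ i \<in> L \<and> a\<^sub>1 $ i \<in> L \<and> f $ i \<in> L \<and> e $ i \<in> L \<and> p' $ i \<in> L"
proof -
  have "p \<noteq> 0" using p(1) by auto
  from exists_frame[OF card c(3,4) this p(2,3), of F]
  obtain a\<^sub>0 a\<^sub>1 f e nf ne np where
    ex: "\<And>z. z = lin c\<^sub>1 z *s a\<^sub>0 + lin c\<^sub>2 z *s a\<^sub>1 + lin nf z *s f + lin ne z *s e + lin np z *s p"
    and dual: "lin c\<^sub>1 a\<^sub>0 = 1" "lin c\<^sub>1 a\<^sub>1 = 0" "lin c\<^sub>1 f = 0" "lin c\<^sub>1 e = 0"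
      "lin c\<^sub>2 a\<^sub>0 = 0" "lin c\<^sub>2 a\<^sub>1 = 1" "lin c\<^sub>2 f = 0" "lin c\<^sub>2 e = 0"
      "lin nf f = 1" "lin nf e = 0" "lin nf p = 0" "lin ne e = 1" "lin ne p = 0"
    and iso: "tri F p e e = 0" by metis
  define X where "X = (\<Union>v\<in>{a\<^sub>0, a\<^sub>1, f, e, p, nf, ne, np}. range (($) v))"
  have "finite X" unfolding X_def by simp
  from specialization[OF K this] obtain A L \<phi> where
    A: "K \<union> X \<subseteq> A" and L: "number_field L" "K \<subseteq> L" and \<phi>: "subring_hom A \<phi>" "\<phi> ` A \<subseteq> L"
    and \<phi>K: "\<forall>x\<in>K. \<phi> x = x" by blast
  interpret subring_hom A \<phi> by (rule \<phi>(1))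
  interpret K: subring K using K by (rule number_field_subring)
  have KA: "K \<subseteq> A" using A by auto
  define V where "V v = (\<chi> i. \<phi> (v $ i))" for v :: "complex ^ 'n"
  have V: "V v $ i = \<phi> (v $ i)" for v i by (simp add: V_def)
  have inA: "v $ i \<in> A" if "v \<in> {a\<^sub>0, a\<^sub>1, f, e, p, nf, ne, np}" for v :: "complex ^ 'n" and i
    using that A unfolding X_def by blast
  have VL: "V v $ i \<in> L" if "v \<in> {a\<^sub>0, a\<^sub>1, f, e, p, nf, ne, np}" for v :: "complex ^ 'n" and i
    using inA[OF that] \<phi>(2) by (auto simp: V)
  have VK: "V v = v" if "\<And>i. v $ i \<in> K" for v :: "complex ^ 'n"
    using that \<phi>K by (simp add: V_def vec_eq_iff)
  have Vlin: "lin (V v) (V w) = \<phi> (lin v w)" if "\<And>i. v $ i \<in> A" "\<And>i. w $ i \<in> A" for v w :: "complex ^ 'n"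
    unfolding lin_def V using that by (simp add: hom_sum hom_mult closed)
  have cA: "c\<^sub>1 $ i \<in> A" "c\<^sub>2 $ i \<in> A" for i using c KA by auto
  have Vc: "V c\<^sub>1 = c\<^sub>1" "V c\<^sub>2 = c\<^sub>2" using VK c by auto
  have Vtri: "tri F (V u) (V v) (V w) = \<phi> (tri F u v w)"
    if "\<And>i. u $ i \<in> A" "\<And>i. v $ i \<in> A" "\<And>i. w $ i \<in> A" for u v w :: "complex ^ 'n"
  proof -
    define \<theta> where "\<theta> i j k = Poly_Mapping.lookup (partial_deriv i (partial_deriv j (partial_deriv k F))) 0 / 6"
      for i j k
    have "coeffs_in K (partial_deriv i (partial_deriv j (partial_deriv k F)))" for i j k
      using F by (intro coeffs_in_partial_deriv K.subring_axioms)
    then have "\<theta> i j k \<in> K" for i j k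
      unfolding \<theta>_def by (intro number_field_divide[OF K] K.numeral_closed) (simp add: coeffs_in_def)
    then have "\<phi> (\<theta> i j k) = \<theta> i j k" "\<theta> i j k \<in> A" for i j k
      using \<phi>K KA by auto
    then show ?thesis
      unfolding tri_def V \<theta>_def[symmetric] using that by (simp add: hom_sum hom_mult mult_closed sum_closed)
  qed
  have \<phi>0: "\<phi> 0 = 0" "\<phi> 1 = 1" using hom_zero hom_one by auto
  have axK: "axis k (1::complex) $ i \<in> K" for k i :: 'n by (simp add: axis_def K.closed)
  have ax: "V (axis k 1) = axis k 1" for k using axK by (rule VK)
  have lin_ax: "lin v (axis k 1) = v $ k" for v :: "complex ^ 'n" and k
    by (simp add: lin_def axis_def if_distrib cong: if_cong)
  \<comment> \<open>The expansion must hold for every complex \<open>z\<close>, so it is transported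
    for the unit vectors, whose coordinates lie in \<open>K\<close>, and then extended by
    linearity.\<close>
  have comp: "axis k 1 $ i = c\<^sub>1 $ k * V a\<^sub>0 $ i + c\<^sub>2 $ k * V a\<^sub>1 $ i + V nf $ k * V f $ i + V ne $ k * V e $ i
      + V np $ k * V p $ i" for k i
  proof -
    have "axis k 1 $ i = c\<^sub>1 $ k * a\<^sub>0 $ i + c\<^sub>2 $ k * a\<^sub>1 $ i + nf $ k * f $ i + ne $ k * e $ i + np $ k * p $ i"
      using arg_cong[OF ex[of "axis k 1"], of "\<lambda>v. v $ i"] by (simp add: lin_ax)
    from arg_cong[OF this, of \<phi>]
    have "\<phi> (axis k 1 $ i) = \<phi> (c\<^sub>1 $ k) * V a\<^sub>0 $ i + \<phi> (c\<^sub>2 $ k) * V a\<^sub>1 $ i + V nf $ k * V f $ i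
        + V ne $ k * V e $ i + V np $ k * V p $ i"
      using inA cA by (simp add: hom_add hom_mult closed V)
    moreover have "\<phi> (axis k 1 $ i) = axis k 1 $ i" "\<phi> (c\<^sub>1 $ k) = c\<^sub>1 $ k" "\<phi> (c\<^sub>2 $ k) = c\<^sub>2 $ k"
      using axK c \<phi>K by auto
    ultimately show ?thesis by simp
  qed
  have Vex: "z = lin c\<^sub>1 z *s V a\<^sub>0 + lin c\<^sub>2 z *s V a\<^sub>1 + lin (V nf) z *s V f + lin (V ne) z *s V e
    + lin (V np) z *s V p" for z
  proof -
    have "z $ i = (\<Sum>k\<in>UNIV. z $ k * axis k 1 $ i)" for i
      using arg_cong[OF basis_expansion[of z], of "\<lambda>v. v $ i"] by simp
    also have "\<dots> i = (lin c\<^sub>1 z *s V a\<^sub>0 + lin c\<^sub>2 z *s V a\<^sub>1 + lin (V nf) z *s V f + lin (V ne) z *s V e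
      + lin (V np) z *s V p) $ i" for i
      unfolding comp lin_def by (simp add: distrib_left sum.distrib sum_distrib_left sum_distrib_right mult_ac)
    finally show ?thesis by (simp add: vec_eq_iff)
  qed
  have Vsing: "tri F w (V p) (V p) = 0" for w
  proof -
    have 0: "tri F (axis k 1) (V p) (V p) = 0" for k
      using Vtri[of "axis k 1" p p] axK KA inA[of p] p(4) ax \<phi>0 by auto
    have "tri F w (V p) (V p) = lin (\<chi> i. tri F (axis i 1) (V p) (V p)) w"
      by (rule linear_functional_lin) (simp_all add: tri_simps)
    then show ?thesis by (simp add: 0 lin_def)
  qed
  \<comment> \<open>The coordinate normalized to 1 is preserved, so the image of the node is not the
    zero vector.\<close>
  have "V p \<noteq> 0" using p(1) \<phi>0 by (auto simp: V_def vec_eq_iff intro!: exI[of _ i\<^sub>0])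
  then obtain d where d: "V p = d *s p" "d \<noteq> 0" using unique[of "V p"] Vsing by auto
  have mult: "\<exists>b. x = b *s V p" if "x = c' *s p" for x c'
    using that d by (intro exI[of _ "c' / d"]) simp
  have Vlin': "lin (V v) (V w) = \<phi> (lin v w)" "lin c\<^sub>1 (V w) = \<phi> (lin c\<^sub>1 w)" "lin c\<^sub>2 (V w) = \<phi> (lin c\<^sub>2 w)"
    if "v \<in> {nf, ne}" "w \<in> {a\<^sub>0, a\<^sub>1, f, e, p}" for v w
    using Vlin[of v w] Vlin[of c\<^sub>1 w] Vlin[of c\<^sub>2 w] that inA[of v] inA[of w] cA Vc by auto
  have "nodal_frame F c\<^sub>1 c\<^sub>2 (V nf) (V ne) (V np) (V a\<^sub>0) (V a\<^sub>1) (V f) (V e) (V p)"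
  proof
    fix v assume *: "\<And>w. tri F (V p) v w = 0"
    have "tri F p v w = 0" for w using *[of w] d by (simp add: tri_scale)
    then show "\<exists>c. v = c *s V p" using nondeg mult by blast
  next
    fix x :: "complex ^ 'n" assume "x \<noteq> 0" "\<And>w. tri F w x x = 0"
    then show "\<exists>c. x = c *s V p" using unique mult by blast
  next
    fix z show "z = lin c\<^sub>1 z *s V a\<^sub>0 + lin c\<^sub>2 z *s V a\<^sub>1 + lin (V nf) z *s V f + lin (V ne) z *s V e
      + lin (V np) z *s V p" by (rule Vex)
  next
    fix w show "tri F w (V p) (V p) = 0" by (rule Vsing)
  next
    show "tri F (V p) (V e) (V e) = 0" using Vtri[of p e e] inA iso \<phi>0 by simp
  qed (simp_all add: F Vlin'(1) Vlin'(2,3)[of nf] dual p \<phi>0)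
  then show ?thesis by (rule that[OF L]) (simp add: VL)
qed

lemma homogeneous_1_coeff_nonzero:
  fixes l :: "'n::finite cpoly"
  assumes "homogeneous 1 l" "l \<noteq> 0"
  shows "\<exists>i. Poly_Mapping.lookup l (Poly_Mapping.single i 1) \<noteq> 0"
proof -
  obtain m where m: "Poly_Mapping.lookup l m \<noteq> 0"
    using assms(2) by (metis lookup_zero poly_mapping_eqI)
  then have s: "(\<Sum>i\<in>UNIV. Poly_Mapping.lookup m i) = 1"
    using assms(1) by (auto simp: homogeneous_def in_keys_iff)
  then obtain i where "Poly_Mapping.lookup m i = 1" "\<And>j. j \<noteq> i \<Longrightarrow> Poly_Mapping.lookup m j = 0"
    using sum_eq_1_iff[of UNIV "Poly_Mapping.lookup m"] by (metis UNIV_I finite)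
  then have "m = Poly_Mapping.single i 1"
    by (intro poly_mapping_eqI) (auto simp: lookup_single when_def)
  then show ?thesis using m by blast
qed

text \<open>The link from units to density: each triple \<open>u\<close>, \<open>s\<close>,
  \<open>t\<close> at which \<open>Q\<close> is a unit gives an integral point, on which
  \<open>G\<close> vanishes, and \<open>proj_inv\<close> of the triple is a multiple of its
  coordinate vector. The vanishing then spreads by \<open>zero_on_cubic\<close>.\<close>

lemma zero_on_integral_points_imp_zero:
  fixes l\<^sub>1 l\<^sub>2 :: "'n::finite cpoly" and c\<^sub>1 c\<^sub>2 a\<^sub>0 a\<^sub>1 f e p z :: "complex ^ 'n"
  assumes frame: "nodal_frame F c\<^sub>1 c\<^sub>2 nf ne np a\<^sub>0 a\<^sub>1 f e p"
    and L: "number_field L" and M: "M > 0"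
    and l: "homogeneous 1 l\<^sub>1" "homogeneous 1 l\<^sub>2"
    and lc: "\<And>x. eval_poly l\<^sub>1 x = lin c\<^sub>1 x" "\<And>x. eval_poly l\<^sub>2 x = lin c\<^sub>2 x"
    and c: "\<And>i. c\<^sub>1 $ i \<in> S_integers L M" "\<And>i. c\<^sub>2 $ i \<in> S_integers L M"
    and R: "\<And>i. a\<^sub>0 $ i \<in> S_integers L M" "\<And>i. a\<^sub>1 $ i \<in> S_integers L M"
      "\<And>i. f $ i \<in> S_integers L M" "\<And>i. e $ i \<in> S_integers L M" "\<And>i. p $ i \<in> S_integers L M"
      "inverse 6 \<in> S_integers L M" "coeffs_in (S_integers L M) F"
    and dense: "infinite {u \<in> S_units L M. infinite {s \<in> S_integers L M.
      infinite {t \<in> S_integers L M. nodal_frame.Q F p (nodal_frame.affine_point a\<^sub>0 a\<^sub>1 f e u s t) \<in> S_units L M}}}"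
    and G: "homogeneous d G"
      "integral_points L {\<nu>. finite_place L \<nu> \<and> of_nat M \<in> \<nu>} (proj_zeros {F})
        (proj_zeros {F} \<inter> proj_zeros {l\<^sub>1} \<union> proj_zeros {F} \<inter> proj_zeros {l\<^sub>2}) \<subseteq> proj_zeros {G}"
    and z: "eval_poly F z = 0" "eval_poly l\<^sub>1 z \<noteq> 0"
  shows "eval_poly G z = 0"
proof -
  interpret nodal_frame F c\<^sub>1 c\<^sub>2 nf ne np a\<^sub>0 a\<^sub>1 f e p by (rule frame)
  interpret R: subring "S_integers L M" using L by (rule subring_S_integers)
  have zero: "eval_poly G (proj_inv (affine_point u s t)) = 0"
    if u: "u \<in> S_units L M" and s: "s \<in> S_integers L M" and t: "t \<in> S_integers L M"
      and unit: "Q (affine_point u s t) \<in> S_units L M" for u s t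
  proof -
    define y where "y = affine_point u s t"
    define r where "r = - C y * inverse (Q y)"
    define x where "x = y + r *s p"
    have y_R: "y $ i \<in> S_integers L M" for i
      using u s t R unfolding y_def affine_point_def S_units_def by (auto intro!: R.closed)
    have "C y \<in> S_integers L M"
      unfolding C_def using y_R R by (intro tri_in[OF R.subring_axioms]) auto
    then have "r \<in> S_integers L M"
      unfolding r_def using unit by (auto simp: S_units_def y_def intro!: R.closed)
    then have x_R: "x $ i \<in> S_integers L M" for i
      unfolding x_def using y_R R by (auto intro!: R.closed)
    have r: "C y + r * Q y = 0" using unit by (simp add: r_def y_def S_units_def)
    then have Fx: "eval_poly F x = 0" by (simp add: x_def eval_F)
    have lx: "lin c\<^sub>1 x = 1" "lin c\<^sub>2 x = u"
      by (simp_all add: x_def y_def affine_point_def lin_simps dual)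
    then have "x \<noteq> 0" by (auto simp: lin_def)
    then obtain P where P: "x \<in> hom_coords P" using hom_coords_exists by blast
    have "P \<in> proj_zeros {F}" using proj_zeros_iff[OF P hom] Fx by simp
    then have "P \<in> integral_points L {\<nu>. finite_place L \<nu> \<and> of_nat M \<in> \<nu>} (proj_zeros {F})
        (proj_zeros {F} \<inter> proj_zeros {l\<^sub>1} \<union> proj_zeros {F} \<inter> proj_zeros {l\<^sub>2})"
      using u lx R.one_closed by (intro integral_pointI[OF L l lc c _ P x_R]) (auto simp: S_units_def)
    then have "eval_poly G x = 0" using G proj_zeros_iff[OF P G(1)] by auto
    then have "eval_poly G (proj_inv y) = 0"
      unfolding proj_inv_on_cubic[OF r, folded x_def] eval_poly_scale[OF G(1)] by simp
    then show ?thesis by (simp add: y_def)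
  qed
  have dense': "infinite {u. infinite {s. infinite {t. eval_poly G (proj_inv (affine_point u s t)) = 0}}}"
  proof (rule infinite_super[OF _ dense], intro Collect_mono impI, elim conjE)
    fix u assume u: "u \<in> S_units L M" and "infinite {s \<in> S_integers L M.
      infinite {t \<in> S_integers L M. Q (affine_point u s t) \<in> S_units L M}}"
    then show "infinite {s. infinite {t. eval_poly G (proj_inv (affine_point u s t)) = 0}}"
    proof (elim infinite_super[rotated], intro Collect_mono impI, elim conjE)
      fix s assume s: "s \<in> S_integers L M"
        and "infinite {t \<in> S_integers L M. Q (affine_point u s t) \<in> S_units L M}"
      then show "infinite {t. eval_poly G (proj_inv (affine_point u s t)) = 0}"
        using zero[OF u s] by (elim infinite_super[rotated]) blast
    qed
  qed
  show ?thesis by (rule zero_on_cubic[OF G(1) dense' z(1)]) (use z(2) lc in simp)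
qed

theorem proposition4p5p1:
  fixes K :: "complex set"
    and F :: "5 cpoly"
    and P :: "5 proj"
    and B H\<^sub>1 H\<^sub>2 :: "5 proj set"
  assumes "number_field K"
    and "cubic_threefold_form K F"
    and "B = proj_zeros {F}"
    and "singular_points F = {P}"
    and "ordinary_double_point F P"
    and "hyperplane_section K B H\<^sub>1" and "P \<in> H\<^sub>1"
    and "hyperplane_section K B H\<^sub>2" and "P \<in> H\<^sub>2"
    and "H\<^sub>1 \<noteq> H\<^sub>2"
  shows "potentially_dense K B (H\<^sub>1 \<union> H\<^sub>2)"
proof -
  have F: "homogeneous 3 F" "coeffs_in K F" using assms(2) by (auto simp: cubic_threefold_form_def)
  obtain l\<^sub>1 where l1: "l\<^sub>1 \<noteq> 0" "homogeneous 1 l\<^sub>1" "coeffs_in K l\<^sub>1" "H\<^sub>1 = B \<inter> proj_zeros {l\<^sub>1}"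
    using assms(6) unfolding hyperplane_section_def by blast
  obtain l\<^sub>2 where l2: "l\<^sub>2 \<noteq> 0" "homogeneous 1 l\<^sub>2" "coeffs_in K l\<^sub>2" "H\<^sub>2 = B \<inter> proj_zeros {l\<^sub>2}"
    using assms(8) unfolding hyperplane_section_def by blast
  define c\<^sub>1 :: "complex ^ 5" where "c\<^sub>1 = (\<chi> i. Poly_Mapping.lookup l\<^sub>1 (Poly_Mapping.single i 1))"
  define c\<^sub>2 :: "complex ^ 5" where "c\<^sub>2 = (\<chi> i. Poly_Mapping.lookup l\<^sub>2 (Poly_Mapping.single i 1))"
  have lc: "\<And>x. eval_poly l\<^sub>1 x = lin c\<^sub>1 x" "\<And>x. eval_poly l\<^sub>2 x = lin c\<^sub>2 x"
    unfolding c\<^sub>1_def c\<^sub>2_def using l1 l2 eval_poly_homogeneous_1 by auto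
  have cK: "\<And>i. c\<^sub>1 $ i \<in> K" "\<And>i. c\<^sub>2 $ i \<in> K"
    using l1 l2 by (auto simp: c\<^sub>1_def c\<^sub>2_def coeffs_in_def)
  have c0: "c\<^sub>1 \<noteq> 0" "c\<^sub>2 \<noteq> 0"
    using homogeneous_1_coeff_nonzero l1 l2 by (auto simp: c\<^sub>1_def c\<^sub>2_def vec_eq_iff)
  \<comment> \<open>Proportional linear forms would cut out the same section, contrary to
    \<open>H\<^sub>1 \<noteq> H\<^sub>2\<close>.\<close>
  have indep: "c\<^sub>2 \<noteq> \<kappa> *s c\<^sub>1" for \<kappa>
  proof
    assume *: "c\<^sub>2 = \<kappa> *s c\<^sub>1"
    then have "\<kappa> \<noteq> 0" using c0 by auto
    moreover have "lin c\<^sub>2 x = \<kappa> * lin c\<^sub>1 x" for x by (simp add: * lin_def sum_distrib_left mult_ac)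
    ultimately have "proj_zeros {l\<^sub>1} = proj_zeros {l\<^sub>2}" by (simp add: proj_zeros_def lc)
    then show False using assms(10) l1 l2 by simp
  qed
  obtain p :: "complex ^ 5" and i\<^sub>0 where p: "p \<in> hom_coords P" "p $ i\<^sub>0 = 1"
    and hess: "\<And>v. v $ i\<^sub>0 = 0 \<Longrightarrow> (\<And>w. w $ i\<^sub>0 = 0 \<Longrightarrow> hessian_form F p v w = 0) \<Longrightarrow> v = 0"
    using assms(5) unfolding ordinary_double_point_def by blast
  have "P \<in> singular_points F" using assms(4) by simp
  then have "\<forall>i. eval_poly (partial_deriv i F) p = 0"
    using p(1) by (auto simp: singular_points_def proj_zeros_def)
  then have sing: "tri F w p p = 0" for w using partial_derivs_zero_iff_tri[OF F(1)] by blast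
  then have sing': "tri F p w p = 0" "tri F p p w = 0" for w
    using tri_commute12 tri_commute23 by metis+
  have nondeg: "\<exists>c. v = c *s p" if v: "\<And>w. tri F p v w = 0" for v
  proof -
    \<comment> \<open>The ordinary double point condition tests only vectors with vanishing
      \<open>i\<^sub>0\<close>-coordinate; subtracting a multiple of \<open>p\<close>, which lies in
      the kernel, brings \<open>v\<close> among them.\<close>
    define v' where "v' = v + (- (v $ i\<^sub>0)) *s p"
    have "hessian_form F p v' w = 0" for w
      by (simp only: hessian_form_tri[OF F(1)] v'_def tri_simps v sing') simp
    moreover have "v' $ i\<^sub>0 = 0" using p by (simp add: v'_def)
    ultimately have "v' = 0" using hess by blast
    then show ?thesis by (intro exI[of _ "v $ i\<^sub>0"]) (simp add: v'_def)
  qed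
  have unique: "\<exists>c. x = c *s p" if x: "x \<noteq> 0" "\<And>w. tri F w x x = 0" for x
  proof -
    obtain P' where P': "x \<in> hom_coords P'" using hom_coords_exists[OF x(1)] by blast
    have d0: "eval_poly (partial_deriv i F) x = 0" for i
      using partial_derivs_zero_iff_tri[OF F(1)] x(2) by blast
    have "homogeneous 2 (partial_deriv i F)" for i
      using F(1) by (auto intro!: homogeneous_partial_deriv simp: numeral_eq_Suc)
    then have "P' \<in> proj_zeros {partial_deriv i F}" for i using proj_zeros_iff[OF P'] d0 by blast
    moreover have "P' \<in> proj_zeros {F}"
      using proj_zeros_iff[OF P' F(1)] eval_poly_tri[OF F(1)] x(2) by simp
    ultimately have "P' \<in> singular_points F" by (auto simp: singular_points_def proj_zeros_def)
    then have "P' = P" using assms(4) by simp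
    then show ?thesis using P' hom_coords_iff[OF p(1)] by blast
  qed
  have lp: "lin c\<^sub>1 p = 0" "lin c\<^sub>2 p = 0"
    using assms(7,9) l1 l2 p(1) lc by (auto simp: proj_zeros_def)
  have card: "CARD(5) = 5" by simp
  obtain L and nf ne np a\<^sub>0 a\<^sub>1 f e q :: "complex ^ 5" where L: "number_field L" "K \<subseteq> L"
    and frame: "nodal_frame F c\<^sub>1 c\<^sub>2 nf ne np a\<^sub>0 a\<^sub>1 f e q"
    and inL: "\<forall>i. a\<^sub>0 $ i \<in> L \<and> a\<^sub>1 $ i \<in> L \<and> f $ i \<in> L \<and> e $ i \<in> L \<and> q $ i \<in> L"
    by (rule nodal_frame_over_number_field[OF assms(1) F card cK c0(1) indep p(2) lp sing nondeg unique])
  interpret nodal_frame F c\<^sub>1 c\<^sub>2 nf ne np a\<^sub>0 a\<^sub>1 f e q by (rule frame)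
  interpret L: subring L using L(1) by (rule number_field_subring)
  have "inverse 6 \<in> L" by (intro number_field_inverse[OF L(1)] L.numeral_closed)
  moreover have FL: "coeffs_in L F" using F(2) L(2) by (auto simp: coeffs_in_def)
  ultimately have tri_L: "tri F u v w \<in> L" if "\<And>i. u $ i \<in> L" "\<And>i. v $ i \<in> L" "\<And>i. w $ i \<in> L" for u v w :: "complex ^ 5"
    using that by (intro tri_in[OF L.subring_axioms])
  have coef_L: "\<alpha> \<in> L" "\<beta> \<in> L" "\<gamma> \<in> L"
    unfolding \<alpha>_def \<beta>_def \<gamma>_def using inL by (auto intro!: L.closed tri_L)
  have g_L: "g (- \<alpha> / \<beta>) s \<in> L" if "s \<in> {0, 1, -1}" for s
  proof -
    have *: "affine_point u s 0 $ i \<in> L" if "u \<in> L" "s \<in> L" for u s i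
      unfolding affine_point_def using that inL by (auto intro!: L.closed)
    have "- \<alpha> / \<beta> \<in> L" using coef_L by (intro number_field_divide[OF L(1)] L.closed)
    moreover have "s \<in> L" using that by (auto intro: L.closed)
    ultimately show ?thesis
      unfolding g_def Q_def using inL * by (intro L.mult_closed L.numeral_closed tri_L) auto
  qed
  \<comment> \<open>The constants to be made integral or inverted: the frame, the linear forms and
    the cubic, \<open>1 / 6\<close> for the polarization, the coefficients of the slope, and the
    three candidate values of \<open>g\<close> at the root of the slope.\<close>
  define X where "X = (\<Union>v\<in>{c\<^sub>1, c\<^sub>2, a\<^sub>0, a\<^sub>1, f, e, q}. range (($) v)) \<union>
    Poly_Mapping.lookup F ` Poly_Mapping.keys F \<union> {inverse 6, \<alpha>, \<beta>, \<gamma>} \<union>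
    g (- \<alpha> / \<beta>) ` {0, 1, -1}"
  have fin: "finite X" unfolding X_def by simp
  have sub: "X \<subseteq> L"
    unfolding X_def using inL cK L(2) coef_L g_L FL \<open>inverse 6 \<in> L\<close> by (auto simp: coeffs_in_def)
  obtain M where M: "M > 0" "even M"
    and MX: "\<And>x. x \<in> X \<Longrightarrow> x \<in> S_integers L M \<and> inverse x \<in> S_integers L M"
    using finite_subset_S_integers[OF L(1) fin sub] by blast
  interpret R: subring "S_integers L M" using L(1) by (rule subring_S_integers)
  have R: "c\<^sub>1 $ i \<in> S_integers L M" "c\<^sub>2 $ i \<in> S_integers L M"
    "a\<^sub>0 $ i \<in> S_integers L M" "a\<^sub>1 $ i \<in> S_integers L M" "f $ i \<in> S_integers L M"
    "e $ i \<in> S_integers L M" "q $ i \<in> S_integers L M" for i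
    by (intro MX[THEN conjunct1]; auto simp: X_def)+
  have R6: "inverse 6 \<in> S_integers L M" using MX[of "inverse 6"] by (simp add: X_def)
  have RF: "coeffs_in (S_integers L M) F"
    unfolding coeffs_in_def
  proof
    fix m show "Poly_Mapping.lookup F m \<in> S_integers L M"
      using MX[of "Poly_Mapping.lookup F m"] R.zero_closed
      by (cases "m \<in> Poly_Mapping.keys F") (auto simp: X_def in_keys_iff)
  qed
  have inv: "inverse \<alpha> \<in> S_integers L M" "inverse \<beta> \<in> S_integers L M" "inverse \<gamma> \<in> S_integers L M"
    "\<And>s. s \<in> {0, 1, -1} \<Longrightarrow> inverse (g (- \<alpha> / \<beta>) s) \<in> S_integers L M"
    by (intro MX[THEN conjunct2]; auto simp: X_def)+
  note dense = infinite_unit_Q[OF L(1) M R(3-7) R6 RF inv]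
  define S where "S = {\<nu>. finite_place L \<nu> \<and> of_nat M \<in> \<nu>}"
  have S: "finite S" "\<forall>\<nu>\<in>S. finite_place L \<nu>"
    using finite_places_over[OF L(1) M(1)] by (auto simp: S_def)
  have "zariski_dense_in (integral_points L S B (H\<^sub>1 \<union> H\<^sub>2)) (B - (H\<^sub>1 \<union> H\<^sub>2))"
    unfolding zariski_dense_in_def
  proof (intro conjI allI impI subsetI)
    fix Z P' assume Z: "zariski_closed Z \<and> integral_points L S B (H\<^sub>1 \<union> H\<^sub>2) \<subseteq> Z"
      and P': "P' \<in> B - (H\<^sub>1 \<union> H\<^sub>2)"
    obtain T where T: "\<And>G. G \<in> T \<Longrightarrow> \<exists>d. homogeneous d G" "Z = proj_zeros T"
      using Z unfolding zariski_closed_def by blast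
    \<comment> \<open>Each form defining \<open>Z\<close> is treated separately: it vanishes at the
      integral points, hence on the cubic off the first hyperplane, where \<open>P'\<close>
      lies.\<close>
    have "eval_poly G z = 0" if GT: "G \<in> T" and zP: "z \<in> hom_coords P'" for G z
    proof -
      obtain d where d: "homogeneous d G" using T(1) GT by blast
      have "integral_points L S B (H\<^sub>1 \<union> H\<^sub>2) \<subseteq> proj_zeros {G}"
        using Z T(2) GT by (auto simp: proj_zeros_def)
      moreover have "eval_poly F z = 0" "eval_poly l\<^sub>1 z \<noteq> 0"
        using P' assms(3) l1 zP proj_zeros_iff[OF zP F(1)] proj_zeros_iff[OF zP l1(2)] by auto
      ultimately show ?thesis
        using zero_on_integral_points_imp_zero[OF frame L(1) M(1) l1(2) l2(2) lc R R6 RF dense d]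
        unfolding S_def l1(4) l2(4) assms(3) by blast
    qed
    then show "P' \<in> Z" unfolding T(2) proj_zeros_def by blast
  qed (auto simp: integral_points_def)
  then show ?thesis
    unfolding potentially_dense_def using L S by blast
qed

end
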